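(* Let $q$ be a prime power and $\ell,m$ positive integers with $2\le 2\ell\le m$. Let $\mathcal C$ be a nondegenerate $[2\ell,2]_{q^m/q}$ code having at least three codewords of rank weight $\ell$, no two of which are $\mathbb{F}_{q^m}$-proportional. Then $\mathcal C$ is $L_{\mathrm{rk}}$-optimal if and only if $\mathcal C$ is equivalent to a code with one of the following generator matrices: (1) $\begin{bmatrix}1&\lambda&\cdots&\lambda^{\ell-1}&0&0&\cdots&0\\0&0&\cdots&0&1&\lambda&\cdots&\lambda^{\ell-1}\end{bmatrix}$ for some $\lambda\in\mathbb{F}_{q^m}\setminus\mathbb{F}_q$ with $\ell\le\frac{[\mathbb{F}_q(\lambda):\mathbb{F}_q]+1}{2}$ if $\mathbb{F}_q(\lambda)\ne\mathbb{F}_{q^m}$, and $\ell\le\frac m2$ if $\mathbb{F}_q(\lambda)=\mathbb{F}_{q^m}$; (2) $m$ even, $\ell=2l+1$, $\mathbb{F}_{q^2}=\langle1,\xi\rangle_{\mathbb{F}_q}\subseteq\mathbb{F}_{q^m}$, $\lambda\in\mathbb{F}_{q^m}\setminus\mathbb{F}_{q^2}$ with $l<\frac{[\mathbb{F}_{q^2}(\lambda):\mathbb{F}_{q^2}]}{2}$, and the generator matrix $\begin{bmatrix}\mathbf r&\mathbf 0\\\mathbf 0&\mathbf r\end{bmatrix}$ where $\mathbf r=(1,\xi,\lambda,\xi\lambda,\dots,\lambda^{l-1},\xi\lambda^{l-1},\lambda^l)\in\mathbb{F}_{q^m}^{\ell}$ and $\mathbf 0\in\mathbb{F}_{q^m}^\ell$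 is the zero vector.
   Context: $\mathbb{F}_{q^m}$ is the degree-$m$ extension of $\mathbb{F}_q$. Rank weight of $\mathbf v=(v_1,\dots,v_n)\in\mathbb{F}_{q^m}^n$: $\mathrm{w}(\mathbf v)=\dim_{\mathbb{F}_q}\langle v_1,\dots,v_n\rangle_{\mathbb{F}_q}$. An $[n,k]_{q^m/q}$ code is a $k$-dimensional $\mathbb{F}_{q^m}$-subspace $\mathcal C\subseteq\mathbb{F}_{q^m}^n$; a generator matrix is a $k\times n$ matrix over $\mathbb{F}_{q^m}$ whose rows span $\mathcal C$; nondegenerate means the $\mathbb{F}_q$-span of the columns of a generator matrix has $\mathbb{F}_q$-dimension $n$. Two codes $\mathcal C,\mathcal C'$ are equivalent if $\mathcal C'=\mathcal CA=\{\mathbf vA:\mathbf v\in\mathcal C\}$ for some $A\in\mathrm{GL}(n,q)$. $\mathrm{WS}(\mathcal C)=\{\mathrm{w}(\mathbf c):\mathbf c\in\mathcal C\setminus\{\mathbf 0\}\}$. $L_{\mathrm{rk}}(n,m,k,q)$ is the maximum of $|\mathrm{WS}(\mathcal C)|$ over nondegenerate $[n,k]_{q^m/q}$ codes, and a nondegenerate code is $L_{\mathrm{rk}}$-optimal if $|\mathrm{WS}(\mathcal C)|=L_{\mathrm{rk}}(n,m,k,q)$. *)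

theory Defs
  imports
    "Jordan_Normal_Form.VS_Connect"
    "HOL-Algebra.Generated_Fields"
    "HOL-Number_Theory.Prime_Powers"
    "HOL-Library.Cardinality"
begin

text \<open>
  The big field is the type \<open>'a :: {field, finite}\<close>; the subfields of it (the ground field, its
  quadratic extension, the fields generated by an element) are subsets \<open>K :: 'a set\<close> satisfying
  \<open>subfield K class_ring\<close>. Vectors are rows, of type \<open>'a vec\<close>.
\<close>

definition restr_ring :: "'a::field set \<Rightarrow> 'a ring" where
  "restr_ring K = class_ring\<lparr>carrier := K\<rparr>"

definition field_module :: "'a::field itself \<Rightarrow> ('a, 'a) module" where
  "field_module ty =
     \<lparr>carrier = UNIV, monoid.mult = (*), one = 1, zero = 0, add = (+), module.smult = (*)\<rparr>"

text \<open>
  The scalar multiplications of \<open>field_module\<close> and \<open>module_vec\<close> take scalars from all of \<open>'a\<close>;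
  restriction of scalars to \<open>K\<close> is expressed by the ring argument \<open>restr_ring K\<close> alone.
\<close>

lemma field_restr_ring:
  assumes "subfield K (class_ring :: 'a::field ring)"
  shows "field (restr_ring K)"
proof -
  have "ring (class_ring :: 'a ring)"
    using class_field[where 'a = 'a] by (simp add: field_def domain_def cring_def)
  then show ?thesis
    using ring.subfield_iff(2)[OF _ assms] by (simp only: restr_ring_def)
qed

lemma vectorspace_field_module:
  assumes "subfield K (class_ring :: 'a::field ring)"
  shows "vectorspace (restr_ring K) (field_module TYPE('a))"
proof -
  interpret F: field "restr_ring K" by (rule field_restr_ring[OF assms])
  have "abelian_group (field_module TYPE('a))"
  proof (rule abelian_groupI)
    fix x assume "x \<in> carrier (field_module TYPE('a))"
    show "\<exists>y \<in> carrier (field_module TYPE('a)).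
        y \<oplus>\<^bsub>field_module TYPE('a)\<^esub> x = \<zero>\<^bsub>field_module TYPE('a)\<^esub>"
      by (rule bexI[of _ "- x"]) (auto simp: field_module_def)
  qed (auto simp: field_module_def)
  moreover have "module_axioms (restr_ring K) (field_module TYPE('a))"
    by (auto simp: module_axioms_def field_module_def restr_ring_def algebra_simps)
  ultimately show ?thesis
    by (intro vectorspace.intro Module.module.intro F.is_cring F.field_axioms)
qed

lemma vectorspace_module_vec:
  assumes "subfield K (class_ring :: 'a::field ring)"
  shows "vectorspace (restr_ring K) (module_vec TYPE('a) n)"
proof -
  interpret F: field "restr_ring K" by (rule field_restr_ring[OF assms])
  interpret V: vec_module "TYPE('a)" n .
  have "module_axioms (restr_ring K) (module_vec TYPE('a) n)"
    by (auto simp: module_axioms_def module_vec_simps restr_ring_def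
        add_smult_distrib_vec smult_add_distrib_vec smult_smult_assoc)
  then show ?thesis
    by (intro vectorspace.intro Module.module.intro F.is_cring F.field_axioms V.abelian_group_axioms)
qed

definition span_over :: "'a::field set \<Rightarrow> ('a, 'b) module \<Rightarrow> 'b set \<Rightarrow> 'b set" where
  "span_over K V S = LinearCombinations.module.span (restr_ring K) V S"

definition dim_over :: "'a::field set \<Rightarrow> ('a, 'b) module \<Rightarrow> 'b set \<Rightarrow> nat" where
  "dim_over K V W = vectorspace.dim (restr_ring K) (V\<lparr>carrier := W\<rparr>)"

definition adjoin :: "'a::field set \<Rightarrow> 'a \<Rightarrow> 'a set" where
  "adjoin K x = generate_field class_ring (insert x K)"

definition ext_degree :: "'a::field set \<Rightarrow> 'a set \<Rightarrow> nat" where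
  "ext_degree K L = dim_over K (field_module TYPE('a)) L"

definition rank_weight :: "'a::field set \<Rightarrow> 'a vec \<Rightarrow> nat" where
  "rank_weight K v =
     dim_over K (field_module TYPE('a)) (span_over K (field_module TYPE('a)) (set\<^sub>v v))"

definition is_code :: "nat \<Rightarrow> nat \<Rightarrow> 'a::field vec set \<Rightarrow> bool" where
  "is_code n k C \<longleftrightarrow>
     VectorSpace.subspace class_ring C (module_vec TYPE('a) n) \<and>
     vectorspace.dim class_ring ((module_vec TYPE('a) n)\<lparr>carrier := C\<rparr>) = k"

definition generator_matrix :: "nat \<Rightarrow> nat \<Rightarrow> 'a::field mat \<Rightarrow> 'a vec set \<Rightarrow> bool" where
  "generator_matrix n k G C \<longleftrightarrow> G \<in> carrier_mat k n \<and> vec_space.row_space n G = C"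

definition nondegenerate_code :: "'a::field set \<Rightarrow> nat \<Rightarrow> nat \<Rightarrow> 'a vec set \<Rightarrow> bool" where
  "nondegenerate_code K n k C \<longleftrightarrow>
     is_code n k C \<and>
     (\<exists>G. generator_matrix n k G C \<and>
        dim_over K (module_vec TYPE('a) k)
          (span_over K (module_vec TYPE('a) k) (set (cols G))) = n)"

definition GL_over :: "'a::field set \<Rightarrow> nat \<Rightarrow> 'a mat set" where
  "GL_over K n =
     {A \<in> carrier_mat n n. elements_mat A \<subseteq> K \<and>
        (\<exists>B \<in> carrier_mat n n. elements_mat B \<subseteq> K \<and> A * B = 1\<^sub>m n \<and> B * A = 1\<^sub>m n)}"

text \<open>The row vector \<open>v A\<close> is \<open>A\<^sup>T *\<^sub>v v\<close>.\<close>

definition equivalent_codes :: "'a::field set \<Rightarrow> nat \<Rightarrow> 'a vec set \<Rightarrow> 'a vec set \<Rightarrow> bool" where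
  "equivalent_codes K n C C' \<longleftrightarrow> (\<exists>A \<in> GL_over K n. C' = (\<lambda>v. A\<^sup>T *\<^sub>v v) ` C)"

definition weight_spectrum :: "'a::field set \<Rightarrow> nat \<Rightarrow> 'a vec set \<Rightarrow> nat set" where
  "weight_spectrum K n C = rank_weight K ` (C - {0\<^sub>v n})"

text \<open>The parameters \<open>q = card K\<close> and \<open>m\<close>, with \<open>CARD('a) = q ^ m\<close>, are carried by \<open>K :: 'a set\<close>.\<close>

definition L_rk :: "'a::{field, finite} set \<Rightarrow> nat \<Rightarrow> nat \<Rightarrow> nat" where
  "L_rk K n k = Max {card (weight_spectrum K n C) | C. nondegenerate_code K n k C}"

definition L_rk_optimal ::
    "'a::{field, finite} set \<Rightarrow> nat \<Rightarrow> nat \<Rightarrow> 'a vec set \<Rightarrow> bool" where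
  "L_rk_optimal K n k C \<longleftrightarrow>
     nondegenerate_code K n k C \<and> card (weight_spectrum K n C) = L_rk K n k"

definition proportional :: "'a::field vec \<Rightarrow> 'a vec \<Rightarrow> bool" where
  "proportional v w \<longleftrightarrow> (\<exists>a. a \<noteq> 0 \<and> w = a \<cdot>\<^sub>v v)"

definition double_row_mat :: "'a::field vec \<Rightarrow> 'a mat" where
  "double_row_mat r =
     mat_of_rows (2 * dim_vec r) [r @\<^sub>v 0\<^sub>v (dim_vec r), 0\<^sub>v (dim_vec r) @\<^sub>v r]"

definition power_row :: "nat \<Rightarrow> 'a::field \<Rightarrow> 'a vec" where
  "power_row n x = vec n (\<lambda>i. x ^ i)"

text \<open>\<open>(1, \<xi>, x, \<xi> x, \<dots>, x^(l-1), \<xi> x^(l-1), x^l)\<close>, of length \<open>2 l + 1\<close>.\<close>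

definition quad_power_row :: "nat \<Rightarrow> 'a::field \<Rightarrow> 'a \<Rightarrow> 'a vec" where
  "quad_power_row l \<xi> x =
     vec (2 * l + 1) (\<lambda>i. if even i then x ^ (i div 2) else \<xi> * x ^ (i div 2))"

end

theory Submission
  imports Defs "HOL-Library.Set_Algebras"
begin

text \<open>
  Write \<open>F\<close> for the big field. Three pairwise non-proportional words of weight \<open>\<ell>\<close> force the
  \<open>K\<close>-span of the columns of a suitable generator matrix to be \<open>S \<times> S\<close> with \<open>dim S = \<ell>\<close>, so that
  the weights are \<open>\<ell>\<close> and the numbers \<open>2\<ell> - dim (S \<inter> \<nu>S)\<close> with \<open>\<nu> \<noteq> 0\<close>. Since the weights of two
  independent words add up to at least \<open>2\<ell>\<close>, there are at most \<open>\<ell> + 1\<close> weights, and a primitive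
  element of \<open>F\<close> attains this bound. Hence the code is optimal iff \<open>dim (S \<inter> \<nu>S)\<close> takes all values
  from \<open>0\<close> to \<open>\<ell>\<close>.

  A multiplier \<open>\<mu>\<close> with \<open>dim (S \<inter> \<mu>S) = \<ell> - 1\<close> gives \<open>S = W \<oplus> a\<langle>1, \<mu>, \<dots>, \<mu>^(s-1)\<rangle>\<close> with \<open>W\<close> a space
  over \<open>E = K(\<mu>)\<close> and \<open>0 < s < t = [E:K]\<close>. If \<open>W = 0\<close> we are in the first case. Otherwise \<open>S\<close> lies
  between the \<open>E\<close>-spaces \<open>W\<close> and \<open>W \<oplus> aE\<close>, which restricts \<open>dim (S \<inter> \<nu>S)\<close> modulo \<open>t\<close> so much that
  \<open>t = 2\<close> and \<open>s = 1\<close>; repeating the argument over \<open>E\<close> shows that \<open>W\<close> and \<open>W \<oplus> aE\<close> are geometric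
  progressions with the same ratio, and a Moebius change of the ratio yields the second case.
  The value \<open>1\<close> of the intersection dimension gives the bounds on the degrees.

  All dimensions are read off from cardinalities.
\<close>

section \<open>Subfields and subspaces of a finite field\<close>

text \<open>The obstacle is that several fields act on the same sets: \<open>K\<close>, the field E
  generated by \<mu>, and later an extension of E generated by a further multiplier. S is linear
  over \<open>K\<close> only, while the spaces W and W + aE around it are linear over E. For each
  \<nu> the proof therefore compares three numbers: the E-dimensions d and f of the intersections
  formed with the lower and with the upper E-space, and the \<open>K\<close>-dimension of S \<inter>
  \<nu>S. Always f - d is 0, 1 or 2, and each value confines the third number to a narrow window
  above t d. Where the windows leave a gap, a prescribed dimension is missing. Where they do not,
  some \<nu> outside E preserves one of the E-spaces and also a subspace of codimension one in it,
  which is impossible because [E(\<nu>):E] > 1 would divide two consecutive integers. An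
  intersection of dimension 1 bounds the degree because a nonzero common vector writes \<nu> as a
  quotient inside the generated field, so a progression and its multiple by \<nu> lie in one
  multiple of that field.\<close>

abbreviation subfld :: "'a::field set \<Rightarrow> bool" where
  "subfld K \<equiv> subfield K (class_ring :: 'a ring)"

lemma ring_class_ring: "ring (class_ring :: 'a::field ring)"
  using class_field[where 'a = 'a] by (simp add: field_def domain_def cring_def)

lemma inv_class_ring: "x \<noteq> 0 \<Longrightarrow> inv\<^bsub>class_ring\<^esub> x = inverse (x :: 'a::field)"
  by (simp add: class_ring_simps)

lemma subfldI:
  fixes K :: "'a::field set"
  assumes "1 \<in> K" "\<And>x y. x \<in> K \<Longrightarrow> y \<in> K \<Longrightarrow> x + y \<in> K"
    "\<And>x y. x \<in> K \<Longrightarrow> y \<in> K \<Longrightarrow> x * y \<in> K" "\<And>x. x \<in> K \<Longrightarrow> - x \<in> K"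
    "\<And>x. x \<in> K \<Longrightarrow> x \<noteq> 0 \<Longrightarrow> inverse x \<in> K"
  shows "subfld K"
proof -
  show ?thesis
  proof (rule field.subfieldI'[OF class_field])
    show "subring K class_ring"
      by (rule ring.subringI[OF ring_class_ring]) (use assms in \<open>auto simp: class_ring_simps\<close>)
  qed (use assms inv_class_ring in \<open>auto simp: class_ring_simps\<close>)
qed

lemma subfldD:
  fixes K :: "'a::field set"
  assumes "subfld K"
  shows subfld_0: "0 \<in> K" and subfld_1: "1 \<in> K"
    and subfld_add: "\<And>x y. x \<in> K \<Longrightarrow> y \<in> K \<Longrightarrow> x + y \<in> K"
    and subfld_mult: "\<And>x y. x \<in> K \<Longrightarrow> y \<in> K \<Longrightarrow> x * y \<in> K"
    and subfld_uminus: "\<And>x. x \<in> K \<Longrightarrow> - x \<in> K"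
    and subfld_inverse: "\<And>x. x \<in> K \<Longrightarrow> inverse x \<in> K"
proof -
  note K = subfieldE(1)[OF assms]
  show "0 \<in> K" "1 \<in> K"
    using subringE(2,3)[OF K] by (simp_all add: class_ring_simps)
  show "x + y \<in> K" "x * y \<in> K" if "x \<in> K" "y \<in> K" for x y
    using subringE(6,7)[OF K that] by (simp_all add: class_ring_simps)
  show "- x \<in> K" if "x \<in> K" for x
    using subringE(5)[OF K that] by (simp add: class_ring_simps)
  show "inverse x \<in> K" if "x \<in> K" for x
    using ring.subfield_m_inv(1)[OF ring_class_ring assms, of x] that inv_class_ring[of x] \<open>0 \<in> K\<close>
    by (cases "x = 0") (auto simp: class_ring_simps)
qed

lemma subfld_UNIV: "subfld (UNIV :: 'a::field set)"
  by (rule subfldI) auto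

lemma subfld_divide: "subfld K \<Longrightarrow> x \<in> K \<Longrightarrow> y \<in> K \<Longrightarrow> x / y \<in> K"
  by (simp add: divide_inverse subfldD)

text \<open>Multiplication by a nonzero element is injective on the finite set, hence onto, so it
  reaches 1.\<close>

lemma finite_subring_imp_subfld:
  fixes R :: "'a::{field, finite} set"
  assumes "1 \<in> R" "\<And>x y. x \<in> R \<Longrightarrow> y \<in> R \<Longrightarrow> x + y \<in> R"
    "\<And>x y. x \<in> R \<Longrightarrow> y \<in> R \<Longrightarrow> x * y \<in> R" "\<And>x. x \<in> R \<Longrightarrow> - x \<in> R"
  shows "subfld R"
proof (rule subfldI)
  fix x assume x: "x \<in> R" "x \<noteq> 0"
  have "inj_on ((*) x) R" using x by (auto simp: inj_on_def)
  moreover have "(*) x ` R \<subseteq> R" using x assms by auto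
  ultimately have "(*) x ` R = R" by (intro endo_inj_surj) auto
  then obtain y where "y \<in> R" "x * y = 1" using assms(1) by (metis imageE)
  then show "inverse x \<in> R" by (metis inverse_unique)
qed (use assms in auto)

lemma card_subfld_ge_2:
  fixes K :: "'a::{field, finite} set"
  assumes "subfld K" shows "2 \<le> card K"
proof -
  have "card {0, 1::'a} \<le> card K"
    by (rule card_mono) (use assms subfldD in auto)
  then show ?thesis by simp
qed

section \<open>Subspaces of the big field over varying scalar fields\<close>

text \<open>The scalars enter only through the set \<open>K\<close>, so the same V can be a subspace
  over several subfields, and scalars are restricted without touching V. The link to modules is
  \<open>submodule_field_module_iff\<close>.\<close>

definition subsp :: "'a::field set \<Rightarrow> 'a set \<Rightarrow> bool" where
  "subsp K V \<longleftrightarrow> 0 \<in> V \<and> (\<forall>x\<in>V. \<forall>y\<in>V. x + y \<in> V) \<and> (\<forall>k\<in>K. \<forall>x\<in>V. k * x \<in> V)"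

lemma subspD:
  assumes "subsp K V"
  shows subsp_0: "0 \<in> V" and subsp_add: "\<And>x y. x \<in> V \<Longrightarrow> y \<in> V \<Longrightarrow> x + y \<in> V"
    and subsp_mult: "\<And>k x. k \<in> K \<Longrightarrow> x \<in> V \<Longrightarrow> k * x \<in> V"
  using assms by (auto simp: subsp_def)

lemma subsp_uminus: "subfld K \<Longrightarrow> subsp K V \<Longrightarrow> x \<in> V \<Longrightarrow> - x \<in> V"
  using subsp_mult[of K V "- 1" x] subfld_uminus[of K 1] subfld_1[of K] by simp

lemma subsp_diff: "subfld K \<Longrightarrow> subsp K V \<Longrightarrow> x \<in> V \<Longrightarrow> y \<in> V \<Longrightarrow> x - y \<in> V"
  using subsp_add[of K V x "- y"] subsp_uminus[of K V y] by simp

lemma subsp_mono: "subsp E V \<Longrightarrow> K \<subseteq> E \<Longrightarrow> subsp K V"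
  by (auto simp: subsp_def)

lemma subsp_subfld: "subfld E \<Longrightarrow> K \<subseteq> E \<Longrightarrow> subsp K E"
  by (auto simp: subsp_def subfldD)

lemma subsp_Int: "subsp K A \<Longrightarrow> subsp K B \<Longrightarrow> subsp K (A \<inter> B)"
  by (auto simp: subsp_def)

lemma subsp_zero: "subsp K {0}"
  by (auto simp: subsp_def)

lemma subsp_plus:
  assumes "subsp K A" "subsp K B" shows "subsp K (A + B)"
  unfolding subsp_def
proof (intro conjI ballI)
  show "0 \<in> A + B" using assms set_plus_intro[of 0 A 0 B] by (simp add: subspD)
next
  fix x y assume "x \<in> A + B" "y \<in> A + B"
  then obtain a b a' b' where "x = a + b" "y = a' + b'" "a \<in> A" "b \<in> B" "a' \<in> A" "b' \<in> B"
    by (auto elim!: set_plus_elim)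
  then have "x + y = (a + a') + (b + b')" "a + a' \<in> A" "b + b' \<in> B"
    using assms by (auto simp: subspD)
  then show "x + y \<in> A + B" by (metis set_plus_intro)
next
  fix k x assume "k \<in> K" "x \<in> A + B"
  then obtain a b where "x = a + b" "a \<in> A" "b \<in> B"
    by (auto elim!: set_plus_elim)
  then have "k * x = k * a + k * b" "k * a \<in> A" "k * b \<in> B"
    using assms \<open>k \<in> K\<close> by (auto simp: subspD distrib_left)
  then show "k * x \<in> A + B" by (metis set_plus_intro)
qed

lemma subsp_scale:
  assumes "subsp K A" shows "subsp K ((*) c ` A)"
  unfolding subsp_def
proof (intro conjI ballI)
  show "0 \<in> (*) c ` A" using assms by (force simp: subspD)
next
  fix x y assume "x \<in> (*) c ` A" "y \<in> (*) c ` A"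
  then show "x + y \<in> (*) c ` A"
    using assms by (auto simp: subspD distrib_left[symmetric])
next
  fix k x assume "k \<in> K" "x \<in> (*) c ` A"
  then show "k * x \<in> (*) c ` A"
    using assms by (auto simp: subspD mult.left_commute[of k])
qed

lemma subset_plus_left: "subsp K B \<Longrightarrow> A \<subseteq> A + B"
  using set_zero_plus2[of B A] subsp_0[of K B] by (simp add: add.commute)

lemma subset_plus_right: "subsp K A \<Longrightarrow> B \<subseteq> A + B"
  using set_zero_plus2[of A B] subsp_0[of K A] by simp

lemma plus_subset: "subsp K V \<Longrightarrow> A \<subseteq> V \<Longrightarrow> B \<subseteq> V \<Longrightarrow> A + B \<subseteq> V"
  using subsp_add[of K V] by (auto elim!: set_plus_elim)

text \<open>Addition maps A \<times> B onto A + B. The fibre over a + b consists of the pairs (a +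
  z, b - z) with z in A \<inter> B, so all fibres have the same size.\<close>

lemma card_plus_Int:
  fixes A B :: "'a::{field, finite} set"
  assumes K: "subfld K" and A: "subsp K A" and B: "subsp K B"
  shows "card (A + B) * card (A \<inter> B) = card A * card B"
proof -
  let ?f = "\<lambda>(x, y). x + y" and ?g = "\<lambda>c. {p \<in> A \<times> B. (case p of (x, y) \<Rightarrow> x + y) = c}"
  have im: "A + B = ?f ` (A \<times> B)" by (auto simp: set_plus_def)
  have fib: "card (?g c) = card (A \<inter> B)" if "c \<in> A + B" for c
  proof -
    obtain a b where ab: "a \<in> A" "b \<in> B" "c = a + b" using \<open>c \<in> A + B\<close> by (auto elim: set_plus_elim)
    have "bij_betw (\<lambda>z. (a + z, b - z)) (A \<inter> B) (?g c)"
      unfolding bij_betw_def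
    proof
      show "inj_on (\<lambda>z. (a + z, b - z)) (A \<inter> B)" by (auto simp: inj_on_def)
      show "(\<lambda>z. (a + z, b - z)) ` (A \<inter> B) = ?g c"
      proof (intro equalityI subsetI)
        fix p assume "p \<in> (\<lambda>z. (a + z, b - z)) ` (A \<inter> B)"
        then show "p \<in> ?g c"
          using ab subsp_add[OF A] subsp_diff[OF K B] by auto
      next
        fix p assume "p \<in> ?g c"
        then obtain x y where p: "p = (x, y)" "x \<in> A" "y \<in> B" "x + y = a + b" using ab by auto
        have e: "x - a = b - y" using p(4) by (simp add: algebra_simps)
        have "x - a \<in> A" "b - y \<in> B"
          using p ab subsp_diff[OF K A] subsp_diff[OF K B] by auto
        then have "x - a \<in> A \<inter> B" using e by simp
        moreover have "p = (a + (x - a), b - (x - a))" using p(1,4) by (simp add: algebra_simps)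
        ultimately show "p \<in> (\<lambda>z. (a + z, b - z)) ` (A \<inter> B)" by (rule rev_image_eqI)
      qed
    qed
    then show ?thesis by (simp add: bij_betw_same_card)
  qed
  have "card A * card B = card (A \<times> B)" by (simp add: card_cartesian_product)
  also have "A \<times> B = (\<Union>c\<in>A + B. ?g c)" using im by auto
  also have "card \<dots> = (\<Sum>c\<in>A + B. card (?g c))"
    by (rule card_UN_disjoint) auto
  also have "\<dots> = card (A + B) * card (A \<inter> B)" using fib by simp
  finally show ?thesis by simp
qed

lemma line_Int_trivial:
  assumes E: "subfld E" and W: "subsp E W" and a: "a \<notin> W"
  shows "W \<inter> (*) a ` E = {0}"
proof (intro equalityI subsetI)
  fix z assume z: "z \<in> W \<inter> (*) a ` E"
  then obtain k where k: "k \<in> E" "z = a * k" by auto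
  have "k = 0"
  proof (rule ccontr)
    assume "k \<noteq> 0"
    then have "a = inverse k * z" using k by simp
    then show False using a subsp_mult[OF W, of "inverse k" z] z subfld_inverse[OF E k(1)] by simp
  qed
  then show "z \<in> {0}" using k by simp
next
  fix z :: 'a assume "z \<in> {0}"
  then show "z \<in> W \<inter> (*) a ` E" using subsp_0[OF W] subfld_0[OF E] by force
qed

lemma card_plus_line:
  fixes U :: "'a::{field, finite} set"
  assumes K: "subfld K" and U: "subsp K U" and v: "v \<notin> U"
  shows "card (U + (*) v ` K) = card U * card K"
proof -
  have L: "subsp K ((*) v ` K)" using K by (intro subsp_scale subsp_subfld) auto
  have "v \<noteq> 0" using v U by (auto simp: subspD)
  have "card (U + (*) v ` K) = card U * card ((*) v ` K)"
    using card_plus_Int[OF K U L] line_Int_trivial[OF K U v] by simp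
  then show ?thesis using \<open>v \<noteq> 0\<close> by (simp add: card_image inj_on_def)
qed

text \<open>V is reached from U by adding one line at a time, each multiplying the cardinality by
  \<open>card K\<close>. The lower end U is kept variable because the induction enlarges it.\<close>

lemma ex_card_subsp_between:
  fixes U V :: "'a::{field, finite} set"
  assumes K: "subfld K" and "subsp K U" and V: "subsp K V" and "U \<subseteq> V"
  shows "\<exists>d. card V = card U * card K ^ d"
  using assms(2,4)
proof (induction "card V - card U" arbitrary: U rule: less_induct)
  case less
  show ?case
  proof (cases "U = V")
    case True then show ?thesis by (intro exI[of _ 0]) simp
  next
    case False
    then obtain v where v: "v \<in> V" "v \<notin> U" using less.prems by auto
    let ?U = "U + (*) v ` K"
    have L: "subsp K ((*) v ` K)" using K by (intro subsp_scale subsp_subfld) auto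
    have sub: "?U \<subseteq> V"
      using less.prems V v by (intro plus_subset[OF V]) (auto simp: subspD mult.commute[of v])
    have c: "card ?U = card U * card K" by (rule card_plus_line[OF K less.prems(1) v(2)])
    have "card U > 0" using less.prems(1) by (auto simp: card_gt_0_iff dest: subsp_0)
    then have "card U < card ?U" using c card_subfld_ge_2[OF K] by simp
    moreover have "card ?U \<le> card V" using sub by (intro card_mono) auto
    ultimately obtain d where "card V = card ?U * card K ^ d"
      using less.hyps[of ?U] subsp_plus[OF less.prems(1) L] sub by (metis diff_less_mono2 order_less_le_trans)
    then show ?thesis using c by (intro exI[of _ "Suc d"]) simp
  qed
qed

section \<open>Dimension as an exponent of the cardinality\<close>

text \<open>Only the cardinality of V enters, so a nonzero scalar factor cannot change the value,
  and the tower law becomes a law of exponents. If \<open>card V\<close> is no power of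
  \<open>card K\<close>, the value is arbitrary.\<close>

definition vdim :: "'a::field set \<Rightarrow> 'a set \<Rightarrow> nat" where
  "vdim K V = (THE d. card V = card K ^ d)"

lemma vdim_eqI:
  fixes K :: "'a::{field, finite} set"
  assumes "subfld K" "card V = card K ^ d" shows "vdim K V = d"
  unfolding vdim_def using card_subfld_ge_2[OF assms(1)] assms(2) by (auto intro!: the_equality)

lemma card_eq_vdim:
  fixes K :: "'a::{field, finite} set"
  assumes "subfld K" "subsp K V" shows "card V = card K ^ vdim K V"
proof -
  obtain d where d: "card V = card K ^ d"
    using ex_card_subsp_between[OF assms(1) subsp_zero[of K] assms(2)] assms(2) by (auto dest: subsp_0)
  then show ?thesis using vdim_eqI[OF assms(1) d] by simp
qed

lemma vdim_plus_Int:
  fixes K :: "'a::{field, finite} set"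
  assumes K: "subfld K" and A: "subsp K A" and B: "subsp K B"
  shows "vdim K (A + B) + vdim K (A \<inter> B) = vdim K A + vdim K B"
proof -
  have "card K ^ (vdim K (A + B) + vdim K (A \<inter> B)) = card K ^ (vdim K A + vdim K B)"
    using card_plus_Int[OF assms]
      card_eq_vdim[OF K] A B subsp_plus[OF A B] subsp_Int[OF A B]
    by (metis power_add)
  then show ?thesis using card_subfld_ge_2[OF K] by simp
qed

lemma vdim_mono:
  fixes K :: "'a::{field, finite} set"
  assumes K: "subfld K" and A: "subsp K A" and B: "subsp K B" and "A \<subseteq> B"
  shows "vdim K A \<le> vdim K B"
proof -
  have "card K ^ vdim K A \<le> card K ^ vdim K B"
    using card_eq_vdim[OF K A] card_eq_vdim[OF K B] card_mono[of B A] \<open>A \<subseteq> B\<close> by simp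
  then show ?thesis using card_subfld_ge_2[OF K] by (simp add: power_increasing_iff)
qed

lemma vdim_subset_eq:
  fixes K :: "'a::{field, finite} set"
  assumes K: "subfld K" and A: "subsp K A" and B: "subsp K B" and "A \<subseteq> B" "vdim K A \<ge> vdim K B"
  shows "A = B"
proof -
  have "vdim K A = vdim K B" using vdim_mono[OF assms(1-4)] assms(5) by simp
  then show ?thesis
    using card_eq_vdim[OF K A] card_eq_vdim[OF K B] \<open>A \<subseteq> B\<close> by (intro card_subset_eq) auto
qed

lemma vdim_scale:
  fixes K :: "'a::{field, finite} set"
  assumes "c \<noteq> 0" shows "vdim K ((*) c ` A) = vdim K A"
proof -
  have "card ((*) c ` A) = card A" using assms by (intro card_image) (auto simp: inj_on_def)
  then show ?thesis by (simp add: vdim_def)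
qed

lemma vdim_plus_line:
  fixes K :: "'a::{field, finite} set"
  assumes K: "subfld K" and U: "subsp K U" and v: "v \<notin> U"
  shows "vdim K (U + (*) v ` K) = Suc (vdim K U)"
  using card_plus_line[OF assms] card_eq_vdim[OF K U] by (intro vdim_eqI[OF K]) simp

lemma vdim_zero: "subfld (K :: 'a::{field, finite} set) \<Longrightarrow> vdim K {0} = 0"
  by (rule vdim_eqI) auto

lemma vdim_eq_0:
  fixes K :: "'a::{field, finite} set"
  assumes K: "subfld K" and A: "subsp K A" and "vdim K A = 0" shows "A = {0}"
  using vdim_subset_eq[OF K subsp_zero A] assms subsp_0[OF A] vdim_zero[OF K] by auto

lemma vdim_self: "subfld (K :: 'a::{field, finite} set) \<Longrightarrow> vdim K K = 1"
  by (rule vdim_eqI) auto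

lemma vdim_tower:
  fixes K :: "'a::{field, finite} set"
  assumes K: "subfld K" and E: "subfld E" and "K \<subseteq> E" and V: "subsp E V"
  shows "vdim K V = vdim K E * vdim E V"
  using card_eq_vdim[OF E V] card_eq_vdim[OF K subsp_subfld[OF E \<open>K \<subseteq> E\<close>]]
  by (intro vdim_eqI[OF K]) (simp add: power_mult)

subsection \<open>Simple extensions\<close>

lemma subfld_adjoin: "subfld (adjoin K (x :: 'a::field))"
proof -
  show ?thesis unfolding adjoin_def by (rule field.generate_field_is_subfield[OF class_field]) (simp add: class_ring_simps)
qed

lemma adjoin_incl: "K \<subseteq> adjoin K x" "x \<in> adjoin K x"
  unfolding adjoin_def by (auto intro: generate_field.incl)

lemma adjoin_least:
  fixes x :: "'a::field"
  assumes "subfld E" "K \<subseteq> E" "x \<in> E" shows "adjoin K x \<subseteq> E"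
proof -
  show ?thesis unfolding adjoin_def
    by (rule field.generate_field_min_subfield1[OF class_field]) (use assms in \<open>auto simp: class_ring_simps\<close>)
qed

text \<open>The c with cV \<subseteq> V form a subring, by finiteness a subfield, which contains
  \<open>K\<close> and x and therefore the field they generate.\<close>

lemma subsp_adjoinI:
  fixes V :: "'a::{field, finite} set"
  assumes K: "subfld K" and V: "subsp K V" and x: "(*) x ` V \<subseteq> V"
  shows "subsp (adjoin K x) V"
proof -
  let ?R = "{c. (*) c ` V \<subseteq> V}"
  have "subfld ?R"
    by (rule finite_subring_imp_subfld)
      (use V subsp_uminus[OF K V] in \<open>auto simp: subspD distrib_right mult.assoc image_subset_iff\<close>)
  then have "adjoin K x \<subseteq> ?R" by (rule adjoin_least) (use V x in \<open>auto simp: subspD\<close>)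
  then show ?thesis using V by (auto simp: subsp_def)
qed

text \<open>The values at x of the polynomials over \<open>K\<close> of degree below n. Building it
  one line per power lets \<open>vdim_plus_line\<close> count dimensions.\<close>

primrec pspan :: "'a::field set \<Rightarrow> 'a \<Rightarrow> nat \<Rightarrow> 'a set" where
  "pspan K x 0 = {0}"
| "pspan K x (Suc n) = pspan K x n + (*) (x ^ n) ` K"

lemma subsp_pspan: "subfld K \<Longrightarrow> subsp K (pspan K x n)"
  by (induction n) (auto intro: subsp_zero subsp_plus subsp_scale subsp_subfld)

lemma pspan_mono:
  assumes "subfld K" "i \<le> j" shows "pspan K x i \<subseteq> pspan K x j"
  using assms(2)
proof (induction rule: dec_induct)
  case (step n)
  have "pspan K x n \<subseteq> pspan K x (Suc n)"
    unfolding pspan.simps using assms(1) by (intro subset_plus_left subsp_scale subsp_subfld) auto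
  then show ?case using step by auto
qed auto

lemma power_in_pspan:
  assumes K: "subfld K" and "i < n" shows "x ^ i \<in> pspan K x n"
proof -
  have "x ^ i * 1 \<in> (*) (x ^ i) ` K" using subfld_1[OF K] by (rule imageI)
  then have "x ^ i \<in> pspan K x (Suc i)"
    using subset_plus_right[OF subsp_pspan[OF K, of x i], of "(*) (x ^ i) ` K"] by auto
  then show ?thesis using pspan_mono[OF K, of "Suc i" n x] assms(2) by auto
qed

lemma pspan_least:
  assumes "subsp K V" "\<And>i. i < n \<Longrightarrow> x ^ i \<in> V" shows "pspan K x n \<subseteq> V"
  using assms(2)
proof (induction n)
  case 0 then show ?case using assms(1) by (auto simp: subspD)
next
  case (Suc n)
  have "(*) (x ^ n) ` K \<subseteq> V"
    using Suc.prems[of n] subsp_mult[OF assms(1)] by (auto simp: mult.commute[of "x ^ n"])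
  then show ?case unfolding pspan.simps using Suc by (intro plus_subset[OF assms(1)]) auto
qed

lemma scale_pspan_subset:
  assumes K: "subfld K" and V: "subsp K V" and "\<And>i. i < n \<Longrightarrow> c * x ^ i \<in> V"
  shows "(*) c ` pspan K x n \<subseteq> V"
proof -
  have "subsp K {v. c * v \<in> V}"
    using V by (auto simp: subsp_def distrib_left mult.left_commute[of c])
  then have "pspan K x n \<subseteq> {v. c * v \<in> V}" by (rule pspan_least) (use assms in auto)
  then show ?thesis by auto
qed

lemma mult_pspan:
  assumes K: "subfld K" and "u \<in> pspan K x (Suc i)" "v \<in> pspan K x (Suc j)"
  shows "u * v \<in> pspan K x (Suc (i + j))"
proof -
  have 1: "(*) (x ^ k) ` pspan K x (Suc j) \<subseteq> pspan K x (Suc (i + j))" if "k < Suc i" for k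
    using that power_in_pspan[OF K, of "k + _" "Suc (i + j)" x]
    by (intro scale_pspan_subset[OF K subsp_pspan[OF K]]) (simp only: power_add[symmetric])
  have "(*) v ` pspan K x (Suc i) \<subseteq> pspan K x (Suc (i + j))"
    using 1 assms(3) by (intro scale_pspan_subset[OF K subsp_pspan[OF K]])
      (metis image_subset_iff mult.commute)
  then show ?thesis using assms(2) by (auto simp: mult.commute[of u])
qed

lemma subfld_power: "subfld K \<Longrightarrow> x \<in> K \<Longrightarrow> x ^ n \<in> K"
  by (induction n) (auto simp: subfldD)

lemma pspan_subset_adjoin: "subfld K \<Longrightarrow> pspan K x n \<subseteq> adjoin K x"
  by (intro pspan_least subsp_subfld subfld_adjoin adjoin_incl subfld_power)

lemma pspan_adjoin:
  fixes K :: "'a::{field, finite} set"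
  assumes K: "subfld K"
  shows pspan_vdim_adjoin: "pspan K x (vdim K (adjoin K x)) = adjoin K x"
    and vdim_pspan: "n \<le> vdim K (adjoin K x) \<Longrightarrow> vdim K (pspan K x n) = n"
    and power_notin_pspan: "n < vdim K (adjoin K x) \<Longrightarrow> x ^ n \<notin> pspan K x n"
proof -
  let ?P = "pspan K x"
  have sP: "subsp K (?P n)" for n by (rule subsp_pspan[OF K])
  have dim: "vdim K (?P n) = n" if "\<And>i. i < n \<Longrightarrow> x ^ i \<notin> ?P i" for n
    using that by (induction n) (simp_all add: vdim_zero[OF K] vdim_plus_line[OF K sP])
  have "\<exists>n. x ^ n \<in> ?P n"
  proof (rule ccontr)
    assume "\<nexists>n. x ^ n \<in> ?P n"
    then have "vdim K (?P n) = n" for n using dim by blast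
    moreover have "vdim K (?P n) \<le> vdim K UNIV" for n
      by (rule vdim_mono[OF K sP]) (auto simp: subsp_def)
    ultimately show False by (metis Suc_n_not_le_n)
  qed
  \<comment> \<open>The degree of the minimal polynomial of x: below t each power is a new
    direction, and at t the span becomes stable under x, hence a space over the generated
    field.\<close>
  define t where "t = (LEAST n. x ^ n \<in> ?P n)"
  have t: "x ^ t \<in> ?P t" unfolding t_def by (rule LeastI_ex) fact
  have less: "x ^ i \<notin> ?P i" if "i < t" for i using not_less_Least that unfolding t_def by blast
  have "t \<noteq> 0" using t by (intro notI) simp
  have "(*) x ` ?P t \<subseteq> ?P t"
  proof (rule scale_pspan_subset[OF K sP])
    fix i assume "i < t"
    then show "x * x ^ i \<in> ?P t"
      using power_in_pspan[OF K, of "Suc i" t x] t by (cases "Suc i = t") auto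
  qed
  then have "subsp (adjoin K x) (?P t)" by (rule subsp_adjoinI[OF K sP])
  moreover have "1 \<in> ?P t" using power_in_pspan[OF K, of 0 t x] \<open>t \<noteq> 0\<close> by simp
  ultimately have "adjoin K x \<subseteq> ?P t" by (metis mult.right_neutral subsetI subsp_mult)
  then have eq: "?P t = adjoin K x" using pspan_subset_adjoin[OF K] by blast
  then have td: "vdim K (adjoin K x) = t" using dim[of t] less by simp
  show "?P (vdim K (adjoin K x)) = adjoin K x" using eq td by simp
  show "vdim K (?P n) = n" if "n \<le> vdim K (adjoin K x)" using that td less by (intro dim) auto
  show "x ^ n \<notin> ?P n" if "n < vdim K (adjoin K x)" using that td less by auto
qed

lemma vdim_adjoin_gt_0:
  fixes K :: "'a::{field, finite} set"
  assumes K: "subfld K" shows "vdim K (adjoin K x) > 0"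
proof -
  have "vdim K K \<le> vdim K (adjoin K x)"
    by (intro vdim_mono K subsp_subfld subfld_adjoin adjoin_incl order_refl)
  then show ?thesis using vdim_self[OF K] by simp
qed

lemma adjoin_eq_self_iff:
  fixes K :: "'a::{field, finite} set"
  assumes K: "subfld K" shows "vdim K (adjoin K x) = 1 \<longleftrightarrow> x \<in> K"
proof
  assume "vdim K (adjoin K x) = 1"
  then have "K = adjoin K x"
    by (intro vdim_subset_eq[OF K] subsp_subfld subfld_adjoin adjoin_incl K order_refl)
      (simp add: vdim_self[OF K])
  then show "x \<in> K" using adjoin_incl(2) by metis
next
  assume "x \<in> K"
  then have "adjoin K x = K" using adjoin_least[OF K order_refl] adjoin_incl(1) by blast
  then show "vdim K (adjoin K x) = 1" by (simp add: vdim_self[OF K])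
qed

section \<open>Subspaces that almost coincide with a scalar multiple\<close>

lemma hyperplane_decomposition:
  fixes K :: "'a::{field, finite} set"
  assumes K: "subfld K" and S: "subsp K S" and T: "subsp K T" and "T \<subseteq> S"
    and dim: "vdim K S = Suc (vdim K T)" and u: "u \<in> S" "u \<notin> T"
  shows "S = T + (*) u ` K"
proof -
  have "T + (*) u ` K \<subseteq> S"
    using \<open>T \<subseteq> S\<close> u(1) subsp_mult[OF S] by (intro plus_subset[OF S]) (auto simp: mult.commute[of u])
  then show ?thesis
    using vdim_subset_eq[OF K subsp_plus[OF T subsp_scale[OF subsp_subfld[OF K order_refl]]] S]
      vdim_plus_line[OF K T u(2)] dim by (metis order_refl)
qed

text \<open>The key is that a vector whose first \<open>s\<close> multiples by powers of \<open>\<mu>\<close> stay in \<open>S\<close>, with \<open>s\<close>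
  maximal, fills the hyperplane \<open>{v \<in> S. \<mu> v \<in> S}\<close> up to \<open>S\<close>; subtracting its multiples moves
  every vector of \<open>S\<close> into the largest \<open>K(\<mu>)\<close>-subspace of \<open>S\<close>.\<close>

lemma near_invariant_decomposition:
  fixes K :: "'a::{field, finite} set"
  assumes K: "subfld K" and S: "subsp K S" and mu: "\<mu> \<noteq> 0"
    and dim: "vdim K S = Suc (vdim K (S \<inter> (*) \<mu> ` S))"
  obtains W a s where "subsp (adjoin K \<mu>) W" "a \<notin> W" "0 < s" "s < vdim K (adjoin K \<mu>)"
    "S = W + (*) a ` pspan K \<mu> s"
proof -
  define E where "E = adjoin K \<mu>"
  define t where "t = vdim K E"
  have E: "subfld E" and KE: "K \<subseteq> E" and muE: "\<mu> \<in> E"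
    unfolding E_def by (rule subfld_adjoin adjoin_incl)+
  \<comment> \<open>The largest E-linear subspace of S.\<close>
  define W where "W = {v. \<forall>c\<in>E. c * v \<in> S}"
  have W: "subsp E W"
    using S E by (auto simp: subsp_def W_def distrib_left mult.assoc[symmetric] subfldD)
  have WS: "W \<subseteq> S" using subfld_1[OF E] by (force simp: W_def)
  \<comment> \<open>T is the preimage of S \<inter> \<mu>S under \<mu>, hence a hyperplane of
    S.\<close>
  define T where "T = {v \<in> S. \<mu> * v \<in> S}"
  have T: "subsp K T"
    using S by (auto simp: T_def subsp_def distrib_left mult.left_commute[of \<mu>])
  have "(*) \<mu> ` T = S \<inter> (*) \<mu> ` S" by (auto simp: T_def)
  then have dimT: "vdim K S = Suc (vdim K T)" using dim vdim_scale[OF mu, of K T] by simp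
  \<comment> \<open>A chain of s successive multiples inside S that starts outside W. A chain of
    length t would put all of aE into S, hence a into W; this is \<open>bound\<close>.\<close>
  define good where "good s a \<longleftrightarrow> a \<notin> W \<and> (\<forall>i<s. \<mu> ^ i * a \<in> S)" for s a
  have bound: "s < t" if "good s a" for s a
  proof (rule ccontr)
    assume "\<not> s < t"
    then have "(*) a ` pspan K \<mu> t \<subseteq> S"
      using that by (intro scale_pspan_subset[OF K S]) (auto simp: good_def mult.commute[of a])
    then have "a \<in> W" using pspan_vdim_adjoin[OF K, of \<mu>] unfolding W_def t_def E_def
      by (auto simp: mult.commute[of _ a])
    then show False using that by (simp add: good_def)
  qed
  have "T \<noteq> S" using dimT by auto
  then obtain a0 where "a0 \<in> S" "\<mu> * a0 \<notin> S" by (auto simp: T_def)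
  then have g1: "good 1 a0" using muE by (auto simp: good_def W_def)
  define s where "s = Max {s. \<exists>a. good s a}"
  have fin: "finite {s. \<exists>a. good s a}" by (rule finite_subset[of _ "{..<t}"]) (use bound in auto)
  have "s \<in> {s. \<exists>a. good s a}" unfolding s_def by (rule Max_in[OF fin]) (use g1 in auto)
  then obtain a where a: "good s a" by auto
  have max: "s' \<le> s" if "good s' a'" for s' a'
    unfolding s_def by (rule Max_ge[OF fin]) (use that in auto)
  have s: "0 < s" "s < t" using max[OF g1] bound[OF a] by auto
  have aS: "\<mu> ^ i * a \<in> S" if "i < s" for i using a that by (auto simp: good_def)
  \<comment> \<open>The last vector of a longest chain: it lies in S, but \<mu>u does not, so u
    spans a complement of T.\<close>
  define u where "u = \<mu> ^ (s - 1) * a"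
  have u: "u \<in> S" "u \<notin> T"
  proof -
    show "u \<in> S" using aS s by (simp add: u_def)
    show "u \<notin> T"
    proof
      assume "u \<in> T"
      then have "\<mu> ^ s * a \<in> S" using s
        by (auto simp: T_def u_def mult.assoc[symmetric] power_Suc[symmetric] simp del: power_Suc)
      then have "good (Suc s) a" using a by (auto simp: good_def less_Suc_eq)
      then show False using max by fastforce
    qed
  qed
  have dec: "S = T + (*) u ` K"
    by (rule hyperplane_decomposition[OF K S T _ dimT u]) (auto simp: T_def)
  let ?A = "(*) a ` pspan K \<mu> s"
  have A: "subsp K ?A" by (intro subsp_scale subsp_pspan K)
  have AS: "?A \<subseteq> S"
    using aS by (intro scale_pspan_subset[OF K S]) (auto simp: mult.commute[of a])
  \<comment> \<open>Each stage corrects w by a multiple of an earlier chain vector: from \<mu>^i w =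
    \<tau> + u k subtract k \<mu>^(s-1-i) a, whose multiple by \<mu>^i is exactly k u. The next
    multiple is then \<mu>\<tau>, which lies in S, and the multiples up to i stay in S because j +
    (s - 1 - i) < s.\<close>
  have step: "\<exists>w. v - w \<in> ?A \<and> (\<forall>j\<le>i. \<mu> ^ j * w \<in> S)" if "v \<in> S" "i \<le> s" for v i
    using that(2)
  proof (induction i)
    case 0
    have "v - v \<in> ?A" using subsp_0[OF A] by simp
    then show ?case using \<open>v \<in> S\<close> by (intro exI[of _ v]) auto
  next
    case (Suc i)
    then obtain w where w: "v - w \<in> ?A" "\<And>j. j \<le> i \<Longrightarrow> \<mu> ^ j * w \<in> S" by auto
    obtain \<tau> k where tk: "\<mu> ^ i * w = \<tau> + u * k" "\<tau> \<in> T" "k \<in> K"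
      using w(2)[of i] dec by (auto elim: set_plus_elim)
    let ?w = "w - k * (\<mu> ^ (s - 1 - i) * a)"
    have "a * \<mu> ^ (s - 1 - i) \<in> ?A" using Suc.prems by (intro imageI power_in_pspan[OF K]) auto
    then have "k * (\<mu> ^ (s - 1 - i) * a) \<in> ?A"
      using subsp_mult[OF A tk(3)] by (metis mult.commute)
    then have "(v - w) + k * (\<mu> ^ (s - 1 - i) * a) \<in> ?A" by (rule subsp_add[OF A w(1)])
    moreover have "(v - w) + k * (\<mu> ^ (s - 1 - i) * a) = v - ?w" by simp
    ultimately have 1: "v - ?w \<in> ?A" by (simp only:)
    have 2: "\<mu> ^ j * ?w \<in> S" if "j \<le> Suc i" for j
    proof (cases "j = Suc i")
      case True
      have "\<mu> ^ i * ?w = \<mu> ^ i * w - k * (\<mu> ^ (i + (s - 1 - i)) * a)"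
        by (simp add: algebra_simps power_add)
      also have "i + (s - 1 - i) = s - 1" using Suc.prems by simp
      also have "\<mu> ^ i * w - k * (\<mu> ^ (s - 1) * a) = \<tau>" unfolding tk(1) u_def by (simp add: algebra_simps)
      finally have "\<mu> ^ j * ?w = \<mu> * \<tau>" using True by (simp add: mult.assoc)
      then show ?thesis using tk(2) by (simp add: T_def)
    next
      case False
      then have "j \<le> i" using that by simp
      have e: "\<mu> ^ j * ?w = \<mu> ^ j * w - k * (\<mu> ^ (j + (s - 1 - i)) * a)"
        by (simp add: algebra_simps power_add)
      have "j + (s - 1 - i) < s" using \<open>j \<le> i\<close> Suc.prems by simp
      then show ?thesis unfolding e
        by (intro subsp_diff[OF K S] w(2) subsp_mult[OF S tk(3)] aS \<open>j \<le> i\<close>)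
    qed
    show ?case using 1 2 by blast
  qed
  have "S \<subseteq> W + ?A"
  proof
    fix v assume "v \<in> S"
    then obtain w where w: "v - w \<in> ?A" "\<forall>j\<le>s. \<mu> ^ j * w \<in> S" using step by blast
    \<comment> \<open>Otherwise w would start a chain of length s + 1.\<close>
    have "w \<in> W"
    proof (rule ccontr)
      assume "w \<notin> W"
      then have "good (Suc s) w" using w(2) by (auto simp: good_def less_Suc_eq_le)
      then show False using max by fastforce
    qed
    then have "w + (v - w) \<in> W + ?A" using w(1) by (rule set_plus_intro)
    then show "v \<in> W + ?A" by simp
  qed
  moreover have "W + ?A \<subseteq> S" by (rule plus_subset[OF S WS AS])
  ultimately have "S = W + ?A" by blast
  moreover have "a \<notin> W" using a by (simp add: good_def)
  ultimately show thesis using that W s by (simp add: E_def t_def)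
qed

lemma vdim_near_invariant:
  fixes K :: "'a::{field, finite} set"
  assumes K: "subfld K" and E: "E = adjoin K \<mu>" and W: "subsp E W" and a: "a \<notin> W"
    and s: "s \<le> vdim K E"
  shows "vdim K (W + (*) a ` pspan K \<mu> s) = vdim K E * vdim E W + s"
proof -
  have sE: "subfld E" and KE: "K \<subseteq> E" unfolding E by (rule subfld_adjoin adjoin_incl)+
  have "a \<noteq> 0" using a subsp_0[OF W] by auto
  have WK: "subsp K W" by (rule subsp_mono[OF W KE])
  have A: "subsp K ((*) a ` pspan K \<mu> s)" by (intro subsp_scale subsp_pspan K)
  have "W \<inter> (*) a ` pspan K \<mu> s \<subseteq> {0}"
    using line_Int_trivial[OF sE W a] pspan_subset_adjoin[OF K, of \<mu> s] unfolding E by blast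
  then have "W \<inter> (*) a ` pspan K \<mu> s = {0}" using subsp_0[OF WK] subsp_0[OF A] by auto
  then have "vdim K (W + (*) a ` pspan K \<mu> s) = vdim K W + vdim K ((*) a ` pspan K \<mu> s)"
    using vdim_plus_Int[OF K WK A] vdim_zero[OF K] by simp
  then show ?thesis
    using vdim_scale[OF \<open>a \<noteq> 0\<close>] vdim_pspan[OF K] s vdim_tower[OF K sE KE W] by (simp add: E)
qed

section \<open>K-spaces between two E-spaces of consecutive dimensions\<close>

text \<open>Keeps from a decomposition of S only what is needed to intersect S with its multiples; s
  is the K-dimension of S modulo W.\<close>

definition sandwich :: "'a::field set \<Rightarrow> 'a set \<Rightarrow> nat \<Rightarrow> nat \<Rightarrow> 'a set \<Rightarrow> 'a set \<Rightarrow> 'a set \<Rightarrow> bool" where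
  "sandwich K E w s W S P \<longleftrightarrow> subsp E W \<and> subsp E P \<and> subsp K S \<and> W \<subseteq> S \<and> S \<subseteq> P \<and>
     vdim E W = w \<and> vdim E P = Suc w \<and> vdim K S = vdim K E * w + s"

lemma sandwich_scale:
  fixes K :: "'a::{field, finite} set"
  assumes "sandwich K E w s W S P" "c \<noteq> 0"
  shows "sandwich K E w s ((*) c ` W) ((*) c ` S) ((*) c ` P)"
  using assms unfolding sandwich_def by (auto simp: vdim_scale intro: subsp_scale)

text \<open>If Q is not inside W, then W + Q is all of P by dimension, hence so is S + Q, and the
  dimension formula fixes both intersections: S \<inter> Q is again squeezed between W \<inter> Q
  and Q, with the same s.\<close>

lemma sandwich_Int:
  fixes K :: "'a::{field, finite} set"
  assumes K: "subfld K" and E: "subfld E" and KE: "K \<subseteq> E"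
    and sw: "sandwich K E w s W S P" and Q: "subsp E Q" and "Q \<subseteq> P"
  shows "Q \<subseteq> W \<or> (vdim E Q = Suc (vdim E (W \<inter> Q)) \<and>
    vdim K (S \<inter> Q) = vdim K E * vdim E (W \<inter> Q) + s)"
proof (cases "Q \<subseteq> W")
  case False
  have W: "subsp E W" and P: "subsp E P" and S: "subsp K S" and sub: "W \<subseteq> S" "S \<subseteq> P"
    and dims: "vdim E W = w" "vdim E P = Suc w" "vdim K S = vdim K E * w + s"
    using sw by (auto simp: sandwich_def)
  have "W + Q \<subseteq> P" using sub \<open>Q \<subseteq> P\<close> by (intro plus_subset[OF P]) auto
  have WQ: "subsp E (W + Q)" by (rule subsp_plus[OF W Q])
  have "\<not> vdim E (W + Q) \<le> w"
    using vdim_subset_eq[OF E W WQ subset_plus_left[OF Q]] subset_plus_right[OF W, of Q] False dims(1)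
    by auto
  then have eq: "W + Q = P" using dims(2) by (intro vdim_subset_eq[OF E WQ P \<open>W + Q \<subseteq> P\<close>]) auto
  then have 1: "vdim E Q = Suc (vdim E (W \<inter> Q))" using vdim_plus_Int[OF E W Q] dims by simp
  have QK: "subsp K Q" and PK: "subsp K P" using Q P KE by (auto intro: subsp_mono)
  have "S + Q \<subseteq> P" using sub \<open>Q \<subseteq> P\<close> by (intro plus_subset[OF P]) auto
  moreover have "W + Q \<subseteq> S + Q" by (rule set_plus_mono2) (use sub in auto)
  ultimately have "S + Q = P" using eq by auto
  then have "vdim K P + vdim K (S \<inter> Q) = vdim K S + vdim K Q" using vdim_plus_Int[OF K S QK] by simp
  then have "vdim K E * Suc w + vdim K (S \<inter> Q) = vdim K E * w + s + vdim K E * Suc (vdim E (W \<inter> Q))"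
    using vdim_tower[OF K E KE] P Q dims 1 by simp
  then show ?thesis using 1 by simp
qed auto

text \<open>Everything happens in Q = P1 \<inter> P2, where \<open>sandwich_Int\<close> applies to
  both triples. If Q lies in both lower spaces, then X = t d. If it lies in just one, or if both cut
  the same hyperplane out of Q, then f = d + 1 and X is confined to a range. Two different
  hyperplanes add up to Q, so the sum of the two K-spaces is Q and X is determined.\<close>

lemma sandwich_Int_sandwich:
  fixes K :: "'a::{field, finite} set"
  assumes K: "subfld K" and E: "subfld E" and KE: "K \<subseteq> E"
    and sw1: "sandwich K E w s W1 S1 P1" and sw2: "sandwich K E w s W2 S2 P2"
    and st: "s \<le> vdim K E"
  defines "t \<equiv> vdim K E" and "d \<equiv> vdim E (W1 \<inter> W2)" and "f \<equiv> vdim E (P1 \<inter> P2)"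
    and "X \<equiv> vdim K (S1 \<inter> S2)"
  shows "(f = d \<and> X = t * d) \<or>
    (f = Suc d \<and> t * d \<le> X \<and> t * d + 2 * s \<le> X + t \<and> X \<le> t * d + s) \<or>
    (f = Suc (Suc d) \<and> X = t * d + 2 * s)"
proof -
  have W1: "subsp E W1" and P1: "subsp E P1" and S1: "subsp K S1" and sub1: "W1 \<subseteq> S1" "S1 \<subseteq> P1"
    using sw1 by (auto simp: sandwich_def)
  have W2: "subsp E W2" and P2: "subsp E P2" and S2: "subsp K S2" and sub2: "W2 \<subseteq> S2" "S2 \<subseteq> P2"
    using sw2 by (auto simp: sandwich_def)
  define Q where "Q = P1 \<inter> P2"
  have Q: "subsp E Q" unfolding Q_def by (intro subsp_Int P1 P2)
  have QK: "subsp K Q" by (rule subsp_mono[OF Q KE])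
  have WW: "subsp E (W1 \<inter> W2)" by (intro subsp_Int W1 W2)
  have tow: "vdim K V = t * vdim E V" if "subsp E V" for V
    unfolding t_def by (rule vdim_tower[OF K E KE that])
  have S1Q: "subsp K (S1 \<inter> Q)" and S2Q: "subsp K (S2 \<inter> Q)" by (auto intro: subsp_Int S1 S2 QK)
  have XX: "(S1 \<inter> Q) \<inter> (S2 \<inter> Q) = S1 \<inter> S2" using sub1 sub2 by (auto simp: Q_def)
  have sum: "vdim K ((S1 \<inter> Q) + (S2 \<inter> Q)) + X = vdim K (S1 \<inter> Q) + vdim K (S2 \<inter> Q)"
    using vdim_plus_Int[OF K S1Q S2Q] unfolding XX X_def .
  have le: "vdim K ((S1 \<inter> Q) + (S2 \<inter> Q)) \<le> t * f"
    using vdim_mono[OF K subsp_plus[OF S1Q S2Q] QK plus_subset[OF QK Int_lower2 Int_lower2]] tow[OF Q]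
    by (simp add: f_def Q_def)
  have dX: "t * d \<le> X"
    unfolding d_def X_def tow[OF WW, symmetric]
    by (rule vdim_mono[OF K subsp_mono[OF WW KE] subsp_Int[OF S1 S2]]) (use sub1 sub2 in auto)
  have alt1: "Q \<subseteq> W1 \<or> (f = Suc (vdim E (W1 \<inter> Q)) \<and> vdim K (S1 \<inter> Q) = t * vdim E (W1 \<inter> Q) + s)"
    using sandwich_Int[OF K E KE sw1 Q] by (auto simp: Q_def f_def t_def)
  have alt2: "Q \<subseteq> W2 \<or> (f = Suc (vdim E (W2 \<inter> Q)) \<and> vdim K (S2 \<inter> Q) = t * vdim E (W2 \<inter> Q) + s)"
    using sandwich_Int[OF K E KE sw2 Q] by (auto simp: Q_def f_def t_def)
  have W1Q: "subsp E (W1 \<inter> Q)" and W2Q: "subsp E (W2 \<inter> Q)" by (auto intro: subsp_Int W1 W2 Q)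
  have WWX: "(W1 \<inter> Q) \<inter> (W2 \<inter> Q) = W1 \<inter> W2" using sub1 sub2 by (auto simp: Q_def)
  have wsum: "vdim E ((W1 \<inter> Q) + (W2 \<inter> Q)) + d = vdim E (W1 \<inter> Q) + vdim E (W2 \<inter> Q)"
    using vdim_plus_Int[OF E W1Q W2Q] unfolding WWX d_def .
  have wle: "vdim E ((W1 \<inter> Q) + (W2 \<inter> Q)) \<le> f"
    using vdim_mono[OF E subsp_plus[OF W1Q W2Q] Q plus_subset[OF Q Int_lower2 Int_lower2]] by (simp add: f_def Q_def)
  consider "Q \<subseteq> W1" "Q \<subseteq> W2" | "Q \<subseteq> W1" "\<not> Q \<subseteq> W2" | "\<not> Q \<subseteq> W1" "Q \<subseteq> W2"
    | "\<not> Q \<subseteq> W1" "\<not> Q \<subseteq> W2" by blast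
  then show ?thesis
  proof cases
    case 1
    then have "W1 \<inter> W2 = Q" "S1 \<inter> S2 = Q" using sub1 sub2 by (auto simp: Q_def)
    then show ?thesis using tow[OF Q] by (simp add: d_def f_def X_def Q_def)
  next
    case 2
    then have "W2 \<inter> Q = W1 \<inter> W2" "S2 \<inter> Q = S1 \<inter> S2" using sub1 sub2 by (auto simp: Q_def)
    then show ?thesis using alt2 2 dX st by (auto simp: d_def X_def t_def)
  next
    case 3
    then have "W1 \<inter> Q = W1 \<inter> W2" "S1 \<inter> Q = S1 \<inter> S2" using sub1 sub2 by (auto simp: Q_def)
    then show ?thesis using alt1 3 dX st by (auto simp: d_def X_def t_def)
  next
    case 4
    define e where "e = vdim E (W1 \<inter> Q)"
    have e: "f = Suc e" "vdim K (S1 \<inter> Q) = t * e + s" "vdim E (W2 \<inter> Q) = e" "vdim K (S2 \<inter> Q) = t * e + s"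
      using alt1 alt2 4 by (auto simp: e_def)
    have de: "d \<le> e" "e \<le> Suc d"
      using wsum wle e vdim_mono[OF E WW W1Q] WWX by (auto simp: e_def[symmetric] d_def)
    have up: "X \<le> t * e + s"
      using vdim_mono[OF K subsp_Int[OF S1 S2] S1Q] XX e(2) by (auto simp: X_def)
    show ?thesis
    proof (cases "e = d")
      case True
      then show ?thesis using e up dX sum le by auto
    next
      case False
      \<comment> \<open>The hyperplanes are distinct and span Q, so the K-spaces containing them
        span Q as well.\<close>
      then have ed: "e = Suc d" using de by simp
      have "vdim E ((W1 \<inter> Q) + (W2 \<inter> Q)) = f" using wsum e ed by (simp add: e_def)
      then have "(W1 \<inter> Q) + (W2 \<inter> Q) = Q"
        by (intro vdim_subset_eq[OF E subsp_plus[OF W1Q W2Q] Q plus_subset[OF Q]])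
          (auto simp: f_def Q_def)
      moreover have "(W1 \<inter> Q) + (W2 \<inter> Q) \<subseteq> (S1 \<inter> Q) + (S2 \<inter> Q)"
        by (rule set_plus_mono2) (use sub1 sub2 in auto)
      moreover have "(S1 \<inter> Q) + (S2 \<inter> Q) \<subseteq> Q" by (rule plus_subset[OF QK]) auto
      ultimately have "(S1 \<inter> Q) + (S2 \<inter> Q) = Q" by blast
      then have "t * f + X = 2 * (t * e + s)" using sum e tow[OF Q] by (simp add: f_def Q_def)
      then show ?thesis using e(1) ed by simp
    qed
  qed
qed

lemma scale_subset_of_vdim_Int:
  fixes E :: "'a::{field, finite} set"
  assumes E: "subfld E" and V: "subsp E V" and "\<nu> \<noteq> 0" and "vdim E V \<le> vdim E (V \<inter> (*) \<nu> ` V)"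
  shows "(*) \<nu> ` V \<subseteq> V"
proof -
  have "V \<inter> (*) \<nu> ` V = (*) \<nu> ` V"
    using vdim_subset_eq[OF E subsp_Int[OF V subsp_scale[OF V]] subsp_scale[OF V] Int_lower2] assms(4)
      vdim_scale[OF \<open>\<nu> \<noteq> 0\<close>] by simp
  then show ?thesis by blast
qed

lemma vdim_Int_scale_subset:
  fixes E :: "'a::{field, finite} set"
  assumes "\<nu> \<noteq> 0" "(*) \<nu> ` V \<subseteq> V"
  shows "vdim E (V \<inter> (*) \<nu> ` V) = vdim E V"
  using assms vdim_scale[OF assms(1), of E V] by (simp add: Int_absorb1)

text \<open>Both dimensions are multiples of the degree of \<nu> over E, which exceeds 1.\<close>

lemma no_consecutive_invariant_dims:
  fixes E :: "'a::{field, finite} set"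
  assumes E: "subfld E" and "\<nu> \<notin> E" and "subsp E V" "(*) \<nu> ` V \<subseteq> V" "subsp E V'" "(*) \<nu> ` V' \<subseteq> V'"
  shows "vdim E V' \<noteq> Suc (vdim E V)"
proof
  assume c: "vdim E V' = Suc (vdim E V)"
  define r where "r = vdim E (adjoin E \<nu>)"
  have "r dvd vdim E U" if "subsp E U" "(*) \<nu> ` U \<subseteq> U" for U
    using vdim_tower[OF E subfld_adjoin adjoin_incl(1) subsp_adjoinI[OF E that]] by (simp add: r_def)
  then have "r dvd vdim E V" "r dvd Suc (vdim E V)" using assms c by metis+
  then have "r dvd 1" by (metis Suc_eq_plus1 dvd_add_right_iff)
  then show False using adjoin_eq_self_iff[OF E, of \<nu>] \<open>\<nu> \<notin> E\<close> by (simp add: r_def)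
qed

lemma scale_Int_invariant:
  fixes W :: "'a::field set"
  assumes "(*) \<nu> ` W \<subseteq> W"
  shows "(*) \<nu> ` (W \<inter> (*) c ` W) \<subseteq> W \<inter> (*) c ` W"
  using assms by (auto simp: mult.left_commute[of \<nu>] intro!: imageI)

text \<open>Each alternative for the parameters is refuted by one missing intersection dimension:
  \<open>t w - 1\<close> leaves \<open>s = t - 1\<close> or \<open>2 s = t - 1\<close>, and \<open>1\<close>, \<open>t w\<close>, \<open>t w - 2\<close> finish.\<close>

lemma sandwich_parameters:
  fixes K :: "'a::{field, finite} set"
  assumes K: "subfld K" and E: "subfld E" and KE: "K \<subseteq> E"
    and sw: "sandwich K E w s W S P" and s: "0 < s" "s < vdim K E" and w: "0 < w"
    and real: "\<And>v. 0 < v \<Longrightarrow> v \<le> vdim K S \<Longrightarrow> \<exists>\<nu>. \<nu> \<noteq> 0 \<and> vdim K (S \<inter> (*) \<nu> ` S) = v"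
  shows "vdim K E = 2 \<and> s = 1"
proof -
  define t where "t = vdim K E"
  define d where "d \<nu> = vdim E (W \<inter> (*) \<nu> ` W)" for \<nu>
  define f where "f \<nu> = vdim E (P \<inter> (*) \<nu> ` P)" for \<nu>
  define X where "X \<nu> = vdim K (S \<inter> (*) \<nu> ` S)" for \<nu>
  have W: "subsp E W" and P: "subsp E P" and dims: "vdim E W = w" "vdim E P = Suc w" "vdim K S = t * w + s"
    using sw by (auto simp: sandwich_def t_def)
  have tri: "(f \<nu> = d \<nu> \<and> X \<nu> = t * d \<nu>) \<or>
    (f \<nu> = Suc (d \<nu>) \<and> t * d \<nu> \<le> X \<nu> \<and> t * d \<nu> + 2 * s \<le> X \<nu> + t \<and> X \<nu> \<le> t * d \<nu> + s) \<or>
    (f \<nu> = Suc (Suc (d \<nu>)) \<and> X \<nu> = t * d \<nu> + 2 * s)" if "\<nu> \<noteq> 0" for \<nu>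
    using sandwich_Int_sandwich[OF K E KE sw sandwich_scale[OF sw that]] s
    by (simp add: f_def d_def X_def t_def)
  have dw: "d \<nu> \<le> w" for \<nu>
    using vdim_mono[OF E subsp_Int[OF W subsp_scale[OF W]] W Int_lower1] by (simp add: d_def dims)
  \<comment> \<open>Splitting w - d into 0, 1, 2 and at least 3 turns the products t d and t w into
    atoms with linear relations, as \<open>linarith\<close> requires.\<close>
  have dcases: "t * d \<nu> = t * w \<and> d \<nu> = w \<or> t * d \<nu> + t = t * w \<and> Suc (d \<nu>) = w \<or> t * d \<nu> + 2 * t = t * w
     \<or> t * d \<nu> + 3 * t \<le> t * w" for \<nu>
  proof -
    consider "d \<nu> = w" | "w = Suc (d \<nu>)" | "w = Suc (Suc (d \<nu>))" | "d \<nu> + 3 \<le> w" using dw[of \<nu>] by linarith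
    then show ?thesis
    proof cases
      case 4
      then have "t * (d \<nu> + 3) \<le> t * w" by (rule mult_le_mono2)
      then show ?thesis by (simp add: distrib_left)
    qed (auto simp: algebra_simps)
  qed
  have t2: "2 \<le> t" "s < t" using s by (auto simp: t_def)
  have tw: "t \<le> t * w" using w by simp
  have get: "\<exists>\<nu>. \<nu> \<noteq> 0 \<and> X \<nu> = v" if "0 < v" "v \<le> t * w + s" for v
    using real that dims by (auto simp: X_def)
  have "0 < t * w - 1" "t * w - 1 \<le> t * w + s" using t2 tw by linarith+
  then obtain \<nu>1 where n1: "\<nu>1 \<noteq> 0" "X \<nu>1 = t * w - 1" using get by blast
  have X1: "Suc (X \<nu>1) = t * w" using n1(2) t2 tw by linarith
  \<comment> \<open>The dimension t w - 1 excludes f = d. For f = d + 1 it forces d = w - 1 and s =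
    t - 1; for f = d + 2 it forces d = w - 1 and 2 s = t - 1, since 2 s = 2 t - 1 fails by
    parity.\<close>
  have A: "Suc s = t \<or> (2 * s + 1 = t \<and> f \<nu>1 = Suc w \<and> Suc (d \<nu>1) = w)"
  proof -
    have par: "Suc (2 * s) \<noteq> 2 * t" by presburger
    show ?thesis
      using tri[OF n1(1)] dcases[of \<nu>1] by (elim disjE conjE) (use X1 par t2 s in linarith)+
  qed
  have notinW: "\<nu> \<notin> E" if "\<nu> \<noteq> 0" "d \<nu> \<noteq> w" for \<nu>
  proof
    assume "\<nu> \<in> E"
    then have "(*) \<nu> ` W \<subseteq> W" using subsp_mult[OF W] by auto
    then show False using vdim_Int_scale_subset[OF that(1)] that dims by (metis d_def)
  qed
  have notinP: "\<nu> \<notin> E" if "\<nu> \<noteq> 0" "f \<nu> \<noteq> Suc w" for \<nu>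
  proof
    assume "\<nu> \<in> E"
    then have "(*) \<nu> ` P \<subseteq> P" using subsp_mult[OF P] by auto
    then show False using vdim_Int_scale_subset[OF that(1)] that dims by (metis f_def)
  qed
  have "Suc s = t"
  proof (rule ccontr)
    assume "Suc s \<noteq> t"
    then have B: "2 * s + 1 = t" "f \<nu>1 = Suc w" "Suc (d \<nu>1) = w" using A by auto
    have inv: "(*) \<nu>1 ` P \<subseteq> P"
      using scale_subset_of_vdim_Int[OF E P n1(1)] B dims by (simp add: f_def)
    have "\<nu>1 \<notin> E" using notinW[OF n1(1)] B by auto
    have "0 < t * w - 2" "t * w - 2 \<le> t * w + s" using B(1) s(1) tw by linarith+
    then obtain \<nu>2 where n2: "\<nu>2 \<noteq> 0" "X \<nu>2 = t * w - 2" using get by blast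
    have X2: "X \<nu>2 + 2 = t * w" using n2(2) \<open>0 < t * w - 2\<close> by linarith
    \<comment> \<open>P is \<nu>1-invariant of dimension w + 1, and the dimension t w - 2 produces a
      \<nu>1-invariant subspace P \<inter> \<nu>2 P of dimension w.\<close>
    have "f \<nu>2 = w"
      using tri[OF n2(1)] dcases[of \<nu>2] by (elim disjE conjE) (use X2 B(1) t2 s in linarith)+
    then have "vdim E P = Suc (vdim E (P \<inter> (*) \<nu>2 ` P))" using dims by (simp add: f_def)
    then show False
      using no_consecutive_invariant_dims[OF E \<open>\<nu>1 \<notin> E\<close> subsp_Int[OF P subsp_scale[OF P]]
          scale_Int_invariant[OF inv] P inv] by blast
  qed
  \<comment> \<open>The dimension 1 allows only d = 0 and f = 1, whence 2 s \<le> t + 1; with s = t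
    - 1 this gives t \<le> 3.\<close>
  obtain \<nu>3 where n3: "\<nu>3 \<noteq> 0" "X \<nu>3 = 1" using get[of 1] tw t2 by auto
  have "t = 2 \<or> t = 3"
  proof -
    have "d \<nu>3 = 0 \<or> t \<le> t * d \<nu>3" by (cases "d \<nu>3") auto
    then show ?thesis using tri[OF n3(1)] n3(2) \<open>Suc s = t\<close> t2 by fastforce
  qed
  moreover have "t \<noteq> 3"
  proof
    assume t3: "t = 3"
    then have s2: "s = 2" using \<open>Suc s = t\<close> by simp
    \<comment> \<open>The dimension 3 w occurs only for d = f = w, so \<nu>4 preserves W but not P
      and lies outside E. Then W and W \<inter> \<nu>1 W are \<nu>4-invariant of consecutive
      dimensions.\<close>
    obtain \<nu>4 where n4: "\<nu>4 \<noteq> 0" "X \<nu>4 = 3 * w" using get[of "3 * w"] t3 w by auto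
    have df: "d \<nu>4 = w" "f \<nu>4 = w"
      using tri[OF n4(1)] n4(2) unfolding t3 s2 by presburger+
    have "\<nu>4 \<notin> E" using notinP[OF n4(1)] df by simp
    have inv: "(*) \<nu>4 ` W \<subseteq> W"
      using scale_subset_of_vdim_Int[OF E W n4(1)] df dims by (simp add: d_def)
    have "Suc (d \<nu>1) = w" using tri[OF n1(1)] X1 unfolding t3 s2 by presburger
    then have "vdim E W = Suc (vdim E (W \<inter> (*) \<nu>1 ` W))" using dims by (simp add: d_def)
    then show False
      using no_consecutive_invariant_dims[OF E \<open>\<nu>4 \<notin> E\<close> subsp_Int[OF W subsp_scale[OF W]]
          scale_Int_invariant[OF inv] W inv] by blast
  qed
  ultimately show ?thesis using \<open>Suc s = t\<close> by (auto simp: t_def)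
qed

lemma sandwich_of_decomposition:
  fixes K :: "'a::{field, finite} set"
  assumes K: "subfld K" and E: "E = adjoin K \<mu>" and W: "subsp E W" and a: "a \<notin> W"
    and s: "s \<le> vdim K E"
  shows "sandwich K E (vdim E W) s W (W + (*) a ` pspan K \<mu> s) (W + (*) a ` E)"
proof -
  have sE: "subfld E" and KE: "K \<subseteq> E" unfolding E by (rule subfld_adjoin adjoin_incl)+
  have A: "subsp K ((*) a ` pspan K \<mu> s)" by (intro subsp_scale subsp_pspan K)
  have B: "subsp E ((*) a ` E)" by (intro subsp_scale subsp_subfld sE order_refl)
  show ?thesis
    unfolding sandwich_def
    using W subsp_plus[OF W B] subsp_plus[OF subsp_mono[OF W KE] A] subset_plus_left[OF A, of W]
      vdim_plus_line[OF sE W a] vdim_near_invariant[OF K E W a s]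
      set_plus_mono2[OF order_refl[of W] image_mono[OF pspan_subset_adjoin[OF K, of \<mu> s], of "(*) a"]] E
    by blast
qed

subsection \<open>Geometric progressions\<close>

text \<open>A nonzero common vector c p = \<nu> c p' gives \<nu> = p / p' in the field M generated
  by x. Hence V and \<nu>V both lie in cM, and their sum has dimension 2 n - 1.\<close>

lemma geometric_length_bound:
  fixes E :: "'a::{field, finite} set"
  assumes E: "subfld E" and n: "n \<le> vdim E (adjoin E x)" and "c \<noteq> 0"
    and V: "V = (*) c ` pspan E x n" and nu: "\<nu> \<noteq> 0" and one: "vdim E (V \<inter> (*) \<nu> ` V) = 1"
  shows "2 * n \<le> Suc (vdim E (adjoin E x))"
proof -
  let ?M = "adjoin E x"
  have M: "subfld ?M" "E \<subseteq> ?M" by (rule subfld_adjoin adjoin_incl)+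
  have sV: "subsp E V" unfolding V by (intro subsp_scale subsp_pspan E)
  have "V \<inter> (*) \<nu> ` V \<noteq> {0}" using one vdim_zero[OF E] by (intro notI) simp
  then obtain z where z: "z \<noteq> 0" "z \<in> V" "z \<in> (*) \<nu> ` V"
    using subsp_0[OF subsp_Int[OF sV subsp_scale[OF sV]]] by blast
  then obtain p p' where p: "z = c * p" "z = \<nu> * (c * p')" "p \<in> ?M" "p' \<in> ?M"
    using pspan_subset_adjoin[OF E] unfolding V by blast
  then have "\<nu> = p / p'" using z \<open>c \<noteq> 0\<close> by (auto simp: field_simps)
  then have nM: "\<nu> \<in> ?M" using p subfld_divide[OF M(1)] by simp
  have cM: "subsp E ((*) c ` ?M)" by (intro subsp_scale subsp_subfld M)
  have VM: "V \<subseteq> (*) c ` ?M" unfolding V using pspan_subset_adjoin[OF E] by blast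
  have "(*) \<nu> ` V \<subseteq> (*) c ` ?M"
    using subsp_mult[OF subsp_scale[OF subsp_subfld[OF M(1) order_refl]] nM] VM by blast
  then have "vdim E (V + (*) \<nu> ` V) \<le> vdim E ((*) c ` ?M)"
    by (intro vdim_mono[OF E subsp_plus[OF sV subsp_scale[OF sV]] cM] plus_subset[OF cM] VM)
  moreover have "vdim E V = n" unfolding V using vdim_scale[OF \<open>c \<noteq> 0\<close>] vdim_pspan[OF E n] by simp
  ultimately show ?thesis
    using vdim_plus_Int[OF E sV subsp_scale[OF sV], of \<nu>] one vdim_scale[OF nu, of E V]
      vdim_scale[OF \<open>c \<noteq> 0\<close>, of E ?M] by simp
qed

section \<open>Changing the ratio of a geometric progression\<close>

lemma power_pspan_2:
  assumes E: "subfld E" and "y \<in> pspan E x 2" shows "y ^ k \<in> pspan E x (Suc k)"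
proof (induction k)
  case 0 show ?case using power_in_pspan[OF E, of 0 1 x] by simp
next
  case (Suc k)
  show ?case using mult_pspan[OF E, of y x 1 "y ^ k" k] assms(2) Suc by (simp add: numeral_2_eq_2)
qed

text \<open>Up to the factor \<open>y\<^sub>0 ^ n\<close>, both sides are the binary forms of degree \<open>n\<close> in \<open>y\<^sub>0, y\<^sub>1\<close>.\<close>

lemma pspan_moebius:
  fixes E :: "'a::{field, finite} set"
  assumes E: "subfld E" and y: "y0 \<in> pspan E x 2" "y1 \<in> pspan E x 2" "y0 \<noteq> 0"
    and z: "z = y1 / y0" and x: "x \<in> adjoin E z" and n: "Suc n \<le> vdim E (adjoin E x)"
  shows "pspan E x (Suc n) = (*) (y0 ^ n) ` pspan E z (Suc n)"
proof -
  have "z \<in> adjoin E x" unfolding z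
    by (rule subfld_divide[OF subfld_adjoin]) (use y pspan_subset_adjoin[OF E] in auto)
  then have eq: "adjoin E x = adjoin E z"
    using adjoin_least[OF subfld_adjoin adjoin_incl(1)] x by blast
  have sub: "(*) (y0 ^ n) ` pspan E z (Suc n) \<subseteq> pspan E x (Suc n)"
  proof (rule scale_pspan_subset[OF E subsp_pspan[OF E]])
    fix i assume i: "i < Suc n"
    have "y0 ^ n = y0 ^ (n - i) * y0 ^ i" using i by (simp add: power_add[symmetric])
    then have "y0 ^ n * z ^ i = y0 ^ (n - i) * y1 ^ i" using y(3) by (simp add: z power_divide)
    then show "y0 ^ n * z ^ i \<in> pspan E x (Suc n)"
      using mult_pspan[OF E power_pspan_2[OF E y(1), of "n - i"] power_pspan_2[OF E y(2), of i]] i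
      by simp
  qed
  \<comment> \<open>Since x and z generate the same field, the powers of z up to n are independent
    too, and the inclusion is an equality by dimension.\<close>
  have "vdim E ((*) (y0 ^ n) ` pspan E z (Suc n)) = vdim E (pspan E z (Suc n))"
    using y(3) by (intro vdim_scale) simp
  then show ?thesis
    using vdim_subset_eq[OF E subsp_scale[OF subsp_pspan[OF E]] subsp_pspan[OF E] sub]
      vdim_pspan[OF E] n eq by (metis order_refl)
qed

lemma pspan_2_iff: "subfld E \<Longrightarrow> y \<in> pspan E x 2 \<longleftrightarrow> (\<exists>\<alpha>\<in>E. \<exists>\<beta>\<in>E. y = \<alpha> + x * \<beta>)"
  by (auto simp: numeral_2_eq_2 set_plus_def)

text \<open>Here g is the denominator of a fractional linear function of x, and y is a numerator
  that makes it invertible: x itself when g is a constant, and 1 otherwise.\<close>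

lemma ex_moebius_coordinate:
  assumes E: "subfld E" and g: "g \<in> pspan E x 2" "g \<noteq> 0"
  obtains y where "y \<in> pspan E x 2" "x \<in> adjoin E (y / g)"
proof -
  have "1 \<in> pspan E x 2" "x \<in> pspan E x 2"
    using power_in_pspan[OF E, of 0 2 x] power_in_pspan[OF E, of 1 2 x] by auto
  obtain \<alpha> \<beta> where ab: "\<alpha> \<in> E" "\<beta> \<in> E" "g = \<alpha> + x * \<beta>" using g pspan_2_iff[OF E] by blast
  have M: "subfld (adjoin E z)" "E \<subseteq> adjoin E z" "z \<in> adjoin E z" for z
    by (rule subfld_adjoin adjoin_incl)+
  show thesis
  proof (cases "\<beta> = 0")
    case True
    then have "x = \<alpha> * (x / g)" using ab g by simp
    then have "x \<in> adjoin E (x / g)" using subfld_mult[OF M(1)] M ab by (metis subsetD)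
    then show thesis using that \<open>x \<in> pspan E x 2\<close> by blast
  next
    case False
    then have "x = (inverse (1 / g) - \<alpha>) / \<beta>" using ab by simp
    moreover have "(inverse (1 / g) + - \<alpha>) / \<beta> \<in> adjoin E (1 / g)"
      by (intro subfld_divide[OF M(1)] subfld_add[OF M(1)] subfld_uminus[OF M(1)]
          subfld_inverse[OF M(1)] M(3)) (use M(2) ab in auto)
    ultimately have "x \<in> adjoin E (1 / g)" by simp
    then show thesis using that \<open>1 \<in> pspan E x 2\<close> by blast
  qed
qed

text \<open>A polynomial argument: g has degree at most w in x, and so do its products with x^i. A
  coefficient e at degree k + 1 > 1, moved by x^(w-k) to degree w + 1, would put e x^(w+1) among the
  values of lower degree, which the independence of the powers forbids unless e = 0. So the degree
  of g descends to 1.\<close>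

lemma pspan_ratio_linear:
  fixes E :: "'a::{field, finite} set"
  assumes E: "subfld E" and w: "0 < w" "Suc w < vdim E (adjoin E x)"
    and g: "\<And>i. i < w \<Longrightarrow> x ^ i * g \<in> pspan E x (Suc w)"
  shows "g \<in> pspan E x 2"
proof -
  have "g \<in> pspan E x (Suc (w - j))" if "j < w" for j
    using that
  proof (induction j)
    case 0 then show ?case using g[of 0] by simp
  next
    case (Suc j)
    define k where "k = w - Suc j"
    have wj: "w - j = Suc k" using Suc.prems by (simp add: k_def)
    have "g \<in> pspan E x (Suc (Suc k))" using Suc unfolding wj by simp
    then obtain h e where h: "g = h + x ^ Suc k * e" "h \<in> pspan E x (Suc k)" "e \<in> E"
      by (auto simp: set_plus_def simp del: power_Suc)
    have "x ^ Suc j * h \<in> pspan E x (Suc (Suc j + k))"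
      by (rule mult_pspan[OF E power_in_pspan[OF E] h(2)]) simp
    moreover have "Suc j + k = w" using Suc.prems by (simp add: k_def)
    ultimately have 1: "x ^ Suc j * h \<in> pspan E x (Suc w)" by (simp only:)
    have "x ^ Suc j * g - x ^ Suc j * h = x ^ (Suc j + Suc k) * e"
      unfolding h(1) power_add by (simp add: algebra_simps)
    also have "Suc j + Suc k = Suc w" using Suc.prems by (simp add: k_def)
    finally have "x ^ Suc w * e \<in> pspan E x (Suc w)"
      using subsp_diff[OF E subsp_pspan[OF E] g[OF Suc.prems] 1] by simp
    then have "inverse e * (x ^ Suc w * e) \<in> pspan E x (Suc w)"
      by (rule subsp_mult[OF subsp_pspan[OF E] subfld_inverse[OF E h(3)]])
    moreover have "inverse e * (x ^ Suc w * e) = x ^ Suc w" if "e \<noteq> 0"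
      using that by (simp add: mult.commute[of _ e] del: power_Suc)
    ultimately have "e = 0" using power_notin_pspan[OF E w(2)] by metis
    then show ?case using h by (simp add: k_def)
  qed
  from this[of "w - 1"] show ?thesis using w(1) by (simp add: numeral_2_eq_2)
qed

lemma scale_scale: "(*) a ` (*) b ` S = (*) (a * b) ` (S :: 'a::field set)"
  by (force simp: mult.assoc)

section \<open>The case of a quadratic extension, and the classification\<close>

lemma quadratic_case:
  fixes K :: "'a::{field, finite} set"
  assumes K: "subfld K" and E: "subfld E" and KE: "K \<subseteq> E" and E2: "vdim K E = 2"
    and W: "subsp E W" and a: "a \<notin> W" and w: "vdim E W = w" "0 < w"
    and S: "S = W + (*) a ` K"
    and real: "\<And>v. 0 < v \<Longrightarrow> v \<le> vdim K S \<Longrightarrow> \<exists>\<nu>. \<nu> \<noteq> 0 \<and> vdim K (S \<inter> (*) \<nu> ` S) = v"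
  shows "\<exists>c x. c \<noteq> 0 \<and> x \<notin> E \<and> 2 * w < vdim E (adjoin E x) \<and>
    S = (*) c ` (pspan E x w + (*) (x ^ w) ` K)"
proof -
  define P where "P = W + (*) a ` E"
  have aE: "subsp E ((*) a ` E)" and aK: "subsp K ((*) a ` K)"
    by (intro subsp_scale subsp_subfld E K order_refl)+
  have WK: "subsp K W" by (rule subsp_mono[OF W KE])
  have P: "subsp E P" unfolding P_def by (rule subsp_plus[OF W aE])
  have dP: "vdim E P = Suc w" unfolding P_def using vdim_plus_line[OF E W a] w by simp
  have dS: "vdim K S = 2 * w + 1"
    unfolding S using vdim_plus_line[OF K WK a] vdim_tower[OF K E KE W] E2 w by simp
  have sw: "sandwich K E w 1 W S P"
    unfolding sandwich_def using W P w dP dS E2 subsp_plus[OF WK aK] subset_plus_left[OF aK, of W]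
      set_plus_mono2[OF order_refl[of W] image_mono[OF KE, of "(*) a"]] by (simp add: S P_def)
  \<comment> \<open>With t = 2 and s = 1 the alternatives f = d and f = d + 2 give even dimensions,
    so 2 v + 1 needs f = d + 1 and d = v. The odd dimensions for S thus control W and P over E
    through the same \<nu>.\<close>
  have odd: "\<exists>\<nu>. \<nu> \<noteq> 0 \<and> vdim E (W \<inter> (*) \<nu> ` W) = v \<and> vdim E (P \<inter> (*) \<nu> ` P) = Suc v" if vw: "v \<le> w" for v
  proof -
    obtain \<nu> where n: "\<nu> \<noteq> 0" "vdim K (S \<inter> (*) \<nu> ` S) = 2 * v + 1" using real[of "2 * v + 1"] dS vw by auto
    have "vdim E (W \<inter> (*) \<nu> ` W) = v \<and> vdim E (P \<inter> (*) \<nu> ` P) = Suc v"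
      using sandwich_Int_sandwich[OF K E KE sw sandwich_scale[OF sw n(1)], unfolded E2 n(2)] by presburger
    then show ?thesis using n(1) by blast
  qed
  \<comment> \<open>One multiplier almost preserves both W and P, so their decompositions share the
    ratio \<kappa> and the field M.\<close>
  obtain \<kappa> where l: "\<kappa> \<noteq> 0" "vdim E (W \<inter> (*) \<kappa> ` W) = w - 1" "vdim E (P \<inter> (*) \<kappa> ` P) = w"
    using odd[of "w - 1"] w by auto
  define M where "M = adjoin E \<kappa>"
  have M: "subfld M" "E \<subseteq> M" unfolding M_def by (rule subfld_adjoin adjoin_incl)+
  define t where "t = vdim E M"
  obtain W1 b1 s1 where d1: "subsp M W1" "b1 \<notin> W1" "0 < s1" "s1 < t" "P = W1 + (*) b1 ` pspan E \<kappa> s1"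
    using near_invariant_decomposition[OF E P l(1)] l(3) dP unfolding t_def M_def by metis
  have "vdim E W = Suc (vdim E (W \<inter> (*) \<kappa> ` W))" using l(2) w by simp
  then obtain W2 b2 s2 where d2: "subsp M W2" "b2 \<notin> W2" "0 < s2" "s2 < t" "W = W2 + (*) b2 ` pspan E \<kappa> s2"
    using near_invariant_decomposition[OF E W l(1)] unfolding t_def M_def by metis
  have c1: "Suc w = t * vdim M W1 + s1"
    using vdim_near_invariant[OF E M_def d1(1,2)] d1(4,5) dP by (simp add: t_def)
  have c2: "w = t * vdim M W2 + s2"
    using vdim_near_invariant[OF E M_def d2(1,2)] d2(4,5) w by (simp add: t_def)
  \<comment> \<open>Otherwise t would divide s2, which lies strictly between 0 and t.\<close>
  have "s1 \<noteq> 1"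
  proof
    assume "s1 = 1"
    then have "t * vdim M W1 = t * vdim M W2 + s2" using c1 c2 by simp
    then have "t dvd s2" by (metis dvd_add_right_iff dvd_triv_left)
    then show False using d2(3,4) by (auto dest: dvd_imp_le)
  qed
  \<comment> \<open>P also takes every positive intersection dimension up to its own, so
    \<open>sandwich_parameters\<close> applies one level higher; its conclusion contradicts s1
    \<noteq> 1, hence W1 = 0.\<close>
  moreover have "t = 2 \<and> s1 = 1" if "0 < vdim M W1"
  proof -
    have sw1: "sandwich E M (vdim M W1) s1 W1 P (W1 + (*) b1 ` M)"
      using sandwich_of_decomposition[OF E M_def d1(1,2)] d1(4,5) by (simp add: t_def)
    have "\<exists>\<nu>. \<nu> \<noteq> 0 \<and> vdim E (P \<inter> (*) \<nu> ` P) = v" if "0 < v" "v \<le> vdim E P" for v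
      using odd[of "v - 1"] that dP by (cases v) auto
    then show ?thesis
      using sandwich_parameters[OF E M sw1 d1(3) _ that] d1(4) by (simp add: t_def)
  qed
  ultimately have z1: "vdim M W1 = 0" by auto
  then have s1: "s1 = Suc w" using c1 by simp
  \<comment> \<open>From w + 1 = s1 < t there is no room for a nonzero M-space inside W.\<close>
  have z2: "vdim M W2 = 0"
  proof (rule ccontr)
    assume "vdim M W2 \<noteq> 0"
    then have "t \<le> t * vdim M W2" by simp
    then show False using c2 s1 d1(4) by linarith
  qed
  then have s2: "s2 = w" using c2 by simp
  have "W1 = {0}" "W2 = {0}" using vdim_eq_0[OF M(1)] d1 d2 z1 z2 by auto
  then have b0: "b1 \<noteq> 0" "b2 \<noteq> 0" using d1 d2 by auto
  have Pg: "P = (*) b1 ` pspan E \<kappa> (Suc w)" and Wg: "W = (*) b2 ` pspan E \<kappa> w"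
    using d1(5) d2(5) \<open>W1 = {0}\<close> \<open>W2 = {0}\<close> s1 s2 by (simp_all add: set_plus_def)
  have wt: "Suc w < vdim E (adjoin E \<kappa>)" using d1(4) s1 by (simp add: t_def M_def)
  \<comment> \<open>The progressions for P and W have the same ratio but start at b1 and b2. Because
    W \<subseteq> P, the quotient of the starts is linear in \<kappa>.\<close>
  define g where "g = b2 / b1"
  have g0: "g \<noteq> 0" using b0 by (simp add: g_def)
  have gP: "\<kappa> ^ i * g \<in> pspan E \<kappa> (Suc w)" if "i < w" for i
  proof -
    have "b2 * \<kappa> ^ i \<in> W" unfolding Wg by (intro imageI power_in_pspan[OF E that])
    then have "b2 * \<kappa> ^ i \<in> P" unfolding P_def using subset_plus_left[OF aE] by blast
    then obtain p where "p \<in> pspan E \<kappa> (Suc w)" "b2 * \<kappa> ^ i = b1 * p" unfolding Pg by auto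
    moreover from this have "p = \<kappa> ^ i * g" using b0 by (simp add: g_def field_simps)
    ultimately show ?thesis by simp
  qed
  have g2: "g \<in> pspan E \<kappa> 2" by (rule pspan_ratio_linear[OF E w(2) wt gP])
  obtain y where y: "y \<in> pspan E \<kappa> 2" "\<kappa> \<in> adjoin E (y / g)" by (rule ex_moebius_coordinate[OF E g2 g0])
  define x where "x = y / g"
  have moeb: "pspan E \<kappa> (Suc n) = (*) (g ^ n) ` pspan E x (Suc n)" if "n \<le> w" for n
    by (rule pspan_moebius[OF E g2 y(1) g0 x_def]) (use y(2) wt that in \<open>auto simp: x_def\<close>)
  \<comment> \<open>After the change of ratio P has the factor b1 g^w and W has b2 g^(w-1); these
    agree since b2 = b1 g.\<close>
  define c0 where "c0 = b1 * g ^ w"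
  have c00: "c0 \<noteq> 0" using b0 g0 by (simp add: c0_def)
  have Px: "P = (*) c0 ` pspan E x (Suc w)"
    unfolding Pg moeb[OF order_refl] c0_def by (rule scale_scale)
  have Wx: "W = (*) c0 ` pspan E x w"
  proof -
    obtain n where n: "w = Suc n" using w by (cases w) auto
    have "W = (*) (b2 * g ^ n) ` pspan E x (Suc n)"
      unfolding Wg n using moeb[of n] n by (simp add: scale_scale del: pspan.simps)
    moreover have "b2 * g ^ n = c0" using b0 by (simp add: c0_def n g_def)
    ultimately show ?thesis using n by simp
  qed
  have "1 \<in> E" by (rule subfld_1[OF E])
  then have "a \<in> P" unfolding P_def using subset_plus_right[OF W, of "(*) a ` E"] by force
  \<comment> \<open>Modulo W, the vector a is c0 x^w e, and e is nonzero because a is outside W.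
    Taking c0 e as the common factor turns aK into x^w K, with p absorbed by W.\<close>
  then obtain p e where pe: "a = c0 * (p + x ^ w * e)" "p \<in> pspan E x w" "e \<in> E"
    unfolding Px by (auto simp: set_plus_def)
  have e0: "e \<noteq> 0" using a pe unfolding Wx by auto
  have sp: "subsp E (pspan E x w)" by (rule subsp_pspan[OF E])
  have Sx: "S = (*) (c0 * e) ` (pspan E x w + (*) (x ^ w) ` K)"
  proof (intro equalityI subsetI)
    fix z assume "z \<in> S"
    then obtain p' k where z: "z = c0 * p' + a * k" "p' \<in> pspan E x w" "k \<in> K"
      unfolding S Wx by (auto simp: set_plus_def)
    have "inverse e * (p' + k * p) \<in> pspan E x w"
      using z pe KE by (intro subsp_mult[OF sp] subsp_add[OF sp] subfld_inverse[OF E]) auto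
    then have "inverse e * (p' + k * p) + x ^ w * k \<in> pspan E x w + (*) (x ^ w) ` K"
      using z(3) by (intro set_plus_intro imageI)
    moreover have "z = c0 * e * (inverse e * (p' + k * p) + x ^ w * k)"
      using e0 by (simp add: z(1) pe(1) field_simps)
    ultimately show "z \<in> (*) (c0 * e) ` (pspan E x w + (*) (x ^ w) ` K)" by blast
  next
    fix z assume "z \<in> (*) (c0 * e) ` (pspan E x w + (*) (x ^ w) ` K)"
    then obtain p' k where z: "z = c0 * e * (p' + x ^ w * k)" "p' \<in> pspan E x w" "k \<in> K"
      by (auto simp: set_plus_def)
    have "e * p' - k * p \<in> pspan E x w"
      using z pe KE by (intro subsp_diff[OF E sp] subsp_mult[OF sp]) auto
    then have "c0 * (e * p' - k * p) + a * k \<in> S"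
      unfolding S Wx using z(3) by (intro set_plus_intro imageI)
    moreover have "z = c0 * (e * p' - k * p) + a * k" by (simp add: z(1) pe(1) algebra_simps)
    ultimately show "z \<in> S" by simp
  qed
  have "\<kappa> \<in> adjoin E x" using y(2) by (simp add: x_def)
  moreover have "x \<in> adjoin E \<kappa>" unfolding x_def
    by (rule subfld_divide[OF subfld_adjoin]) (use y(1) g2 pspan_subset_adjoin[OF E] in auto)
  ultimately have eq: "adjoin E x = adjoin E \<kappa>"
    using adjoin_least[OF subfld_adjoin adjoin_incl(1)] by blast
  \<comment> \<open>The progression P of length w + 1 now obeys 2 (w + 1) \<le> [E(x):E] +
    1.\<close>
  obtain \<nu> where n: "\<nu> \<noteq> 0" "vdim E (P \<inter> (*) \<nu> ` P) = 1" using odd[of 0] by auto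
  have bd: "2 * w < vdim E (adjoin E x)"
    using geometric_length_bound[OF E _ c00 Px n] wt eq by simp
  then have "x \<notin> E" using adjoin_eq_self_iff[OF E, of x] w by auto
  then show ?thesis using Sx bd c00 e0 by (metis mult_eq_0_iff)
qed

theorem all_intersection_dims_classification:
  fixes K :: "'a::{field, finite} set"
  assumes K: "subfld K" and S: "subsp K S" and l: "vdim K S = l" "0 < l"
    and real: "\<And>v. v \<le> l \<Longrightarrow> \<exists>\<nu>. \<nu> \<noteq> 0 \<and> vdim K (S \<inter> (*) \<nu> ` S) = v"
  shows "(\<exists>c x. c \<noteq> 0 \<and> x \<notin> K \<and> 2 * l \<le> Suc (vdim K (adjoin K x)) \<and> S = (*) c ` pspan K x l) \<or>
    (\<exists>c E \<xi> x w. c \<noteq> 0 \<and> subfld E \<and> K \<subseteq> E \<and> card E = (card K)\<^sup>2 \<and> E = pspan K \<xi> 2 \<and>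
      x \<notin> E \<and> l = 2 * w + 1 \<and> 2 * w < vdim E (adjoin E x) \<and>
      S = (*) c ` (pspan E x w + (*) (x ^ w) ` K))"
proof -
  obtain \<mu> where m: "\<mu> \<noteq> 0" "vdim K (S \<inter> (*) \<mu> ` S) = l - 1" using real[of "l - 1"] l by auto
  define E where "E = adjoin K \<mu>"
  have E: "subfld E" and KE: "K \<subseteq> E" unfolding E_def by (rule subfld_adjoin adjoin_incl)+
  have "vdim K S = Suc (vdim K (S \<inter> (*) \<mu> ` S))" using m l by simp
  then obtain W a s where d: "subsp E W" "a \<notin> W" "0 < s" "s < vdim K E" "S = W + (*) a ` pspan K \<mu> s"
    using near_invariant_decomposition[OF K S m(1)] unfolding E_def by metis
  have sw: "sandwich K E (vdim E W) s W S (W + (*) a ` E)"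
    using sandwich_of_decomposition[OF K E_def d(1,2)] d by simp
  have dim: "l = vdim K E * vdim E W + s" using vdim_near_invariant[OF K E_def d(1,2)] d l by simp
  show ?thesis
  proof (cases "vdim E W = 0")
    case True
    then have "W = {0}" using vdim_eq_0[OF E d(1)] by simp
    then have Sg: "S = (*) a ` pspan K \<mu> l" "a \<noteq> 0" using d dim True by (simp_all add: set_plus_def)
    obtain \<nu> where n: "\<nu> \<noteq> 0" "vdim K (S \<inter> (*) \<nu> ` S) = 1" using real[of 1] l by auto
    have "2 * l \<le> Suc (vdim K (adjoin K \<mu>))"
      using geometric_length_bound[OF K _ Sg(2,1) n] d(4) dim True by (simp add: E_def)
    moreover have "\<mu> \<notin> K" using adjoin_eq_self_iff[OF K, of \<mu>] d(3,4) by (auto simp: E_def)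
    ultimately show ?thesis using Sg by blast
  next
    case False
    have ts: "vdim K E = 2" "s = 1"
      using sandwich_parameters[OF K E KE sw d(3,4)] False real l by auto
    then have S1: "S = W + (*) a ` K" using d(5) by (simp add: set_plus_def)
    have "\<exists>c x. c \<noteq> 0 \<and> x \<notin> E \<and> 2 * vdim E W < vdim E (adjoin E x) \<and>
        S = (*) c ` (pspan E x (vdim E W) + (*) (x ^ vdim E W) ` K)"
      using False real l by (intro quadratic_case[OF K E KE ts(1) d(1,2) refl _ S1]) auto
    moreover have "card E = (card K)\<^sup>2" using card_eq_vdim[OF K subsp_subfld[OF E KE]] ts by simp
    moreover have "E = pspan K \<mu> 2" using pspan_vdim_adjoin[OF K, of \<mu>] ts by (simp add: E_def)
    moreover have "l = 2 * vdim E W + 1" using dim ts by simp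
    ultimately show ?thesis using E KE by blast
  qed
qed

section \<open>Dimensions and spans as cardinalities\<close>

text \<open>Coordinates in a finite basis biject the carrier with functions from the basis to the
  scalars. This turns the dimensions of the statement into cardinalities.\<close>

lemma (in vectorspace) card_carrier_eq_power_dim:
  assumes fin: "finite (carrier V)"
  shows "card (carrier V) = card (carrier K) ^ dim"
proof -
  have "span (carrier V) = carrier V" using span_is_subset2 in_own_span by blast
  then have "fin_dim" using fin unfolding fin_dim_def by blast
  then obtain B where B: "finite B" "basis B" using finite_basis_exists by blast
  have BV: "B \<subseteq> carrier V" using B(2) by (simp add: basis_def)
  have ex1: "\<exists>!a. a \<in> B \<rightarrow>\<^sub>E carrier K \<and> lincomb a B = v" if "v \<in> carrier V" for v
    using basis_criterion[OF B(1) BV] B(2) that by blast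
  have "bij_betw (\<lambda>a. lincomb a B) (B \<rightarrow>\<^sub>E carrier K) (carrier V)"
    unfolding bij_betw_def
  proof
    have clo: "lincomb a B \<in> carrier V" if "a \<in> B \<rightarrow>\<^sub>E carrier K" for a
      using that BV by (intro lincomb_closed) auto
    show "inj_on (\<lambda>a. lincomb a B) (B \<rightarrow>\<^sub>E carrier K)"
      by (rule inj_onI) (use ex1 clo in blast)
    show "(\<lambda>a. lincomb a B) ` (B \<rightarrow>\<^sub>E carrier K) = carrier V"
      using ex1 clo by blast
  qed
  then have "card (B \<rightarrow>\<^sub>E carrier K) = card (carrier V)" by (rule bij_betw_same_card)
  then show ?thesis using dim_basis[OF B] B(1) by (simp add: card_PiE)
qed

lemma carrier_restr_ring: "carrier (restr_ring K) = K"
  by (simp add: restr_ring_def)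

lemma card_eq_power_dim_over:
  assumes "vectorspace (restr_ring K) V" "submodule (restr_ring K) W V" "finite W"
  shows "card W = card K ^ dim_over K V W"
proof -
  interpret V: vectorspace "restr_ring K" V by fact
  have "VectorSpace.subspace (restr_ring K) W V"
    using assms by (simp add: VectorSpace.subspace_def)
  then interpret W: vectorspace "restr_ring K" "V\<lparr>carrier := W\<rparr>" by (rule V.subspace_is_vs)
  show ?thesis
    using W.card_carrier_eq_power_dim assms(3) by (simp add: dim_over_def carrier_restr_ring)
qed

text \<open>Spans are recognised by minimality among submodules, without handling linear
  combinations.\<close>

lemma span_over_eqI:
  assumes V: "vectorspace (restr_ring K) V" and T: "submodule (restr_ring K) T V" and "S \<subseteq> T"
    and least: "\<And>N. submodule (restr_ring K) N V \<Longrightarrow> S \<subseteq> N \<Longrightarrow> T \<subseteq> N"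
  shows "span_over K V S = T"
proof -
  interpret V: vectorspace "restr_ring K" V by fact
  have "S \<subseteq> carrier V" using T \<open>S \<subseteq> T\<close> by (auto simp: submodule_def)
  then show ?thesis unfolding span_over_def
    using V.span_is_subset[OF \<open>S \<subseteq> T\<close> T] least[OF V.span_is_submodule V.in_own_span] by blast
qed

lemma submodule_field_module_iff:
  fixes K :: "'a::field set"
  assumes "subfld K"
  shows "submodule (restr_ring K) W (field_module TYPE('a)) \<longleftrightarrow> subsp K W"
  using vectorspace_field_module[OF assms]
  by (auto simp: submodule_def subsp_def vectorspace_def field_module_def carrier_restr_ring)

lemma dim_over_field_module:
  fixes K :: "'a::{field, finite} set"
  assumes "subfld K" "subsp K W"
  shows "dim_over K (field_module TYPE('a)) W = vdim K W"
  using card_eq_power_dim_over[OF vectorspace_field_module[OF assms(1)]]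
    submodule_field_module_iff[OF assms(1)] assms(2) by (intro vdim_eqI[OF assms(1), symmetric]) auto

lemma span_over_field_module_eqI:
  fixes K :: "'a::field set"
  assumes K: "subfld K" and "subsp K T" "S \<subseteq> T" "\<And>N. subsp K N \<Longrightarrow> S \<subseteq> N \<Longrightarrow> T \<subseteq> N"
  shows "span_over K (field_module TYPE('a)) S = T"
  using assms by (intro span_over_eqI vectorspace_field_module) (auto simp: submodule_field_module_iff)

lemma span_over_1_xi:
  fixes K :: "'a::field set"
  assumes K: "subfld K" shows "span_over K (field_module TYPE('a)) {1, \<xi>} = pspan K \<xi> 2"
proof (rule span_over_field_module_eqI[OF K subsp_pspan[OF K]])
  show "{1, \<xi>} \<subseteq> pspan K \<xi> 2"
    using power_in_pspan[OF K, of 0 2 \<xi>] power_in_pspan[OF K, of 1 2 \<xi>] by simp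
next
  fix N assume "subsp K N" "{1, \<xi>} \<subseteq> N"
  then show "pspan K \<xi> 2 \<subseteq> N" by (intro pspan_least) (auto simp: less_2_cases_iff)
qed

lemma subsp_sum: "subsp K V \<Longrightarrow> (\<And>i. i \<in> I \<Longrightarrow> f i \<in> V) \<Longrightarrow> sum f I \<in> V"
  by (induction I rule: infinite_finite_induct) (auto simp: subsp_def)

subsection \<open>Coordinate vectors over the ground field\<close>

definition kvecs :: "'a::field set \<Rightarrow> nat \<Rightarrow> 'a vec set" where
  "kvecs K n = {v \<in> carrier_vec n. \<forall>i<n. v $ i \<in> K}"

lemma card_kvecs: "card (kvecs K n) = card K ^ n"
proof -
  let ?f = "\<lambda>v. \<lambda>i\<in>{..<n}. v $ i"
  have "bij_betw ?f (kvecs K n) ({..<n} \<rightarrow>\<^sub>E K)"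
    unfolding bij_betw_def
  proof
    show "inj_on ?f (kvecs K n)"
    proof (rule inj_onI)
      fix u v assume uv: "u \<in> kvecs K n" "v \<in> kvecs K n" "?f u = ?f v"
      have "u $ i = v $ i" if "i < n" for i using fun_cong[OF uv(3), of i] that by simp
      then show "u = v" using uv(1,2) by (intro eq_vecI) (auto simp: kvecs_def)
    qed
    show "?f ` kvecs K n = ({..<n} \<rightarrow>\<^sub>E K)"
    proof (intro equalityI subsetI)
      fix g assume g: "g \<in> {..<n} \<rightarrow>\<^sub>E K"
      then have "?f (vec n g) = g" by (auto simp: restrict_def PiE_def extensional_def fun_eq_iff)
      moreover have "vec n g \<in> kvecs K n" using g by (auto simp: kvecs_def)
      ultimately show "g \<in> ?f ` kvecs K n" by (metis imageI)
    qed (auto simp: kvecs_def restrict_def split: if_splits)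
  qed
  then show ?thesis by (auto dest: bij_betw_same_card simp: card_PiE)
qed

lemma finite_kvecs: "finite (K :: 'a::field set) \<Longrightarrow> finite (kvecs K n)"
proof -
  assume "finite K"
  have "kvecs K n \<subseteq> (\<lambda>xs. vec_of_list xs) ` {xs. set xs \<subseteq> K \<and> length xs = n}"
  proof
    fix v assume "v \<in> kvecs K n"
    then have "v = vec_of_list (list_of_vec v)" "set (list_of_vec v) \<subseteq> K" "length (list_of_vec v) = n"
      by (auto simp: kvecs_def vec_list set_list_of_vec elim: vec_setE)
    then show "v \<in> (\<lambda>xs. vec_of_list xs) ` {xs. set xs \<subseteq> K \<and> length xs = n}" by blast
  qed
  then show ?thesis using finite_lists_length_eq[OF \<open>finite K\<close>] by (meson finite_imageI finite_subset)
qed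

lemma kvecs_carrier: "k \<in> kvecs K n \<Longrightarrow> k \<in> carrier_vec n"
  by (simp add: kvecs_def)

lemma kvecs_closed:
  assumes K: "subfld K"
  shows "0\<^sub>v n \<in> kvecs K n" "\<And>u v. u \<in> kvecs K n \<Longrightarrow> v \<in> kvecs K n \<Longrightarrow> u + v \<in> kvecs K n"
    "\<And>c u. c \<in> K \<Longrightarrow> u \<in> kvecs K n \<Longrightarrow> c \<cdot>\<^sub>v u \<in> kvecs K n"
    "\<And>i. i < n \<Longrightarrow> unit_vec n i \<in> kvecs K n"
  using K by (auto simp: kvecs_def subfldD)

text \<open>The K-span of the entries, written as an image of the coefficient vectors so that it can
  be counted.\<close>

definition entry_span :: "'a::field set \<Rightarrow> 'a vec \<Rightarrow> 'a set" where
  "entry_span K c = (\<lambda>k. k \<bullet> c) ` kvecs K (dim_vec c)"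

lemma subsp_entry_span:
  assumes K: "subfld K" shows "subsp K (entry_span K c)"
  unfolding subsp_def
proof (intro conjI ballI)
  let ?n = "dim_vec c"
  have "0\<^sub>v ?n \<bullet> c = 0" by (intro scalar_prod_left_zero) auto
  then show "0 \<in> entry_span K c" using kvecs_closed(1)[OF K] unfolding entry_span_def by (metis imageI)
  fix x assume "x \<in> entry_span K c"
  then obtain u where u: "x = u \<bullet> c" "u \<in> kvecs K ?n" by (auto simp: entry_span_def)
  {
    fix y assume "y \<in> entry_span K c"
    then obtain v where v: "y = v \<bullet> c" "v \<in> kvecs K ?n" by (auto simp: entry_span_def)
    have "x + y = (u + v) \<bullet> c"
      unfolding u v by (rule add_scalar_prod_distrib[symmetric]) (use u v in \<open>auto simp: kvecs_def\<close>)
    then show "x + y \<in> entry_span K c"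
      unfolding entry_span_def using kvecs_closed(2)[OF K u(2) v(2)] by (metis imageI)
  }
  fix k assume k: "k \<in> K"
  have "k * x = (k \<cdot>\<^sub>v u) \<bullet> c" unfolding u using u(2) by (simp add: kvecs_def)
  then show "k * x \<in> entry_span K c"
    unfolding entry_span_def using kvecs_closed(3)[OF K k u(2)] by (metis imageI)
qed

lemma entry_in_entry_span:
  assumes K: "subfld K" and "i < dim_vec c" shows "c $ i \<in> entry_span K c"
proof -
  have "c $ i = unit_vec (dim_vec c) i \<bullet> c" using assms(2) by simp
  then show ?thesis unfolding entry_span_def using kvecs_closed(4)[OF K assms(2)] by (metis imageI)
qed

lemma entry_span_least:
  assumes "subsp K V" "\<And>i. i < dim_vec c \<Longrightarrow> c $ i \<in> V" shows "entry_span K c \<subseteq> V"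
proof
  fix x assume "x \<in> entry_span K c"
  then obtain u where u: "x = u \<bullet> c" "u \<in> kvecs K (dim_vec c)" by (auto simp: entry_span_def)
  show "x \<in> V" unfolding u scalar_prod_def
    by (rule subsp_sum[OF assms(1)]) (use u assms in \<open>auto simp: kvecs_def subsp_def\<close>)
qed

lemma rank_weight_eq:
  fixes K :: "'a::{field, finite} set"
  assumes K: "subfld K" shows "rank_weight K c = vdim K (entry_span K c)"
proof -
  have "span_over K (field_module TYPE('a)) (set\<^sub>v c) = entry_span K c"
  proof (rule span_over_field_module_eqI[OF K subsp_entry_span[OF K]])
    show "set\<^sub>v c \<subseteq> entry_span K c" using entry_in_entry_span[OF K] by (auto elim!: vec_setE)
    fix N assume "subsp K N" "set\<^sub>v c \<subseteq> N"
    then show "entry_span K c \<subseteq> N" by (intro entry_span_least) (auto intro: vec_setI)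
  qed
  then show ?thesis using dim_over_field_module[OF K subsp_entry_span[OF K]] by (simp add: rank_weight_def)
qed

lemma mult_mat_vec_in_submodule:
  fixes G :: "'a::field mat"
  assumes G: "G \<in> carrier_mat r n" and k: "k \<in> kvecs K n"
    and N: "submodule (restr_ring K) N (module_vec TYPE('a) r)" and cols: "set (cols G) \<subseteq> N"
  shows "G *\<^sub>v k \<in> N"
proof -
  have add: "u + v \<in> N" if "u \<in> N" "v \<in> N" for u v
    using submodule.m_closed[OF N that] by (simp add: module_vec_simps)
  have smult: "c \<cdot>\<^sub>v u \<in> N" if "c \<in> K" "u \<in> N" for c u
    using submodule.smult_closed[OF N, of c u] that by (simp add: module_vec_simps carrier_restr_ring)
  \<comment> \<open>Truncating k makes the product a partial sum of columns, and the induction adds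
    one column at a time.\<close>
  define p where "p j = vec n (\<lambda>i. if i < j then k $ i else 0)" for j
  have "G *\<^sub>v p j \<in> N" if "j \<le> n" for j
    using that
  proof (induction j)
    case 0
    have "G *\<^sub>v p 0 = 0\<^sub>v r" using G by (intro eq_vecI) (auto simp: p_def scalar_prod_def)
    then show ?case using submodule.zero_closed[OF N] by (simp add: module_vec_simps)
  next
    case (Suc j)
    have "p (Suc j) = p j + (k $ j) \<cdot>\<^sub>v unit_vec n j"
      using Suc.prems by (intro eq_vecI) (auto simp: p_def unit_vec_def less_Suc_eq)
    then have "G *\<^sub>v p (Suc j) = G *\<^sub>v p j + (k $ j) \<cdot>\<^sub>v (G *\<^sub>v unit_vec n j)"
      using mult_add_distrib_mat_vec[OF G, of "p j" "(k $ j) \<cdot>\<^sub>v unit_vec n j"]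
        mult_mat_vec[OF G, of "unit_vec n j"] by (simp add: p_def)
    moreover have "G *\<^sub>v unit_vec n j = col G j"
      using Suc.prems G by (intro eq_vecI) auto
    moreover have "col G j \<in> N" using cols Suc.prems G by (auto simp: cols_def)
    moreover have "k $ j \<in> K" using k Suc.prems by (auto simp: kvecs_def)
    ultimately show ?case using Suc add smult by simp
  qed
  moreover have "p n = k" using k by (intro eq_vecI) (auto simp: p_def kvecs_def)
  ultimately show ?thesis by (metis order_refl)
qed

lemma span_over_cols:
  fixes G :: "'a::field mat"
  assumes K: "subfld K" and G: "G \<in> carrier_mat r n"
  shows "span_over K (module_vec TYPE('a) r) (set (cols G)) = (\<lambda>k. G *\<^sub>v k) ` kvecs K n"
    and "submodule (restr_ring K) ((\<lambda>k. G *\<^sub>v k) ` kvecs K n) (module_vec TYPE('a) r)"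
proof -
  let ?T = "(\<lambda>k. G *\<^sub>v k) ` kvecs K n"
  note V = vectorspace_module_vec[OF K]
  have car: "k \<in> carrier_vec n" if "k \<in> kvecs K n" for k using that by (simp add: kvecs_def)
  show T: "submodule (restr_ring K) ?T (module_vec TYPE('a) r)"
  proof (rule LinearCombinations.submodule.intro)
    show "Module.module (restr_ring K) (module_vec TYPE('a) r)" using V by (simp add: vectorspace_def)
    show "?T \<subseteq> carrier (module_vec TYPE('a) r)"
      using G car by (auto simp: module_vec_simps intro: mult_mat_vec_carrier)
    show "\<zero>\<^bsub>module_vec TYPE('a) r\<^esub> \<in> ?T"
    proof -
      have "G *\<^sub>v 0\<^sub>v n = 0\<^sub>v r" using G by (intro eq_vecI) auto
      then show ?thesis using kvecs_closed(1)[OF K, of n] by (auto simp: module_vec_simps intro: image_eqI[rotated])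
    qed
    fix u v assume "u \<in> ?T" "v \<in> ?T"
    then obtain k l where kl: "u = G *\<^sub>v k" "v = G *\<^sub>v l" "k \<in> kvecs K n" "l \<in> kvecs K n" by auto
    then have "u + v = G *\<^sub>v (k + l)" using mult_add_distrib_mat_vec[OF G] car by simp
    then show "u \<oplus>\<^bsub>module_vec TYPE('a) r\<^esub> v \<in> ?T"
      using kvecs_closed(2)[OF K kl(3,4)] by (auto simp: module_vec_simps)
  next
    fix c v assume c: "c \<in> carrier (restr_ring K)" and "v \<in> ?T"
    then obtain k where k: "v = G *\<^sub>v k" "k \<in> kvecs K n" by auto
    then have "c \<cdot>\<^sub>v v = G *\<^sub>v (c \<cdot>\<^sub>v k)" using mult_mat_vec[OF G] car by simp
    then show "c \<odot>\<^bsub>module_vec TYPE('a) r\<^esub> v \<in> ?T"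
      using kvecs_closed(3)[OF K _ k(2)] c by (auto simp: module_vec_simps carrier_restr_ring)
  qed
  show "span_over K (module_vec TYPE('a) r) (set (cols G)) = ?T"
  proof (rule span_over_eqI[OF V T])
    show "set (cols G) \<subseteq> ?T"
    proof
      fix v assume "v \<in> set (cols G)"
      then obtain j where j: "j < n" "v = col G j" using G by (auto simp: cols_def)
      have "G *\<^sub>v unit_vec n j = col G j" using j G by (intro eq_vecI) auto
      then show "v \<in> ?T" using kvecs_closed(4)[OF K j(1)] j by (metis imageI)
    qed
    fix N assume "submodule (restr_ring K) N (module_vec TYPE('a) r)" "set (cols G) \<subseteq> N"
    then show "?T \<subseteq> N" using mult_mat_vec_in_submodule[OF G] by blast
  qed
qed

section \<open>Two-dimensional codes\<close>

definition pairspan :: "'a::field vec \<Rightarrow> 'a vec \<Rightarrow> 'a vec set" where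
  "pairspan c1 c2 = (\<lambda>(a, b). a \<cdot>\<^sub>v c1 + b \<cdot>\<^sub>v c2) ` UNIV"

lemma pairspanI: "a \<cdot>\<^sub>v c1 + b \<cdot>\<^sub>v c2 \<in> pairspan c1 c2"
  by (auto simp: pairspan_def)

lemma pairspanE:
  assumes "c \<in> pairspan c1 c2" obtains a b where "c = a \<cdot>\<^sub>v c1 + b \<cdot>\<^sub>v c2"
  using assms by (auto simp: pairspan_def)

lemma row_space_two_rows:
  fixes G :: "'a::field mat"
  assumes G: "G \<in> carrier_mat 2 n"
  shows "vec_space.row_space n G = pairspan (row G 0) (row G 1)"
proof -
  interpret vec_space "TYPE('a)" n .
  have eq: "G\<^sup>T *\<^sub>v y = (y $ 0) \<cdot>\<^sub>v row G 0 + (y $ 1) \<cdot>\<^sub>v row G 1" if "y \<in> carrier_vec 2" for y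
    using G that
    by (intro eq_vecI) (auto simp: scalar_prod_def numeral_2_eq_2 mult.commute)
  show ?thesis
  proof (intro equalityI subsetI)
    fix w assume "w \<in> row_space G"
    then obtain y where "y \<in> carrier_vec 2" "w = G\<^sup>T *\<^sub>v y" using G unfolding row_space_eq[OF G] by auto
    then show "w \<in> pairspan (row G 0) (row G 1)" using eq pairspanI by metis
  next
    fix w assume "w \<in> pairspan (row G 0) (row G 1)"
    then obtain a b where w: "w = a \<cdot>\<^sub>v row G 0 + b \<cdot>\<^sub>v row G 1" by (rule pairspanE)
    have "G\<^sup>T *\<^sub>v vec 2 (\<lambda>i. if i = 0 then a else b) = w" unfolding w by (subst eq) auto
    moreover have "vec 2 (\<lambda>i. if i = 0 then a else b) \<in> carrier_vec 2" by auto
    moreover have "w \<in> carrier_vec n" unfolding w using G by auto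
    ultimately show "w \<in> row_space G" unfolding row_space_eq[OF G] using G by auto
  qed
qed

text \<open>The first injectivity is independence of the two rows over the big field, hence
  dimension 2; the second is independence of the columns over \<open>K\<close>, hence nondegeneracy.
  The map in the second one parametrises the K-span of the columns.\<close>

definition code_basis :: "'a::field set \<Rightarrow> nat \<Rightarrow> 'a vec \<Rightarrow> 'a vec \<Rightarrow> 'a vec set \<Rightarrow> bool" where
  "code_basis K n c1 c2 C \<longleftrightarrow> c1 \<in> carrier_vec n \<and> c2 \<in> carrier_vec n \<and> C = pairspan c1 c2 \<and>
     inj (\<lambda>(a, b). a \<cdot>\<^sub>v c1 + b \<cdot>\<^sub>v c2) \<and> inj_on (\<lambda>k. (k \<bullet> c1, k \<bullet> c2)) (kvecs K n)"

lemma code_basisD: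
  assumes "code_basis K n c1 c2 C"
  shows "c1 \<in> carrier_vec n" "c2 \<in> carrier_vec n" "C = pairspan c1 c2"
    "inj (\<lambda>(a, b). a \<cdot>\<^sub>v c1 + b \<cdot>\<^sub>v c2)" "inj_on (\<lambda>k. (k \<bullet> c1, k \<bullet> c2)) (kvecs K n)"
  using assms by (auto simp: code_basis_def)

lemma finite_carrier_vec: "finite (carrier_vec n :: 'a::{field, finite} vec set)"
proof -
  have "carrier_vec n = kvecs (UNIV :: 'a set) n" by (auto simp: kvecs_def)
  then show ?thesis using finite_kvecs[of "UNIV :: 'a set" n] by simp
qed

lemma restr_ring_UNIV: "restr_ring (UNIV :: 'a::field set) = class_ring"
  by (simp add: restr_ring_def)

lemma inj_on_mult_mat_vec_iff:
  fixes G :: "'a::field mat"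
  assumes G: "G \<in> carrier_mat 2 n"
  shows "inj_on (\<lambda>k. G *\<^sub>v k) (kvecs K n) \<longleftrightarrow> inj_on (\<lambda>k. (k \<bullet> row G 0, k \<bullet> row G 1)) (kvecs K n)"
proof -
  have "G *\<^sub>v k = G *\<^sub>v l \<longleftrightarrow> (k \<bullet> row G 0, k \<bullet> row G 1) = (l \<bullet> row G 0, l \<bullet> row G 1)"
    if "k \<in> kvecs K n" "l \<in> kvecs K n" for k l
  proof -
    have kl: "k \<in> carrier_vec n" "l \<in> carrier_vec n" using that by (auto simp: kvecs_def)
    have r: "row G i \<in> carrier_vec n" for i using G by auto
    have "G *\<^sub>v k = G *\<^sub>v l \<longleftrightarrow> (\<forall>i<2. row G i \<bullet> k = row G i \<bullet> l)"
      using G by (auto simp: vec_eq_iff)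
    also have "\<dots> \<longleftrightarrow> (row G 0 \<bullet> k = row G 0 \<bullet> l \<and> row G 1 \<bullet> k = row G 1 \<bullet> l)"
      by (auto simp: less_2_cases_iff)
    finally show ?thesis using comm_scalar_prod[OF r kl(1)] comm_scalar_prod[OF r kl(2)] by simp
  qed
  then show ?thesis by (auto simp: inj_on_def)
qed

text \<open>Both injectivities come from counting: the dimensions make each image as large as its
  finite domain.\<close>

lemma nondegenerate_code_imp_basis:
  fixes K :: "'a::{field, finite} set"
  assumes K: "subfld K" and C: "nondegenerate_code K n 2 C"
  obtains c1 c2 where "code_basis K n c1 c2 C"
proof -
  obtain G where G: "G \<in> carrier_mat 2 n" and row: "vec_space.row_space n G = C"
    and dim: "dim_over K (module_vec TYPE('a) 2) (span_over K (module_vec TYPE('a) 2) (set (cols G))) = n"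
    using C by (auto simp: nondegenerate_code_def generator_matrix_def)
  have sub: "VectorSpace.subspace class_ring C (module_vec TYPE('a) n)"
    and dimC: "vectorspace.dim class_ring ((module_vec TYPE('a) n)\<lparr>carrier := C\<rparr>) = 2"
    using C by (auto simp: nondegenerate_code_def is_code_def)
  let ?c1 = "row G 0" and ?c2 = "row G 1"
  have Cp: "C = pairspan ?c1 ?c2" using row_space_two_rows[OF G] row by simp
  have c: "?c1 \<in> carrier_vec n" "?c2 \<in> carrier_vec n" using G by auto
  have "C \<subseteq> carrier_vec n" unfolding Cp using c by (auto elim!: pairspanE)
  then have "finite C" by (rule finite_subset[OF _ finite_carrier_vec])
  have "card C = CARD('a) ^ dim_over UNIV (module_vec TYPE('a) n) C"
  proof (rule card_eq_power_dim_over)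
    show "vectorspace (restr_ring UNIV) (module_vec TYPE('a) n)"
      by (rule vectorspace_module_vec[OF subfld_UNIV])
    show "submodule (restr_ring UNIV) C (module_vec TYPE('a) n)"
      using sub by (simp add: restr_ring_UNIV VectorSpace.subspace_def)
  qed fact
  then have "card C = card (UNIV :: ('a \<times> 'a) set)"
    using dimC by (simp add: dim_over_def restr_ring_UNIV card_prod power2_eq_square)
  then have 1: "inj (\<lambda>(a, b). a \<cdot>\<^sub>v ?c1 + b \<cdot>\<^sub>v ?c2)"
    unfolding Cp pairspan_def by (intro eq_card_imp_inj_on) auto
  have "card ((\<lambda>k. G *\<^sub>v k) ` kvecs K n) = card K ^ n"
    using card_eq_power_dim_over[OF vectorspace_module_vec[OF K] span_over_cols(2)[OF K G]] dim
      finite_kvecs[of K n] by (simp add: span_over_cols(1)[OF K G])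
  then have "inj_on (\<lambda>k. G *\<^sub>v k) (kvecs K n)"
    by (intro eq_card_imp_inj_on finite_kvecs) (auto simp: card_kvecs)
  then show thesis using that[of ?c1 ?c2] c Cp 1 by (simp add: code_basis_def inj_on_mult_mat_vec_iff[OF G])
qed

lemma code_basis_imp_nondegenerate:
  fixes K :: "'a::{field, finite} set"
  assumes K: "subfld K" and cb: "code_basis K n c1 c2 C"
  shows "nondegenerate_code K n 2 C"
proof -
  note c = code_basisD[OF cb]
  define G where "G = mat_of_rows n [c1, c2]"
  have G: "G \<in> carrier_mat 2 n" using mat_of_rows_carrier(1)[of n "[c1, c2]"] by (simp add: G_def numeral_2_eq_2)
  have rows: "row G 0 = c1" "row G 1 = c2"
    using c unfolding G_def by (auto simp: mat_of_rows_row)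
  have row: "vec_space.row_space n G = C" using row_space_two_rows[OF G] rows c by simp
  interpret V: vec_space "TYPE('a)" n .
  have "set (rows G) \<subseteq> carrier_vec n" using G by (auto simp: rows_def)
  then have sub: "VectorSpace.subspace class_ring C (module_vec TYPE('a) n)"
    using V.span_is_subspace[of "set (rows G)"] row by (simp add: V.row_space_def)
  have "C \<subseteq> carrier_vec n" unfolding c(3) using c by (auto elim!: pairspanE)
  then have "finite C" by (rule finite_subset[OF _ finite_carrier_vec])
  have "card C = CARD('a) ^ dim_over UNIV (module_vec TYPE('a) n) C"
  proof (rule card_eq_power_dim_over)
    show "vectorspace (restr_ring UNIV) (module_vec TYPE('a) n)"
      by (rule vectorspace_module_vec[OF subfld_UNIV])
    show "submodule (restr_ring UNIV) C (module_vec TYPE('a) n)"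
      using sub by (simp add: restr_ring_UNIV VectorSpace.subspace_def)
  qed fact
  moreover have "card C = CARD('a) ^ 2"
    unfolding c(3) pairspan_def using card_image[OF c(4)] by (simp add: card_prod power2_eq_square)
  moreover have "1 < CARD('a)" using card_subfld_ge_2[OF subfld_UNIV, where 'a = 'a] by simp
  ultimately have "is_code n 2 C"
    using sub unfolding is_code_def by (simp add: dim_over_def restr_ring_UNIV)
  moreover have "dim_over K (module_vec TYPE('a) 2) (span_over K (module_vec TYPE('a) 2) (set (cols G))) = n"
  proof -
    have "inj_on (\<lambda>k. G *\<^sub>v k) (kvecs K n)" using c(5) by (simp only: inj_on_mult_mat_vec_iff[OF G] rows)
    then have "card ((\<lambda>k. G *\<^sub>v k) ` kvecs K n) = card K ^ n" by (simp add: card_image card_kvecs)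
    then have "card K ^ n = card K ^ dim_over K (module_vec TYPE('a) 2) (span_over K (module_vec TYPE('a) 2) (set (cols G)))"
      using card_eq_power_dim_over[OF vectorspace_module_vec[OF K] span_over_cols(2)[OF K G]]
        finite_kvecs[of K n] by (simp add: span_over_cols(1)[OF K G])
    then show ?thesis using card_subfld_ge_2[OF K] by simp
  qed
  ultimately show ?thesis
    unfolding nondegenerate_code_def generator_matrix_def using G row by blast
qed

text \<open>Words are combinations of d1 and d2, so k \<bullet> d1 and k \<bullet> d2 determine the
  products of k with all words, in particular with the old basis.\<close>

lemma code_basis_change:
  fixes K :: "'a::{field, finite} set"
  assumes cb: "code_basis K n c1 c2 C" and d: "d1 \<in> C" "d2 \<in> C"
    and inj: "inj (\<lambda>(a, b). a \<cdot>\<^sub>v d1 + b \<cdot>\<^sub>v d2)"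
  shows "code_basis K n d1 d2 C"
proof -
  note c = code_basisD[OF cb]
  have Cn: "C \<subseteq> carrier_vec n" unfolding c(3) using c by (auto elim!: pairspanE)
  have dn: "d1 \<in> carrier_vec n" "d2 \<in> carrier_vec n" using d Cn by auto
  obtain p q r s where pq: "d1 = p \<cdot>\<^sub>v c1 + q \<cdot>\<^sub>v c2" "d2 = r \<cdot>\<^sub>v c1 + s \<cdot>\<^sub>v c2"
    using d unfolding c(3) by (auto elim!: pairspanE)
  have "pairspan d1 d2 \<subseteq> C"
  proof
    fix v assume "v \<in> pairspan d1 d2"
    then obtain a b where "v = a \<cdot>\<^sub>v d1 + b \<cdot>\<^sub>v d2" by (rule pairspanE)
    then have "v = (a * p + b * r) \<cdot>\<^sub>v c1 + (a * q + b * s) \<cdot>\<^sub>v c2"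
      unfolding pq using c by (intro eq_vecI) (auto simp: algebra_simps)
    then show "v \<in> C" unfolding c(3) by (simp add: pairspanI)
  qed
  moreover have "card (pairspan d1 d2) = card C"
    unfolding c(3) pairspan_def using card_image[OF inj] card_image[OF c(4)] by simp
  moreover have "finite C" by (rule finite_subset[OF Cn finite_carrier_vec])
  ultimately have eq: "C = pairspan d1 d2" by (metis card_subset_eq)
  have "inj_on (\<lambda>k. (k \<bullet> d1, k \<bullet> d2)) (kvecs K n)"
  proof (rule inj_onI)
    fix k l assume kl: "k \<in> kvecs K n" "l \<in> kvecs K n" "(k \<bullet> d1, k \<bullet> d2) = (l \<bullet> d1, l \<bullet> d2)"
    have car: "k \<in> carrier_vec n" "l \<in> carrier_vec n" using kl by (auto simp: kvecs_def)
    have "k \<bullet> v = l \<bullet> v" if "v \<in> C" for v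
    proof -
      obtain a b where v: "v = a \<cdot>\<^sub>v d1 + b \<cdot>\<^sub>v d2" using \<open>v \<in> C\<close> unfolding eq by (rule pairspanE)
      have "u \<bullet> v = a * (u \<bullet> d1) + b * (u \<bullet> d2)" if "u \<in> carrier_vec n" for u
        unfolding v using that dn by (simp add: scalar_prod_add_distrib[of _ n])
      then show ?thesis using car kl(3) by simp
    qed
    moreover have "c1 \<in> C" "c2 \<in> C"
    proof -
      have "c1 = 1 \<cdot>\<^sub>v c1 + 0 \<cdot>\<^sub>v c2" "c2 = 0 \<cdot>\<^sub>v c1 + 1 \<cdot>\<^sub>v c2"
        using c by (intro eq_vecI; auto)+
      then show "c1 \<in> C" "c2 \<in> C" unfolding c(3) by (metis pairspanI)+
    qed
    ultimately show "k = l" using c(5) kl(1,2) by (auto simp: inj_on_def)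
  qed
  then show ?thesis using dn eq inj by (simp add: code_basis_def)
qed

lemma inj_of_not_proportional:
  fixes c d :: "'a::field vec"
  assumes "c \<in> carrier_vec n" "d \<in> carrier_vec n" "c \<noteq> 0\<^sub>v n" "d \<noteq> 0\<^sub>v n" "\<not> proportional c d"
  shows "inj (\<lambda>(a, b). a \<cdot>\<^sub>v c + b \<cdot>\<^sub>v d)"
proof (rule injI, clarify)
  fix a b a' b' assume eq: "a \<cdot>\<^sub>v c + b \<cdot>\<^sub>v d = a' \<cdot>\<^sub>v c + b' \<cdot>\<^sub>v d"
  have e: "(a - a') * c $ i = (b' - b) * d $ i" if "i < n" for i
    using arg_cong[OF eq, of "\<lambda>v. v $ i"] that assms(1,2) by (simp add: algebra_simps)
  have nz: "\<exists>i<n. v $ i \<noteq> 0" if "v \<in> carrier_vec n" "v \<noteq> 0\<^sub>v n" for v :: "'a vec"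
    using that by (auto simp: vec_eq_iff)
  have "b = b'"
  proof (rule ccontr)
    assume "b \<noteq> b'"
    then have "d = ((a - a') / (b' - b)) \<cdot>\<^sub>v c"
      using e assms(1,2) by (intro eq_vecI) (auto simp: field_simps)
    moreover from this have "(a - a') / (b' - b) \<noteq> 0"
      using assms(1,4) by (intro notI) (auto simp: vec_eq_iff)
    ultimately show False using assms(5) unfolding proportional_def by blast
  qed
  moreover obtain i where "i < n" "c $ i \<noteq> 0" using nz assms(1,3) by blast
  ultimately show "a = a' \<and> b = b'" using e[of i] by simp
qed

subsection \<open>Weights\<close>

lemma entry_span_smult:
  assumes "c \<in> carrier_vec n" shows "entry_span K (a \<cdot>\<^sub>v c) = (*) a ` entry_span K c"
proof -
  have "k \<bullet> (a \<cdot>\<^sub>v c) = a * (k \<bullet> c)" if "k \<in> kvecs K (dim_vec c)" for k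
    using that by (simp add: kvecs_def)
  then show ?thesis unfolding entry_span_def by (force simp: image_image)
qed

lemma rank_weight_proportional:
  fixes K :: "'a::{field, finite} set"
  assumes K: "subfld K" and "c \<in> carrier_vec n" "proportional c d"
  shows "rank_weight K d = rank_weight K c"
  using assms(3) vdim_scale rank_weight_eq[OF K] entry_span_smult[OF assms(2)]
  by (auto simp: proportional_def)

lemma rank_weight_zero:
  fixes K :: "'a::{field, finite} set"
  assumes K: "subfld K" shows "rank_weight K (0\<^sub>v n) = 0"
proof -
  have "entry_span K (0\<^sub>v n) \<subseteq> {0}" by (rule entry_span_least[OF subsp_zero]) auto
  then have "entry_span K (0\<^sub>v n) = {0}" using subsp_0[OF subsp_entry_span[OF K]] by blast
  then show ?thesis using rank_weight_eq[OF K] vdim_zero[OF K] by simp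
qed

lemma rank_weight_le:
  fixes K :: "'a::{field, finite} set"
  assumes K: "subfld K" and "c \<in> carrier_vec n" shows "rank_weight K c \<le> n"
proof -
  have "card (entry_span K c) \<le> card (kvecs K n)"
    unfolding entry_span_def using assms(2) by (intro order_trans[OF card_image_le]) (auto simp: finite_kvecs)
  then have "card K ^ rank_weight K c \<le> card K ^ n"
    using card_eq_vdim[OF K subsp_entry_span[OF K, of c]] rank_weight_eq[OF K] by (simp add: card_kvecs)
  then show ?thesis using card_subfld_ge_2[OF K] by simp
qed

lemma image_subset_entry_spans:
  assumes "c \<in> carrier_vec n" "d \<in> carrier_vec n"
  shows "(\<lambda>k. (k \<bullet> c, k \<bullet> d)) ` kvecs K n \<subseteq> entry_span K c \<times> entry_span K d"
  using assms by (auto simp: entry_span_def)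

text \<open>The K-span of the columns, of dimension n, embeds into the product of the two entry
  spans.\<close>

lemma code_basis_weight_sum:
  fixes K :: "'a::{field, finite} set"
  assumes K: "subfld K" and cb: "code_basis K n c d C"
  shows "n \<le> rank_weight K c + rank_weight K d"
proof -
  note c = code_basisD[OF cb]
  have "card (kvecs K n) \<le> card (entry_span K c \<times> entry_span K d)"
    using card_image[OF c(5)] card_mono[OF _ image_subset_entry_spans[OF c(1,2), of K]] by simp
  then have "card K ^ n \<le> card K ^ (rank_weight K c + rank_weight K d)"
    using card_eq_vdim[OF K subsp_entry_span[OF K]] rank_weight_eq[OF K]
    by (simp add: card_kvecs card_cartesian_product power_add)
  then show ?thesis using card_subfld_ge_2[OF K] by simp
qed

text \<open>If some word has weight \<open>w0 < l\<close>, then all words not proportional to it have weight at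
  least \<open>2 l - w0\<close>.\<close>

lemma card_weight_spectrum_le:
  fixes K :: "'a::{field, finite} set"
  assumes K: "subfld K" and C: "nondegenerate_code K (2 * l) 2 C"
  shows "card (weight_spectrum K (2 * l) C) \<le> Suc l"
proof -
  let ?n = "2 * l"
  obtain c1 c2 where cb: "code_basis K ?n c1 c2 C" by (rule nondegenerate_code_imp_basis[OF K C])
  note c = code_basisD[OF cb]
  have Cn: "C \<subseteq> carrier_vec ?n" unfolding c(3) using c by (auto elim!: pairspanE)
  have le: "rank_weight K v \<le> ?n" if "v \<in> C" for v using rank_weight_le[OF K] Cn that by blast
  show ?thesis
  proof (cases "\<exists>v\<in>C - {0\<^sub>v ?n}. rank_weight K v < l")
    case False
    then have "weight_spectrum K ?n C \<subseteq> {l..?n}" using le by (force simp: weight_spectrum_def)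
    then have "card (weight_spectrum K ?n C) \<le> card {l..?n}" by (intro card_mono) auto
    then show ?thesis by simp
  next
    case True
    then obtain v where v: "v \<in> C" "v \<noteq> 0\<^sub>v ?n" "rank_weight K v < l" by auto
    have "weight_spectrum K ?n C \<subseteq> insert (rank_weight K v) {?n - rank_weight K v..?n}"
    proof
      fix x assume "x \<in> weight_spectrum K ?n C"
      then obtain u where u: "u \<in> C" "u \<noteq> 0\<^sub>v ?n" "x = rank_weight K u" by (auto simp: weight_spectrum_def)
      show "x \<in> insert (rank_weight K v) {?n - rank_weight K v..?n}"
      proof (cases "proportional v u")
        case True
        then show ?thesis using rank_weight_proportional[OF K, of v ?n u] v Cn u by auto
      next
        case False
        have "code_basis K ?n v u C"
          using inj_of_not_proportional[of v ?n u] v u Cn False by (intro code_basis_change[OF cb]) auto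
        then show ?thesis using code_basis_weight_sum[OF K] u le by fastforce
      qed
    qed
    then have "card (weight_spectrum K ?n C) \<le> card (insert (rank_weight K v) {?n - rank_weight K v..?n})"
      by (intro card_mono) auto
    also have "\<dots> \<le> Suc (card {?n - rank_weight K v..?n})" by (rule card_insert_le_m1) auto
    also have "\<dots> \<le> Suc l" using v(3) by simp
    finally show ?thesis .
  qed
qed

text \<open>When the column span is a full square, the two scalar products vary independently over
  S, so every weight becomes the dimension of a sum of two multiples of S.\<close>

lemma entry_span_combination:
  assumes c: "c1 \<in> carrier_vec n" "c2 \<in> carrier_vec n"
    and im: "(\<lambda>k. (k \<bullet> c1, k \<bullet> c2)) ` kvecs K n = S \<times> S"
  shows "entry_span K (a \<cdot>\<^sub>v c1 + b \<cdot>\<^sub>v c2) = (*) a ` S + (*) b ` S"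
proof -
  have e: "k \<bullet> (a \<cdot>\<^sub>v c1 + b \<cdot>\<^sub>v c2) = a * (k \<bullet> c1) + b * (k \<bullet> c2)" if "k \<in> kvecs K n" for k
    using that c by (simp add: kvecs_def scalar_prod_add_distrib[of _ n])
  have "entry_span K (a \<cdot>\<^sub>v c1 + b \<cdot>\<^sub>v c2) = (\<lambda>(x, y). a * x + b * y) ` ((\<lambda>k. (k \<bullet> c1, k \<bullet> c2)) ` kvecs K n)"
    unfolding entry_span_def image_image using e c by (intro image_cong) auto
  also have "\<dots> = (*) a ` S + (*) b ` S" unfolding im by (force simp: set_plus_def)
  finally show ?thesis .
qed

text \<open>The three weight-\<open>l\<close> words give three points of weight \<open>l\<close> in the linear set of the code;
  sending them to \<open>(1,0)\<close>, \<open>(0,1)\<close>, \<open>(1,-1)\<close> forces the column space to be \<open>S \<times> S\<close>.\<close>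

lemma three_words_imp_square:
  fixes K :: "'a::{field, finite} set"
  assumes K: "subfld K" and C: "nondegenerate_code K (2 * l) 2 C" and "0 < l"
    and w: "c1 \<in> C" "c2 \<in> C" "c3 \<in> C" "rank_weight K c1 = l" "rank_weight K c2 = l" "rank_weight K c3 = l"
    and np: "\<not> proportional c1 c2" "\<not> proportional c1 c3" "\<not> proportional c2 c3"
  obtains d1 d2 S where "code_basis K (2 * l) d1 d2 C" "subsp K S" "vdim K S = l"
    "(\<lambda>k. (k \<bullet> d1, k \<bullet> d2)) ` kvecs K (2 * l) = S \<times> S"
proof -
  let ?n = "2 * l"
  obtain g1 g2 where cb0: "code_basis K ?n g1 g2 C" by (rule nondegenerate_code_imp_basis[OF K C])
  note g = code_basisD[OF cb0]
  have Cn: "C \<subseteq> carrier_vec ?n" unfolding g(3) using g by (auto elim!: pairspanE)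
  have nz: "v \<noteq> 0\<^sub>v ?n" if "rank_weight K v = l" for v
    using that rank_weight_zero[OF K, of ?n] \<open>0 < l\<close> by (intro notI) simp
  have cn: "c1 \<in> carrier_vec ?n" "c2 \<in> carrier_vec ?n" "c3 \<in> carrier_vec ?n" using w Cn by auto
  have cb1: "code_basis K ?n c1 c2 C"
    using inj_of_not_proportional[OF cn(1,2) nz[OF w(4)] nz[OF w(5)] np(1)] w
    by (intro code_basis_change[OF cb0]) auto
  obtain a b where ab: "c3 = a \<cdot>\<^sub>v c1 + b \<cdot>\<^sub>v c2"
    using w(3) code_basisD(3)[OF cb1] by (auto elim: pairspanE)
  have "a \<noteq> 0"
  proof
    assume "a = 0"
    then have e: "c3 = b \<cdot>\<^sub>v c2" unfolding ab using cn by (intro eq_vecI) auto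
    then have "b \<noteq> 0" using nz[OF w(6)] cn by (intro notI) (auto simp: vec_eq_iff)
    then show False using e np(3) by (auto simp: proportional_def)
  qed
  have "b \<noteq> 0"
  proof
    assume "b = 0"
    then have e: "c3 = a \<cdot>\<^sub>v c1" unfolding ab using cn by (intro eq_vecI) auto
    then show False using \<open>a \<noteq> 0\<close> np(2) by (auto simp: proportional_def)
  qed
  \<comment> \<open>Scaled so that c3 = d1 - d2.\<close>
  define d1 where "d1 = a \<cdot>\<^sub>v c1"
  define d2 where "d2 = (- b) \<cdot>\<^sub>v c2"
  have d: "d1 \<in> carrier_vec ?n" "d2 \<in> carrier_vec ?n" using cn by (auto simp: d1_def d2_def)
  have inj: "inj (\<lambda>(p, q). p \<cdot>\<^sub>v d1 + q \<cdot>\<^sub>v d2)"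
  proof (rule injI, clarify)
    fix p q p' q' assume "p \<cdot>\<^sub>v d1 + q \<cdot>\<^sub>v d2 = p' \<cdot>\<^sub>v d1 + q' \<cdot>\<^sub>v d2"
    then have "(\<lambda>(x, y). x \<cdot>\<^sub>v c1 + y \<cdot>\<^sub>v c2) (p * a, q * - b) = (\<lambda>(x, y). x \<cdot>\<^sub>v c1 + y \<cdot>\<^sub>v c2) (p' * a, q' * - b)"
      by (simp add: d1_def d2_def smult_smult_assoc)
    then have "(p * a, q * - b) = (p' * a, q' * - b)" by (rule injD[OF code_basisD(4)[OF cb1]])
    then show "p = p' \<and> q = q'" using \<open>a \<noteq> 0\<close> \<open>b \<noteq> 0\<close> by simp
  qed
  have dC: "d1 \<in> C" "d2 \<in> C"
  proof -
    have "d1 = a \<cdot>\<^sub>v c1 + 0 \<cdot>\<^sub>v c2" "d2 = 0 \<cdot>\<^sub>v c1 + (- b) \<cdot>\<^sub>v c2"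
      using cn by (intro eq_vecI; auto simp: d1_def d2_def)+
    then show "d1 \<in> C" "d2 \<in> C" unfolding code_basisD(3)[OF cb1] by (metis pairspanI)+
  qed
  have cb: "code_basis K ?n d1 d2 C" by (rule code_basis_change[OF cb1 dC inj])
  let ?S1 = "entry_span K d1" and ?S2 = "entry_span K d2" and ?S3 = "entry_span K c3"
  have S: "subsp K ?S1" "subsp K ?S2" "subsp K ?S3" by (rule subsp_entry_span[OF K])+
  have dim: "vdim K ?S1 = l" "vdim K ?S2 = l" "vdim K ?S3 = l"
    using w(4-6) rank_weight_eq[OF K] vdim_scale[OF \<open>a \<noteq> 0\<close>] vdim_scale[of "- b"] \<open>b \<noteq> 0\<close>
    unfolding d1_def d2_def entry_span_smult[OF cn(1)] entry_span_smult[OF cn(2)] by auto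
  let ?f = "\<lambda>k. (k \<bullet> d1, k \<bullet> d2)"
  have "card (?f ` kvecs K ?n) = card (?S1 \<times> ?S2)"
    using card_image[OF code_basisD(5)[OF cb]] card_eq_vdim[OF K S(1)] card_eq_vdim[OF K S(2)] dim
    by (simp add: card_kvecs card_cartesian_product mult_2 power_add)
  then have im: "?f ` kvecs K ?n = ?S1 \<times> ?S2"
    using image_subset_entry_spans[OF d] by (intro card_subset_eq) auto
  have diff: "x - y \<in> ?S3" if xy: "x \<in> ?S1" "y \<in> ?S2" for x y
  proof -
    have "(x, y) \<in> ?f ` kvecs K ?n" using xy unfolding im by simp
    then obtain k where k: "k \<in> kvecs K ?n" "x = k \<bullet> d1" "y = k \<bullet> d2" by auto
    have kn: "k \<in> carrier_vec ?n" using k by (rule_tac kvecs_carrier)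
    have "k \<bullet> c3 = x - y"
      unfolding ab k(2,3) d1_def d2_def using cn kn by (simp add: scalar_prod_add_distrib[of _ ?n])
    then show ?thesis using imageI[OF k(1), of "\<lambda>k. k \<bullet> c3"] cn(3) by (simp add: entry_span_def)
  qed
  \<comment> \<open>In x - y both entries range independently; setting one of them to 0 puts each of
    the two spaces into the third, and equal dimensions make all three coincide.\<close>
  have "?S1 \<subseteq> ?S3" using diff subsp_0[OF S(2)] by force
  then have e1: "?S1 = ?S3" using dim by (intro vdim_subset_eq[OF K S(1) S(3)]) auto
  have "?S2 \<subseteq> ?S3" using diff[OF subsp_0[OF S(1)]] subsp_uminus[OF K S(3)] by force
  then have e2: "?S2 = ?S3" using dim by (intro vdim_subset_eq[OF K S(2) S(3)]) auto
  show thesis using that[OF cb S(3) dim(3)] im e1 e2 by simp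
qed

subsection \<open>Equivalence\<close>

lemma mult_mat_kvec:
  assumes K: "subfld K" and A: "A \<in> carrier_mat n n" "elements_mat A \<subseteq> K" and u: "u \<in> kvecs K n"
  shows "A *\<^sub>v u \<in> kvecs K n"
proof -
  have "A $$ (i, j) \<in> K" if "i < n" "j < n" for i j
    using A(2) elements_matI[OF A(1) that refl] by blast
  then have "(A *\<^sub>v u) $ i \<in> K" if "i < n" for i
    using that A(1) u unfolding kvecs_def
    by (auto simp: scalar_prod_def intro!: subsp_sum[OF subsp_subfld[OF K order_refl]] subfld_mult[OF K])
  then show ?thesis using A(1) u by (auto simp: kvecs_def)
qed

text \<open>By adjunction u \<bullet> (A^T c) = (A u) \<bullet> c, and A u again has coordinates in
  \<open>K\<close>.\<close>

lemma entry_span_transpose_subset: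
  assumes K: "subfld K" and A: "A \<in> carrier_mat n n" "elements_mat A \<subseteq> K" and c: "c \<in> carrier_vec n"
  shows "entry_span K (A\<^sup>T *\<^sub>v c) \<subseteq> entry_span K c"
proof
  fix x assume "x \<in> entry_span K (A\<^sup>T *\<^sub>v c)"
  then obtain u where u: "x = u \<bullet> (A\<^sup>T *\<^sub>v c)" "u \<in> kvecs K n" using A c by (auto simp: entry_span_def)
  have un: "u \<in> carrier_vec n" by (rule kvecs_carrier[OF u(2)])
  have "x = (A\<^sup>T *\<^sub>v c) \<bullet> u" unfolding u(1) using A c un by (intro comm_scalar_prod[of _ n]) auto
  also have "\<dots> = c \<bullet> (A *\<^sub>v u)" by (rule transpose_vec_mult_scalar[OF A(1) un c])
  also have "\<dots> = (A *\<^sub>v u) \<bullet> c" using A c un by (intro comm_scalar_prod[of _ n]) auto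
  finally show "x \<in> entry_span K c"
    using mult_mat_kvec[OF K A u(2)] c by (auto simp: entry_span_def)
qed

text \<open>A matrix over \<open>K\<close> can only shrink entry spans; as its inverse is also over
  \<open>K\<close>, they are unchanged.\<close>

lemma weight_spectrum_equivalent:
  fixes K :: "'a::{field, finite} set"
  assumes K: "subfld K" and eq: "equivalent_codes K n C C'" and C: "C \<subseteq> carrier_vec n"
  shows "weight_spectrum K n C' = weight_spectrum K n C"
proof -
  obtain A where "A \<in> GL_over K n" and C': "C' = (\<lambda>v. A\<^sup>T *\<^sub>v v) ` C"
    using eq by (auto simp: equivalent_codes_def)
  then obtain B where A: "A \<in> carrier_mat n n" "elements_mat A \<subseteq> K"
    and B: "B \<in> carrier_mat n n" "elements_mat B \<subseteq> K" and AB: "A * B = 1\<^sub>m n"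
    by (auto simp: GL_over_def)
  have undo: "B\<^sup>T *\<^sub>v (A\<^sup>T *\<^sub>v v) = v" if "v \<in> carrier_vec n" for v
  proof -
    have "B\<^sup>T *\<^sub>v (A\<^sup>T *\<^sub>v v) = (B\<^sup>T * A\<^sup>T) *\<^sub>v v"
      using A B that by (intro assoc_mult_mat_vec[symmetric, of _ n n _ n]) auto
    also have "B\<^sup>T * A\<^sup>T = (A * B)\<^sup>T" by (rule transpose_mult[OF A(1) B(1), symmetric])
    finally show ?thesis using that AB by simp
  qed
  have wt: "rank_weight K (A\<^sup>T *\<^sub>v v) = rank_weight K v" if "v \<in> carrier_vec n" for v
  proof -
    have Av: "A\<^sup>T *\<^sub>v v \<in> carrier_vec n" using A that by auto
    have "entry_span K (A\<^sup>T *\<^sub>v v) = entry_span K v"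
      using entry_span_transpose_subset[OF K A that]
        entry_span_transpose_subset[OF K B Av, unfolded undo[OF that]] by (rule equalityI)
    then show ?thesis using rank_weight_eq[OF K] by simp
  qed
  have zero: "A\<^sup>T *\<^sub>v v = 0\<^sub>v n \<longleftrightarrow> v = 0\<^sub>v n" if "v \<in> carrier_vec n" for v
  proof
    have z: "M\<^sup>T *\<^sub>v 0\<^sub>v n = 0\<^sub>v n" if "M \<in> carrier_mat n n" for M :: "'a mat"
      using that by (intro eq_vecI) auto
    show "v = 0\<^sub>v n" if "A\<^sup>T *\<^sub>v v = 0\<^sub>v n"
      using undo[OF \<open>v \<in> carrier_vec n\<close>] z[OF B(1)] unfolding that by simp
    show "A\<^sup>T *\<^sub>v v = 0\<^sub>v n" if "v = 0\<^sub>v n" using z[OF A(1)] unfolding that .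
  qed
  let ?f = "\<lambda>v. A\<^sup>T *\<^sub>v v"
  have "v \<in> C' - {0\<^sub>v n} \<longleftrightarrow> v \<in> ?f ` (C - {0\<^sub>v n})" for v
  proof
    assume "v \<in> C' - {0\<^sub>v n}"
    then obtain u where "u \<in> C" "v = ?f u" "?f u \<noteq> 0\<^sub>v n" unfolding C' by blast
    then show "v \<in> ?f ` (C - {0\<^sub>v n})" using zero[of u] C by auto
  next
    assume "v \<in> ?f ` (C - {0\<^sub>v n})"
    then obtain u where "u \<in> C" "v = ?f u" "u \<noteq> 0\<^sub>v n" by blast
    then show "v \<in> C' - {0\<^sub>v n}" unfolding C' using zero[of u] C by auto
  qed
  then have "C' - {0\<^sub>v n} = ?f ` (C - {0\<^sub>v n})" by blast
  then have "weight_spectrum K n C' = (\<lambda>v. rank_weight K (?f v)) ` (C - {0\<^sub>v n})"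
    by (simp add: weight_spectrum_def image_image)
  also have "\<dots> = weight_spectrum K n C"
    unfolding weight_spectrum_def by (rule image_cong[OF refl]) (use wt C in blast)
  finally show ?thesis .
qed

text \<open>Column j of A is a coefficient vector writing the j-th column of the rows d1, d2 through
  the columns of c1, c2.\<close>

lemma ex_transition_matrix:
  fixes c1 c2 d1 d2 :: "'a::field vec"
  assumes c: "c1 \<in> carrier_vec n" "c2 \<in> carrier_vec n" and d: "d1 \<in> carrier_vec n" "d2 \<in> carrier_vec n"
    and im: "\<And>j. j < n \<Longrightarrow> (d1 $ j, d2 $ j) \<in> (\<lambda>k. (k \<bullet> c1, k \<bullet> c2)) ` kvecs K n"
  obtains A where "A \<in> carrier_mat n n" "elements_mat A \<subseteq> K" "A\<^sup>T *\<^sub>v c1 = d1" "A\<^sup>T *\<^sub>v c2 = d2"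
proof -
  have "\<forall>j. \<exists>k. j < n \<longrightarrow> k \<in> kvecs K n \<and> k \<bullet> c1 = d1 $ j \<and> k \<bullet> c2 = d2 $ j" using im by force
  then obtain k where k: "\<And>j. j < n \<Longrightarrow> k j \<in> kvecs K n \<and> k j \<bullet> c1 = d1 $ j \<and> k j \<bullet> c2 = d2 $ j" by metis
  define A where "A = mat n n (\<lambda>(i, j). k j $ i)"
  have A: "A \<in> carrier_mat n n" by (simp add: A_def)
  have col: "col A j = k j" if "j < n" for j
    using k[OF that] that by (intro eq_vecI) (auto simp: A_def kvecs_def)
  show thesis
  proof (rule that[OF A])
    show "elements_mat A \<subseteq> K" using k by (auto simp: A_def elements_mat_def kvecs_def)
    show "A\<^sup>T *\<^sub>v c1 = d1" "A\<^sup>T *\<^sub>v c2 = d2" using A d k col by (auto intro!: eq_vecI)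
  qed
qed

text \<open>The vectors A B e_j and e_j have the same products with c1 and c2, because the
  transposes carry c1, c2 to d1, d2 and back; injectivity identifies them.\<close>

lemma transition_matrices_inverse:
  fixes c1 c2 d1 d2 :: "'a::field vec"
  assumes K: "subfld K" and c: "c1 \<in> carrier_vec n" "c2 \<in> carrier_vec n"
    and inj: "inj_on (\<lambda>k. (k \<bullet> c1, k \<bullet> c2)) (kvecs K n)"
    and A: "A \<in> carrier_mat n n" "elements_mat A \<subseteq> K" "A\<^sup>T *\<^sub>v c1 = d1" "A\<^sup>T *\<^sub>v c2 = d2"
    and B: "B \<in> carrier_mat n n" "elements_mat B \<subseteq> K" "B\<^sup>T *\<^sub>v d1 = c1" "B\<^sup>T *\<^sub>v d2 = c2"
  shows "A * B = 1\<^sub>m n"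
proof (rule mat_col_eqI)
  show "dim_row (A * B) = dim_row (1\<^sub>m n)" "dim_col (A * B) = dim_col (1\<^sub>m n)" using A B by auto
  fix j assume "j < dim_col (1\<^sub>m n)"
  then have j: "j < n" by simp
  have dot: "(M *\<^sub>v u) \<bullet> v = u \<bullet> (M\<^sup>T *\<^sub>v v)"
    if "M \<in> carrier_mat n n" "u \<in> carrier_vec n" "v \<in> carrier_vec n" for M :: "'a mat" and u v
  proof -
    have "(M *\<^sub>v u) \<bullet> v = v \<bullet> (M *\<^sub>v u)" using that by (intro comm_scalar_prod[of _ n]) auto
    also have "\<dots> = (M\<^sup>T *\<^sub>v v) \<bullet> u" by (rule transpose_vec_mult_scalar[OF that, symmetric])
    also have "\<dots> = u \<bullet> (M\<^sup>T *\<^sub>v v)" using that by (intro comm_scalar_prod[of _ n]) auto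
    finally show ?thesis .
  qed
  have d: "d1 \<in> carrier_vec n" "d2 \<in> carrier_vec n" using A c by auto
  have e: "unit_vec n j \<in> kvecs K n" by (rule kvecs_closed(4)[OF K j])
  have Be: "B *\<^sub>v unit_vec n j \<in> kvecs K n" by (rule mult_mat_kvec[OF K B(1,2) e])
  let ?u = "A *\<^sub>v (B *\<^sub>v unit_vec n j)"
  have u: "?u \<in> kvecs K n" by (rule mult_mat_kvec[OF K A(1,2) Be])
  have "?u \<bullet> c1 = unit_vec n j \<bullet> c1" "?u \<bullet> c2 = unit_vec n j \<bullet> c2"
    using dot[OF A(1) kvecs_carrier[OF Be]] dot[OF B(1), of "unit_vec n j"] c d A B by auto
  then have "?u = unit_vec n j" using inj_onD[OF inj, of ?u "unit_vec n j"] u e by simp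
  moreover have "col (A * B) j = (A * B) *\<^sub>v unit_vec n j" using A(1) B(1) j by (intro eq_vecI) (auto simp del: assoc_mult_mat_vec)
  moreover have "(A * B) *\<^sub>v unit_vec n j = ?u" using A B by (intro assoc_mult_mat_vec[of _ n n _ n]) auto
  ultimately show "col (A * B) j = col (1\<^sub>m n) j" using j by simp
qed

text \<open>The K-span of the columns determines the code up to equivalence, since two K-bases of
  that span are related by an invertible matrix over \<open>K\<close>.\<close>

lemma equivalent_codes_of_same_image:
  fixes K :: "'a::field set"
  assumes K: "subfld K" and cb: "code_basis K n c1 c2 C" and db: "code_basis K n d1 d2 D"
    and im: "(\<lambda>k. (k \<bullet> c1, k \<bullet> c2)) ` kvecs K n = (\<lambda>k. (k \<bullet> d1, k \<bullet> d2)) ` kvecs K n"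
  shows "equivalent_codes K n C D"
proof -
  note c = code_basisD[OF cb] and d = code_basisD[OF db]
  have unit: "(v1 $ j, v2 $ j) \<in> (\<lambda>k. (k \<bullet> v1, k \<bullet> v2)) ` kvecs K n"
    if "v1 \<in> carrier_vec n" "v2 \<in> carrier_vec n" "j < n" for v1 v2 :: "'a vec" and j
    using kvecs_closed(4)[OF K that(3)] that by (intro image_eqI[of _ _ "unit_vec n j"]) auto
  have "(d1 $ j, d2 $ j) \<in> (\<lambda>k. (k \<bullet> c1, k \<bullet> c2)) ` kvecs K n" if "j < n" for j
    using unit[OF d(1,2) that] im by simp
  then obtain A where A: "A \<in> carrier_mat n n" "elements_mat A \<subseteq> K" "A\<^sup>T *\<^sub>v c1 = d1" "A\<^sup>T *\<^sub>v c2 = d2"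
    by (rule ex_transition_matrix[OF c(1,2) d(1,2)])
  have "(c1 $ j, c2 $ j) \<in> (\<lambda>k. (k \<bullet> d1, k \<bullet> d2)) ` kvecs K n" if "j < n" for j
    using unit[OF c(1,2) that] im by simp
  then obtain B where B: "B \<in> carrier_mat n n" "elements_mat B \<subseteq> K" "B\<^sup>T *\<^sub>v d1 = c1" "B\<^sup>T *\<^sub>v d2 = c2"
    by (rule ex_transition_matrix[OF d(1,2) c(1,2)])
  have "A * B = 1\<^sub>m n" "B * A = 1\<^sub>m n"
    by (rule transition_matrices_inverse[OF K c(1,2,5) A B] transition_matrices_inverse[OF K d(1,2,5) B A])+
  then have "A \<in> GL_over K n" using A B by (auto simp: GL_over_def)
  moreover have "D = (\<lambda>v. A\<^sup>T *\<^sub>v v) ` C"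
  proof -
    have "A\<^sup>T *\<^sub>v (a \<cdot>\<^sub>v c1 + b \<cdot>\<^sub>v c2) = a \<cdot>\<^sub>v d1 + b \<cdot>\<^sub>v d2" for a b
      using A c by (simp add: mult_add_distrib_mat_vec[of _ n n] mult_mat_vec[of _ n n])
    then show ?thesis unfolding c(3) d(3) pairspan_def by (simp add: image_image case_prod_unfold)
  qed
  ultimately show ?thesis by (auto simp: equivalent_codes_def)
qed

subsection \<open>Codes with generator matrix in two equal blocks\<close>

text \<open>The two halves of a coefficient vector are chosen independently.\<close>

lemma image_double_row:
  fixes r :: "'a::field vec"
  assumes l: "dim_vec r = l"
  shows "(\<lambda>k. (k \<bullet> (r @\<^sub>v 0\<^sub>v l), k \<bullet> (0\<^sub>v l @\<^sub>v r))) ` kvecs K (2 * l) = entry_span K r \<times> entry_span K r"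
proof -
  have r: "r \<in> carrier_vec l" using l by auto
  have dot: "(u @\<^sub>v v) \<bullet> (r @\<^sub>v 0\<^sub>v l) = u \<bullet> r" "(u @\<^sub>v v) \<bullet> (0\<^sub>v l @\<^sub>v r) = v \<bullet> r"
    if "u \<in> carrier_vec l" "v \<in> carrier_vec l" for u v :: "'a vec"
    using that r by (auto simp: scalar_prod_append[of _ l _ l])
  show ?thesis
  proof (intro equalityI subsetI)
    fix p assume "p \<in> (\<lambda>k. (k \<bullet> (r @\<^sub>v 0\<^sub>v l), k \<bullet> (0\<^sub>v l @\<^sub>v r))) ` kvecs K (2 * l)"
    then obtain k where k: "k \<in> kvecs K (2 * l)" "p = (k \<bullet> (r @\<^sub>v 0\<^sub>v l), k \<bullet> (0\<^sub>v l @\<^sub>v r))" by auto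
    let ?u = "vec_first k l" and ?v = "vec_last k l"
    have "k = ?u @\<^sub>v ?v" using k by (intro vec_first_last_append[symmetric]) (auto simp: kvecs_def mult_2)
    moreover have "?u \<in> kvecs K l" "?v \<in> kvecs K l"
      using k(1) by (auto simp: kvecs_def vec_first_def vec_last_def)
    ultimately show "p \<in> entry_span K r \<times> entry_span K r"
      using k(2) dot[of ?u ?v] l by (auto simp: entry_span_def kvecs_carrier)
  next
    fix p assume "p \<in> entry_span K r \<times> entry_span K r"
    then obtain u v where uv: "u \<in> kvecs K l" "v \<in> kvecs K l" "p = (u \<bullet> r, v \<bullet> r)"
      using l by (auto simp: entry_span_def)
    have "u @\<^sub>v v \<in> kvecs K (2 * l)" using uv by (auto simp: kvecs_def mult_2)
    then show "p \<in> (\<lambda>k. (k \<bullet> (r @\<^sub>v 0\<^sub>v l), k \<bullet> (0\<^sub>v l @\<^sub>v r))) ` kvecs K (2 * l)"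
      using uv dot[of u v] by (intro image_eqI[of _ _ "u @\<^sub>v v"]) (auto simp: kvecs_carrier)
  qed
qed

lemma double_row_mat_code:
  fixes r :: "'a::field vec"
  assumes l: "dim_vec r = l"
  shows "generator_matrix (2 * l) 2 (double_row_mat r) C \<longleftrightarrow> C = pairspan (r @\<^sub>v 0\<^sub>v l) (0\<^sub>v l @\<^sub>v r)"
proof -
  have r: "r \<in> carrier_vec l" using l by auto
  have G: "double_row_mat r \<in> carrier_mat 2 (2 * l)"
    using mat_of_rows_carrier(1)[of "2 * l" "[r @\<^sub>v 0\<^sub>v l, 0\<^sub>v l @\<^sub>v r]"]
    by (simp add: double_row_mat_def l numeral_2_eq_2)
  have c: "r @\<^sub>v 0\<^sub>v l \<in> carrier_vec (2 * l)" "0\<^sub>v l @\<^sub>v r \<in> carrier_vec (2 * l)"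
    using r by (auto simp: mult_2)
  have "row (double_row_mat r) 0 = r @\<^sub>v 0\<^sub>v l" "row (double_row_mat r) 1 = 0\<^sub>v l @\<^sub>v r"
    using c by (auto simp: double_row_mat_def l mat_of_rows_row)
  then show ?thesis using G row_space_two_rows[OF G] by (auto simp: generator_matrix_def)
qed

lemma code_basis_double_row:
  fixes K :: "'a::{field, finite} set"
  assumes K: "subfld K" and l: "dim_vec r = l" "0 < l" and dim: "vdim K (entry_span K r) = l"
  shows "code_basis K (2 * l) (r @\<^sub>v 0\<^sub>v l) (0\<^sub>v l @\<^sub>v r) (pairspan (r @\<^sub>v 0\<^sub>v l) (0\<^sub>v l @\<^sub>v r))"
proof -
  have r: "r \<in> carrier_vec l" using l by auto
  have c: "r @\<^sub>v 0\<^sub>v l \<in> carrier_vec (2 * l)" "0\<^sub>v l @\<^sub>v r \<in> carrier_vec (2 * l)"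
    using r by (auto simp: mult_2)
  have "\<exists>i<l. r $ i \<noteq> 0"
  proof (rule ccontr)
    assume "\<not> (\<exists>i<l. r $ i \<noteq> 0)"
    then have "r = 0\<^sub>v l" using r by (intro eq_vecI) auto
    then show False using dim rank_weight_zero[OF K, of l] rank_weight_eq[OF K, of r] l by simp
  qed
  then obtain i where i: "i < l" "r $ i \<noteq> 0" by blast
  have "inj (\<lambda>(a, b). a \<cdot>\<^sub>v (r @\<^sub>v 0\<^sub>v l) + b \<cdot>\<^sub>v (0\<^sub>v l @\<^sub>v r))"
  proof (rule injI, clarify)
    fix a b a' b'
    assume eq: "a \<cdot>\<^sub>v (r @\<^sub>v 0\<^sub>v l) + b \<cdot>\<^sub>v (0\<^sub>v l @\<^sub>v r) = a' \<cdot>\<^sub>v (r @\<^sub>v 0\<^sub>v l) + b' \<cdot>\<^sub>v (0\<^sub>v l @\<^sub>v r)"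
    show "a = a' \<and> b = b'"
      using arg_cong[OF eq, of "\<lambda>v. v $ i"] arg_cong[OF eq, of "\<lambda>v. v $ (l + i)"] i l by auto
  qed
  moreover have "inj_on (\<lambda>k. (k \<bullet> (r @\<^sub>v 0\<^sub>v l), k \<bullet> (0\<^sub>v l @\<^sub>v r))) (kvecs K (2 * l))"
  proof (rule eq_card_imp_inj_on[OF finite_kvecs])
    show "card ((\<lambda>k. (k \<bullet> (r @\<^sub>v 0\<^sub>v l), k \<bullet> (0\<^sub>v l @\<^sub>v r))) ` kvecs K (2 * l)) = card (kvecs K (2 * l))"
      unfolding image_double_row[OF l(1)] card_cartesian_product card_kvecs
      using card_eq_vdim[OF K subsp_entry_span[OF K, of r]] dim by (simp add: mult_2 power_add)
  qed simp
  ultimately show ?thesis using c by (simp add: code_basis_def)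
qed

section \<open>Full weight spectra\<close>

text \<open>For i \<le> l the shifted exponents i, ..., l + i - 1 leave no gap after 0, ..., l -
  1.\<close>

lemma pspan_add:
  assumes K: "subfld K" and "i \<le> l"
  shows "pspan K x (l + i) = pspan K x l + (*) (x ^ i) ` pspan K x l"
proof
  have P: "subsp K (pspan K x n)" for n by (rule subsp_pspan[OF K])
  have s: "subsp K (pspan K x l + (*) (x ^ i) ` pspan K x l)" by (intro subsp_plus subsp_scale P)
  show "pspan K x (l + i) \<subseteq> pspan K x l + (*) (x ^ i) ` pspan K x l"
  proof (rule pspan_least[OF s])
    fix j assume j: "j < l + i"
    show "x ^ j \<in> pspan K x l + (*) (x ^ i) ` pspan K x l"
    proof (cases "j < l")
      case True
      then show ?thesis using power_in_pspan[OF K True, of x] subset_plus_left[OF subsp_scale[OF P]] by blast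
    next
      case False
      then have "x ^ j = x ^ i * x ^ (j - i)" using \<open>i \<le> l\<close> by (simp add: power_add[symmetric])
      moreover have "x ^ (j - i) \<in> pspan K x l" using False j \<open>i \<le> l\<close> by (intro power_in_pspan[OF K]) auto
      ultimately show ?thesis using subset_plus_right[OF P] by blast
    qed
  qed
  show "pspan K x l + (*) (x ^ i) ` pspan K x l \<subseteq> pspan K x (l + i)"
    by (intro plus_subset[OF P] pspan_mono[OF K] scale_pspan_subset[OF K P])
      (auto simp: power_add[symmetric] intro!: power_in_pspan[OF K])
qed

text \<open>While w is at most the degree of x, the progression and its shift by x^(w-l) add up to a
  progression of length w. Only w = 2 l can exceed the degree, by 1; then a factor y outside the
  generated field makes the sum direct.\<close>

lemma geometric_full_spectrum:
  fixes K :: "'a::{field, finite} set"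
  assumes K: "subfld K"
    and bd: "2 * l \<le> vdim K (adjoin K x) \<or> adjoin K x \<noteq> UNIV \<and> 2 * l \<le> Suc (vdim K (adjoin K x))"
    and w: "l \<le> w" "w \<le> 2 * l"
  shows "\<exists>a b. vdim K ((*) a ` pspan K x l + (*) b ` pspan K x l) = w"
proof (cases "w \<le> vdim K (adjoin K x)")
  case True
  have "vdim K ((*) 1 ` pspan K x l + (*) (x ^ (w - l)) ` pspan K x l) = w"
    using pspan_add[OF K, of "w - l" l x] vdim_pspan[OF K True] w by simp
  then show ?thesis by blast
next
  case False
  let ?M = "adjoin K x"
  have w2: "w = 2 * l" and nU: "?M \<noteq> UNIV" using False bd w by auto
  then obtain y where y: "y \<notin> ?M" by blast
  have M: "subfld ?M" by (rule subfld_adjoin)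
  have "0 \<in> ?M" by (rule subfld_0[OF M])
  then have "y \<noteq> 0" using y by auto
  let ?P = "pspan K x l"
  have P: "subsp K ?P" by (rule subsp_pspan[OF K])
  have PM: "?P \<subseteq> ?M" by (rule pspan_subset_adjoin[OF K])
  have "?P \<inter> (*) y ` ?P \<subseteq> {0}"
  proof
    fix z assume "z \<in> ?P \<inter> (*) y ` ?P"
    then obtain p where p: "z \<in> ?M" "p \<in> ?M" "z = y * p" using PM by auto
    have "p = 0"
    proof (rule ccontr)
      assume "p \<noteq> 0"
      then have "y = z / p" using p by simp
      then show False using y subfld_divide[OF M p(1,2)] by simp
    qed
    then show "z \<in> {0}" using p by simp
  qed
  then have "?P \<inter> (*) y ` ?P = {0}" using subsp_0[OF subsp_Int[OF P subsp_scale[OF P]]] by blast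
  moreover have "vdim K ?P = l" using bd w w2 False vdim_adjoin_gt_0[OF K, of x] by (intro vdim_pspan[OF K]) linarith
  ultimately have "vdim K (?P + (*) y ` ?P) = w"
    using vdim_plus_Int[OF K P subsp_scale[OF P], of y] vdim_scale[OF \<open>y \<noteq> 0\<close>] vdim_zero[OF K] w2 by simp
  then have "vdim K ((*) 1 ` ?P + (*) y ` ?P) = w" by simp
  then show ?thesis by blast
qed

text \<open>S is a progression over E of length l with a K-line on top. For odd w = 2 (l + i) + 1
  the shift by x^i moves this line to degree l + i and fills everything below. For even w = 2 (l + i
  + 1) the factor \<xi> x^i completes it to an E-line.\<close>

lemma quadratic_full_spectrum:
  fixes K :: "'a::{field, finite} set"
  assumes K: "subfld K" and E: "subfld E" and E2: "card E = (card K)\<^sup>2" and Exi: "E = pspan K \<xi> 2"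
    and bd: "2 * l < vdim E (adjoin E x)"
    and S: "S = pspan E x l + (*) (x ^ l) ` K"
    and w: "2 * l + 1 \<le> w" "w \<le> 2 * (2 * l + 1)"
  shows "\<exists>a b. vdim K ((*) a ` S + (*) b ` S) = w"
proof -
  have EK: "\<alpha> + \<xi> * \<beta> \<in> E" if "\<alpha> \<in> K" "\<beta> \<in> K" for \<alpha> \<beta> using pspan_2_iff[OF K, of "\<alpha> + \<xi> * \<beta>" \<xi>] that unfolding Exi[symmetric] by blast
  have KE: "K \<subseteq> E" using EK[OF _ subfld_0[OF K]] by auto
  have xiE: "\<xi> \<in> E" using EK[OF subfld_0[OF K] subfld_1[OF K]] by simp
  have vE: "vdim K E = 2" using E2 by (intro vdim_eqI[OF K]) simp
  have "\<xi> \<noteq> 0"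
  proof
    assume "\<xi> = 0"
    then have "E \<subseteq> K" unfolding Exi using pspan_2_iff[OF K, of _ \<xi>] by auto
    then have "card E \<le> card K" by (intro card_mono) auto
    then show False using E2 card_subfld_ge_2[OF K] by (simp add: power2_eq_square)
  qed
  let ?P = "pspan E x"
  have P: "subsp E (?P n)" for n by (rule subsp_pspan[OF E])
  have PK: "subsp K (?P n)" for n by (rule subsp_mono[OF P KE])
  have tow: "vdim K (?P n) = 2 * n" if "n \<le> vdim E (adjoin E x)" for n
    using vdim_tower[OF K E KE P] vdim_pspan[OF E that] vE by simp
  have lK: "subsp K ((*) (x ^ n) ` K)" for n by (intro subsp_scale subsp_subfld K order_refl)
  have sS: "subsp K S" unfolding S by (rule subsp_plus[OF PK lK])
  have PS: "?P l \<subseteq> S" unfolding S by (rule subset_plus_left[OF lK])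
  have lS: "(*) (x ^ l) ` K \<subseteq> S" unfolding S by (rule subset_plus_right[OF PK])
  have SP: "S \<subseteq> ?P (Suc l)" unfolding S pspan.simps using KE by (intro set_plus_mono2) auto
  define i where "i = (w - (2 * l + 1)) div 2"
  have i: "i \<le> l" "l + i < vdim E (adjoin E x)" using w bd by (auto simp: i_def)
  have wc: "w = 2 * (l + i) + 1 \<or> w = 2 * (l + i + 1)" using w by (auto simp: i_def)
  show ?thesis
  proof (cases "w = 2 * (l + i) + 1")
    case True
    let ?T = "S + (*) (x ^ i) ` S"
    have T: "subsp K ?T" by (intro subsp_plus sS subsp_scale)
    have "?T = ?P (l + i) + (*) (x ^ (l + i)) ` K"
    proof
      have U: "subsp K (?P (l + i) + (*) (x ^ (l + i)) ` K)" by (rule subsp_plus[OF PK lK])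
      have a: "?P (l + i) \<subseteq> ?P (l + i) + (*) (x ^ (l + i)) ` K" by (rule subset_plus_left[OF lK])
      have b: "(*) (x ^ (l + i)) ` K \<subseteq> ?P (l + i) + (*) (x ^ (l + i)) ` K" by (rule subset_plus_right[OF PK])
      have "S \<subseteq> ?P (l + i) + (*) (x ^ (l + i)) ` K"
      proof (cases "i = 0")
        case True then show ?thesis by (simp add: S)
      next
        case False
        then show ?thesis using SP pspan_mono[OF E, of "Suc l" "l + i" x] a by fastforce
      qed
      moreover have "(*) (x ^ i) ` S \<subseteq> ?P (l + i) + (*) (x ^ (l + i)) ` K"
      proof
        fix z assume "z \<in> (*) (x ^ i) ` S"
        then obtain p k where z: "z = x ^ i * (p + x ^ l * k)" "p \<in> ?P l" "k \<in> K"
          unfolding S by (auto simp: set_plus_def)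
        have "x ^ i * p \<in> (*) (x ^ i) ` ?P l" using z(2) by (rule imageI)
        then have "x ^ i * p \<in> ?P (l + i)"
          unfolding pspan_add[OF E i(1)] by (rule subsetD[OF subset_plus_right[OF P]])
        moreover have "x ^ (l + i) * k \<in> (*) (x ^ (l + i)) ` K" using z(3) by blast
        moreover have "z = x ^ i * p + x ^ (l + i) * k" unfolding z(1) by (simp add: algebra_simps power_add)
        ultimately show "z \<in> ?P (l + i) + (*) (x ^ (l + i)) ` K" by (metis set_plus_intro)
      qed
      ultimately show "?T \<subseteq> ?P (l + i) + (*) (x ^ (l + i)) ` K" by (rule plus_subset[OF U])
      have "?P (l + i) \<subseteq> ?T" unfolding pspan_add[OF E i(1)] using PS by (intro set_plus_mono2) auto
      moreover have "(*) (x ^ (l + i)) ` K \<subseteq> (*) (x ^ i) ` S"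
      proof -
        have "(*) (x ^ (l + i)) ` K = (*) (x ^ i) ` (*) (x ^ l) ` K"
          unfolding scale_scale by (simp only: power_add mult.commute)
        then show ?thesis using lS by auto
      qed
      then have "(*) (x ^ (l + i)) ` K \<subseteq> ?T" using subset_plus_right[OF sS, of "(*) (x ^ i) ` S"] by blast
      ultimately show "?P (l + i) + (*) (x ^ (l + i)) ` K \<subseteq> ?T" by (rule plus_subset[OF T])
    qed
    then have "vdim K ?T = w"
      using vdim_plus_line[OF K PK power_notin_pspan[OF E i(2)]] tow[of "l + i"] i True by simp
    then have "vdim K ((*) 1 ` S + (*) (x ^ i) ` S) = w" by simp
    then show ?thesis by blast
  next
    case False
    \<comment> \<open>For i > 0 the summand 1 recovers the low degrees: x^i p is available from
      \<open>?b\<close>, and \<open>?a\<close> times p minus x^i p is p. For i = 0 the factors are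
      just 1 and \<xi>.\<close>
    define e where "e = (if i = 0 then 0 else 1 :: 'a)"
    let ?a = "x ^ i + e" and ?b = "\<xi> * x ^ i"
    let ?T = "(*) ?a ` S + (*) ?b ` S"
    have T: "subsp K ?T" by (intro subsp_plus subsp_scale sS)
    have aT: "?a * z \<in> ?T" if "z \<in> S" for z
      using subset_plus_left[OF subsp_scale[OF sS]] that by blast
    have bT: "?b * z \<in> ?T" if "z \<in> S" for z
      using subset_plus_right[OF subsp_scale[OF sS]] that by blast
    have "?T = ?P (Suc (i + l))"
    proof
      have xi: "x ^ i \<in> ?P (Suc i)" by (rule power_in_pspan[OF E]) simp
      have "e \<in> E" using subfldD[OF E] by (simp add: e_def)
      then have "e * x ^ 0 \<in> ?P (Suc i)" by (intro subsp_mult[OF P] power_in_pspan[OF E]) auto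
      then have "?a \<in> ?P (Suc i)" using subsp_add[OF P xi] by simp
      moreover have "?b \<in> ?P (Suc i)" by (rule subsp_mult[OF P xiE xi])
      ultimately show "?T \<subseteq> ?P (Suc (i + l))"
        using mult_pspan[OF E] SP by (intro plus_subset[OF PK]) blast+
      have xp: "x ^ i * p \<in> ?T" if "p \<in> ?P l" for p
      proof -
        have "inverse \<xi> * p \<in> S" using subsp_mult[OF P subfld_inverse[OF E xiE] that] PS by blast
        then have "?b * (inverse \<xi> * p) \<in> ?T" by (rule bT)
        moreover have "?b * (inverse \<xi> * p) = x ^ i * p" using \<open>\<xi> \<noteq> 0\<close> by simp
        ultimately show ?thesis by (simp only:)
      qed
      have pT: "p \<in> ?T" if "p \<in> ?P l" for p
      proof (cases "i = 0")
        case True then show ?thesis using xp[OF that] by simp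
      next
        case False
        have "?a * p - x ^ i * p \<in> ?T" using aT xp that PS by (intro subsp_diff[OF K T]) auto
        moreover have "?a * p - x ^ i * p = p" using False by (simp add: e_def algebra_simps)
        ultimately show ?thesis by (simp only:)
      qed
      have PT: "?P (l + i) \<subseteq> ?T"
        unfolding pspan_add[OF E i(1)] using pT xp by (intro plus_subset[OF T]) auto
      have "(*) (x ^ (l + i)) ` E \<subseteq> ?T"
      proof
        fix z assume "z \<in> (*) (x ^ (l + i)) ` E"
        then obtain y where y: "y \<in> E" "z = x ^ (l + i) * y" by auto
        then obtain \<alpha> \<beta> where z: "\<alpha> \<in> K" "\<beta> \<in> K" "z = x ^ (l + i) * (\<alpha> + \<xi> * \<beta>)"
          using pspan_2_iff[OF K, of y \<xi>] by (auto simp: Exi[symmetric])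
        have xS: "x ^ l * k \<in> S" if "k \<in> K" for k using lS that by blast
        \<comment> \<open>The error that the summand 1 causes at the top; for i > 0 the power x^l
          already has degree below l + i.\<close>
        have "e * (x ^ l * \<alpha>) \<in> ?T"
        proof (cases "i = 0")
          case True then show ?thesis using subsp_0[OF T] by (simp add: e_def)
        next
          case False
          then have "x ^ l \<in> ?P (l + i)" by (intro power_in_pspan[OF E]) simp
          then have "x ^ l \<in> ?T" using PT by blast
          then have "\<alpha> * x ^ l \<in> ?T" by (rule subsp_mult[OF T z(1)])
          then show ?thesis using False by (simp add: e_def mult.commute)
        qed
        then have "(?a * (x ^ l * \<alpha>) - e * (x ^ l * \<alpha>)) + ?b * (x ^ l * \<beta>) \<in> ?T"
          by (intro subsp_add[OF T] subsp_diff[OF K T] aT bT xS z)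
        moreover have "(?a * (x ^ l * \<alpha>) - e * (x ^ l * \<alpha>)) + ?b * (x ^ l * \<beta>) = z"
          unfolding z(3) by (simp add: algebra_simps power_add)
        ultimately show "z \<in> ?T" by (simp only:)
      qed
      then show "?P (Suc (i + l)) \<subseteq> ?T"
        unfolding pspan.simps add.commute[of i l] using PT by (intro plus_subset[OF T])
    qed
    then have "vdim K ?T = w" using tow[of "Suc (i + l)"] i wc False by (simp add: add.commute)
    then show ?thesis by blast
  qed
qed

lemma entry_span_power_row:
  assumes K: "subfld K" shows "entry_span K (power_row l x) = pspan K x l"
proof
  show "entry_span K (power_row l x) \<subseteq> pspan K x l"
    by (rule entry_span_least[OF subsp_pspan[OF K]]) (auto simp: power_row_def intro: power_in_pspan[OF K])
  show "pspan K x l \<subseteq> entry_span K (power_row l x)"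
  proof (rule pspan_least[OF subsp_entry_span[OF K]])
    fix i assume "i < l"
    then show "x ^ i \<in> entry_span K (power_row l x)"
      using entry_in_entry_span[OF K, of i "power_row l x"] by (simp add: power_row_def)
  qed
qed

lemma entry_span_quad_power_row:
  assumes K: "subfld K" and E: "subfld E" and KE: "K \<subseteq> E" and Exi: "E = pspan K \<xi> 2"
  shows "entry_span K (quad_power_row l \<xi> x) = pspan E x l + (*) (x ^ l) ` K"
proof
  let ?r = "quad_power_row l \<xi> x" and ?U = "pspan E x l + (*) (x ^ l) ` K"
  have P: "subsp E (pspan E x l)" by (rule subsp_pspan[OF E])
  have lK: "subsp K ((*) (x ^ l) ` K)" by (intro subsp_scale subsp_subfld K order_refl)
  have U: "subsp K ?U" by (rule subsp_plus[OF subsp_mono[OF P KE] lK])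
  have PU: "pspan E x l \<subseteq> ?U" by (rule subset_plus_left[OF lK])
  have lU: "(*) (x ^ l) ` K \<subseteq> ?U" by (rule subset_plus_right[OF P])
  have xiE: "\<xi> \<in> E" unfolding Exi using power_in_pspan[OF K, of 1 2 \<xi>] by simp
  show "entry_span K ?r \<subseteq> ?U"
  proof (rule entry_span_least[OF U])
    fix i assume "i < dim_vec ?r"
    then have i: "i < 2 * l + 1" by (simp add: quad_power_row_def)
    show "?r $ i \<in> ?U"
    proof (cases "i = 2 * l")
      case True
      have "x ^ l * 1 \<in> (*) (x ^ l) ` K" by (rule imageI[OF subfld_1[OF K]])
      then show ?thesis using lU True by (auto simp: quad_power_row_def)
    next
      case False
      then have "x ^ (i div 2) \<in> pspan E x l" using i by (intro power_in_pspan[OF E]) auto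
      then show ?thesis using PU i subsp_mult[OF P xiE] by (auto simp: quad_power_row_def)
    qed
  qed
  let ?T = "entry_span K ?r"
  have T: "subsp K ?T" by (rule subsp_entry_span[OF K])
  have ev: "x ^ n \<in> ?T" if "n \<le> l" for n
    using entry_in_entry_span[OF K, of "2 * n" ?r] that by (simp add: quad_power_row_def)
  have od: "\<xi> * x ^ n \<in> ?T" if "n < l" for n
    using entry_in_entry_span[OF K, of "2 * n + 1" ?r] that by (simp add: quad_power_row_def)
  have "pspan E x n \<subseteq> ?T" if "n \<le> l" for n
    using that
  proof (induction n)
    case 0 then show ?case using subsp_0[OF T] by simp
  next
    case (Suc n)
    have "(*) (x ^ n) ` E \<subseteq> ?T"
    proof
      fix z assume "z \<in> (*) (x ^ n) ` E"
      then obtain y where y: "y \<in> E" "z = x ^ n * y" by auto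
      then obtain \<alpha> \<beta> where z: "\<alpha> \<in> K" "\<beta> \<in> K" "z = x ^ n * (\<alpha> + \<xi> * \<beta>)"
        using pspan_2_iff[OF K, of y \<xi>] by (auto simp: Exi[symmetric])
      have "\<alpha> * x ^ n + \<beta> * (\<xi> * x ^ n) \<in> ?T"
        using Suc.prems by (intro subsp_add[OF T] subsp_mult[OF T] z ev od) auto
      moreover have "\<alpha> * x ^ n + \<beta> * (\<xi> * x ^ n) = z" unfolding z(3) by (simp add: algebra_simps)
      ultimately show "z \<in> ?T" by (simp only:)
    qed
    then show ?case unfolding pspan.simps using Suc by (intro plus_subset[OF T]) auto
  qed
  moreover have "(*) (x ^ l) ` K \<subseteq> ?T" using subsp_mult[OF T _ ev] by (auto simp: mult.commute[of "x ^ l"])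
  ultimately show "?U \<subseteq> ?T" by (intro plus_subset[OF T]) auto
qed

section \<open>The maximal number of weights, and optimality\<close>

lemma weight_spectrum_double_row:
  fixes K :: "'a::{field, finite} set"
  assumes K: "subfld K" and l: "dim_vec r = l" "0 < l"
    and full: "\<And>w. l \<le> w \<Longrightarrow> w \<le> 2 * l \<Longrightarrow>
      \<exists>a b. vdim K ((*) a ` entry_span K r + (*) b ` entry_span K r) = w"
  shows "{l..2 * l} \<subseteq> weight_spectrum K (2 * l) (pairspan (r @\<^sub>v 0\<^sub>v l) (0\<^sub>v l @\<^sub>v r))"
proof
  have c: "r @\<^sub>v 0\<^sub>v l \<in> carrier_vec (2 * l)" "0\<^sub>v l @\<^sub>v r \<in> carrier_vec (2 * l)"
    using carrier_vecI[OF l(1)] by (auto simp: mult_2)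
  fix w assume w: "w \<in> {l..2 * l}"
  then obtain a b where ab: "vdim K ((*) a ` entry_span K r + (*) b ` entry_span K r) = w" using full[of w] by auto
  let ?v = "a \<cdot>\<^sub>v (r @\<^sub>v 0\<^sub>v l) + b \<cdot>\<^sub>v (0\<^sub>v l @\<^sub>v r)"
  have wt: "rank_weight K ?v = w"
    using rank_weight_eq[OF K] entry_span_combination[OF c image_double_row[OF l(1)]] ab by simp
  then have "?v \<noteq> 0\<^sub>v (2 * l)" using rank_weight_zero[OF K, of "2 * l"] w l by (intro notI) simp
  then show "w \<in> weight_spectrum K (2 * l) (pairspan (r @\<^sub>v 0\<^sub>v l) (0\<^sub>v l @\<^sub>v r))"
    unfolding weight_spectrum_def using wt pairspanI by (intro image_eqI[of _ _ ?v]) auto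
qed

text \<open>A generator of the cyclic multiplicative group serves as x.\<close>

lemma ex_primitive_element: "\<exists>x :: 'a::{field, finite}. adjoin K x = UNIV"
proof -
  have "finite (carrier (class_ring :: 'a ring))" by (simp add: class_ring_simps)
  from field.finite_field_mult_group_has_gen[OF class_field this] obtain x :: 'a where
    x: "carrier (mult_of class_ring) = {x [^]\<^bsub>class_ring\<^esub> i | i :: nat. i \<in> UNIV}"
    by blast
  have "y \<in> adjoin K x" for y
  proof (cases "y = 0")
    case True then show ?thesis using subfld_0[OF subfld_adjoin] by simp
  next
    case False
    then have "y \<in> carrier (mult_of class_ring)" by (simp add: class_ring_simps)
    then obtain i :: nat where "y = x ^ i" unfolding x by (auto simp: class_ring_simps)
    then show ?thesis using subfld_power[OF subfld_adjoin adjoin_incl(2)] by simp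
  qed
  then show ?thesis by blast
qed

lemma L_rk_eq:
  fixes K :: "'a::{field, finite} set"
  assumes K: "subfld K" and l: "0 < l" "2 * l \<le> vdim K (UNIV :: 'a set)"
  shows "L_rk K (2 * l) 2 = Suc l"
proof -
  obtain x :: 'a where x: "adjoin K x = UNIV" using ex_primitive_element by blast
  let ?r = "power_row l x"
  let ?C = "pairspan (?r @\<^sub>v 0\<^sub>v l) (0\<^sub>v l @\<^sub>v ?r)"
  have dim: "dim_vec ?r = l" by (simp add: power_row_def)
  have S: "entry_span K ?r = pspan K x l" by (rule entry_span_power_row[OF K])
  have "vdim K (pspan K x l) = l" using l x by (intro vdim_pspan[OF K]) simp
  then have C: "nondegenerate_code K (2 * l) 2 ?C"
    by (intro code_basis_imp_nondegenerate[OF K code_basis_double_row[OF K dim l(1)]]) (simp add: S)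
  have "{l..2 * l} \<subseteq> weight_spectrum K (2 * l) ?C"
    using geometric_full_spectrum[OF K, of l x] l x
    by (intro weight_spectrum_double_row[OF K dim l(1)]) (auto simp: S)
  moreover have fin: "finite (weight_spectrum K (2 * l) D)" if D: "nondegenerate_code K (2 * l) 2 D" for D
  proof -
    obtain c1 c2 where "code_basis K (2 * l) c1 c2 D" by (rule nondegenerate_code_imp_basis[OF K D])
    from code_basisD[OF this] have "finite D" by (simp add: pairspan_def)
    then show ?thesis by (simp add: weight_spectrum_def)
  qed
  ultimately have "card {l..2 * l} \<le> card (weight_spectrum K (2 * l) ?C)" using C by (intro card_mono) auto
  then have "card (weight_spectrum K (2 * l) ?C) = Suc l" using card_weight_spectrum_le[OF K C] by simp
  moreover have "finite {card (weight_spectrum K (2 * l) C) | C. nondegenerate_code K (2 * l) 2 C}"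
    by (rule finite_subset[of _ "{..Suc l}"]) (use card_weight_spectrum_le[OF K] in auto)
  moreover have "Suc l \<in> {card (weight_spectrum K (2 * l) C) | C. nondegenerate_code K (2 * l) 2 C}"
    using C \<open>card (weight_spectrum K (2 * l) ?C) = Suc l\<close> by (metis (mono_tags, lifting) mem_Collect_eq)
  ultimately show ?thesis unfolding L_rk_def
    using card_weight_spectrum_le[OF K] by (intro Max_eqI) auto
qed

lemma optimal_of_equivalent_double_row:
  fixes K :: "'a::{field, finite} set"
  assumes K: "subfld K" and l: "dim_vec r = l" "0 < l" "2 * l \<le> vdim K (UNIV :: 'a set)"
    and C: "nondegenerate_code K (2 * l) 2 C" and eq: "equivalent_codes K (2 * l) C C'"
    and G: "generator_matrix (2 * l) 2 (double_row_mat r) C'"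
    and full: "\<And>w. l \<le> w \<Longrightarrow> w \<le> 2 * l \<Longrightarrow>
      \<exists>a b. vdim K ((*) a ` entry_span K r + (*) b ` entry_span K r) = w"
  shows "L_rk_optimal K (2 * l) 2 C"
proof -
  obtain c1 c2 where "code_basis K (2 * l) c1 c2 C" by (rule nondegenerate_code_imp_basis[OF K C])
  note c = code_basisD[OF this]
  have Cn: "C \<subseteq> carrier_vec (2 * l)" unfolding c(3) using c by (auto elim!: pairspanE)
  have "finite (weight_spectrum K (2 * l) C)" using c(3) by (simp add: weight_spectrum_def pairspan_def)
  moreover have "{l..2 * l} \<subseteq> weight_spectrum K (2 * l) C"
    using weight_spectrum_double_row[OF K l(1,2) full] weight_spectrum_equivalent[OF K eq Cn]
      G[unfolded double_row_mat_code[OF l(1)]] by simp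
  ultimately have "card {l..2 * l} \<le> card (weight_spectrum K (2 * l) C)" by (rule card_mono)
  then have "card (weight_spectrum K (2 * l) C) = Suc l" using card_weight_spectrum_le[OF K C] by simp
  then show ?thesis using C L_rk_eq[OF K l(2,3)] by (simp add: L_rk_optimal_def)
qed

text \<open>The word \<open>a d1 + b d2\<close> with \<open>a b \<noteq> 0\<close> has weight \<open>2 l - dim (S \<inter> \<nu> S)\<close> for \<open>\<nu> = b / a\<close>.\<close>

lemma optimal_imp_all_intersection_dims:
  fixes K :: "'a::{field, finite} set"
  assumes K: "subfld K" and l: "0 < l" "2 * l \<le> vdim K (UNIV :: 'a set)"
    and opt: "L_rk_optimal K (2 * l) 2 C" and cb: "code_basis K (2 * l) d1 d2 C"
    and S: "subsp K S" "vdim K S = l"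
    and im: "(\<lambda>k. (k \<bullet> d1, k \<bullet> d2)) ` kvecs K (2 * l) = S \<times> S"
    and v: "v \<le> l"
  shows "\<exists>\<nu>. \<nu> \<noteq> 0 \<and> vdim K (S \<inter> (*) \<nu> ` S) = v"
proof (cases "v = l")
  case True
  then show ?thesis using S by (intro exI[of _ 1]) simp
next
  case False
  note d = code_basisD[OF cb]
  have wt: "rank_weight K (a \<cdot>\<^sub>v d1 + b \<cdot>\<^sub>v d2) = vdim K ((*) a ` S + (*) b ` S)" for a b
    using rank_weight_eq[OF K] entry_span_combination[OF d(1,2) im] by simp
  have zS: "(*) 0 ` S = {0}" using subsp_0[OF S(1)] by force
  have cases: "vdim K ((*) a ` S + (*) b ` S) = l \<or>
    (\<exists>\<nu>. \<nu> \<noteq> 0 \<and> vdim K ((*) a ` S + (*) b ` S) + vdim K (S \<inter> (*) \<nu> ` S) = 2 * l)"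
    if ab: "a \<noteq> 0 \<or> b \<noteq> 0" for a b
  proof (cases "a = 0 \<or> b = 0")
    case True
    have "{0} + T = T" "T + {0} = T" for T :: "'a set" by (simp_all add: set_plus_def)
    then show ?thesis using True ab zS vdim_scale[of _ K S] S(2) by auto
  next
    case False
    have bS: "(*) b ` S = (*) a ` (*) (b / a) ` S" unfolding scale_scale using False by simp
    have I: "(*) a ` S \<inter> (*) a ` (*) (b / a) ` S = (*) a ` (S \<inter> (*) (b / a) ` S)"
      using False by (intro image_Int[symmetric]) (auto simp: inj_def)
    have "vdim K ((*) a ` S + (*) b ` S) + vdim K (S \<inter> (*) (b / a) ` S) = 2 * l"
      using vdim_plus_Int[OF K subsp_scale[OF S(1)] subsp_scale[OF S(1)], of a b]
        vdim_scale[of a K] vdim_scale[of b K S] False S(2) I unfolding bS by simp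
    then show ?thesis using False by (intro disjI2 exI[of _ "b / a"]) auto
  qed
  have "weight_spectrum K (2 * l) C \<subseteq> {l..2 * l}"
  proof
    fix w assume "w \<in> weight_spectrum K (2 * l) C"
    then obtain a b where ab: "w = rank_weight K (a \<cdot>\<^sub>v d1 + b \<cdot>\<^sub>v d2)" "a \<cdot>\<^sub>v d1 + b \<cdot>\<^sub>v d2 \<noteq> 0\<^sub>v (2 * l)"
      unfolding weight_spectrum_def d(3) by (auto elim!: pairspanE)
    have "a \<noteq> 0 \<or> b \<noteq> 0"
    proof (rule ccontr)
      assume "\<not> (a \<noteq> 0 \<or> b \<noteq> 0)"
      then have "a \<cdot>\<^sub>v d1 + b \<cdot>\<^sub>v d2 = 0\<^sub>v (2 * l)" using d(1,2) by (intro eq_vecI) auto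
      then show False using ab(2) by simp
    qed
    then have "w = l \<or> (\<exists>\<nu>. w + vdim K (S \<inter> (*) \<nu> ` S) = 2 * l)"
      using cases[of a b] unfolding ab(1) wt by blast
    moreover have "vdim K (S \<inter> (*) \<nu> ` S) \<le> l" for \<nu>
      using vdim_mono[OF K subsp_Int[OF S(1) subsp_scale[OF S(1)]] S(1) Int_lower1] S(2) by simp
    ultimately show "w \<in> {l..2 * l}"
    proof (elim disjE exE)
      fix \<nu> assume "w + vdim K (S \<inter> (*) \<nu> ` S) = 2 * l" "\<And>\<nu>. vdim K (S \<inter> (*) \<nu> ` S) \<le> l"
      from this(1) this(2)[of \<nu>] show ?thesis by simp
    qed simp
  qed
  moreover have "card (weight_spectrum K (2 * l) C) = card {l..2 * l}"
    using opt L_rk_eq[OF K l] by (simp add: L_rk_optimal_def)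
  \<comment> \<open>The interval has l + 1 elements and there are l + 1 weights, so none is
    missing.\<close>
  ultimately have "weight_spectrum K (2 * l) C = {l..2 * l}" by (intro card_subset_eq) auto
  then have "2 * l - v \<in> weight_spectrum K (2 * l) C" using v by auto
  then obtain a b where ab: "2 * l - v = rank_weight K (a \<cdot>\<^sub>v d1 + b \<cdot>\<^sub>v d2)" "a \<cdot>\<^sub>v d1 + b \<cdot>\<^sub>v d2 \<noteq> 0\<^sub>v (2 * l)"
    unfolding weight_spectrum_def d(3) by (auto elim!: pairspanE)
  have "a \<noteq> 0 \<or> b \<noteq> 0"
  proof (rule ccontr)
    assume "\<not> (a \<noteq> 0 \<or> b \<noteq> 0)"
    then have "a \<cdot>\<^sub>v d1 + b \<cdot>\<^sub>v d2 = 0\<^sub>v (2 * l)" using d(1,2) by (intro eq_vecI) auto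
    then show False using ab(2) by simp
  qed
  from cases[OF this] show ?thesis
  proof
    \<comment> \<open>This weight would mean v = l, the case settled first.\<close>
    assume "vdim K ((*) a ` S + (*) b ` S) = l"
    then show ?thesis using ab(1) wt v False by simp
  next
    assume "\<exists>\<nu>. \<nu> \<noteq> 0 \<and> vdim K ((*) a ` S + (*) b ` S) + vdim K (S \<inter> (*) \<nu> ` S) = 2 * l"
    then obtain \<nu> where n: "\<nu> \<noteq> 0" "(2 * l - v) + vdim K (S \<inter> (*) \<nu> ` S) = 2 * l"
      using ab(1) wt by auto
    then have "vdim K (S \<inter> (*) \<nu> ` S) = v" using v by linarith
    then show ?thesis using n(1) by blast
  qed
qed

text \<open>Dividing the basis by c turns S \<times> S into the square of the entry span of r, so
  both codes have the same column span.\<close>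

lemma equivalent_to_double_row:
  fixes K :: "'a::{field, finite} set"
  assumes K: "subfld K" and l: "dim_vec r = l" "0 < l" and cb: "code_basis K (2 * l) d1 d2 C"
    and S: "vdim K S = l" and im: "(\<lambda>k. (k \<bullet> d1, k \<bullet> d2)) ` kvecs K (2 * l) = S \<times> S"
    and c: "c \<noteq> 0" "S = (*) c ` entry_span K r"
  shows "\<exists>C'. equivalent_codes K (2 * l) C C' \<and> generator_matrix (2 * l) 2 (double_row_mat r) C'"
proof -
  note d = code_basisD[OF cb]
  let ?e = "inverse c"
  define f1 where "f1 = ?e \<cdot>\<^sub>v d1"
  define f2 where "f2 = ?e \<cdot>\<^sub>v d2"
  have dimr: "vdim K (entry_span K r) = l" using S vdim_scale[OF c(1), of K "entry_span K r"] c(2) by simp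
  have inj: "inj (\<lambda>(p, q). p \<cdot>\<^sub>v f1 + q \<cdot>\<^sub>v f2)"
  proof (rule injI, clarify)
    fix p q p' q' assume "p \<cdot>\<^sub>v f1 + q \<cdot>\<^sub>v f2 = p' \<cdot>\<^sub>v f1 + q' \<cdot>\<^sub>v f2"
    then have "(\<lambda>(x, y). x \<cdot>\<^sub>v d1 + y \<cdot>\<^sub>v d2) (p * ?e, q * ?e) = (\<lambda>(x, y). x \<cdot>\<^sub>v d1 + y \<cdot>\<^sub>v d2) (p' * ?e, q' * ?e)"
      by (simp add: f1_def f2_def smult_smult_assoc)
    then have "(p * ?e, q * ?e) = (p' * ?e, q' * ?e)" by (rule injD[OF d(4)])
    then show "p = p' \<and> q = q'" using c(1) by simp
  qed
  have "f1 = ?e \<cdot>\<^sub>v d1 + 0 \<cdot>\<^sub>v d2" "f2 = 0 \<cdot>\<^sub>v d1 + ?e \<cdot>\<^sub>v d2"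
    using d(1,2) by (intro eq_vecI; auto simp: f1_def f2_def)+
  then have "f1 \<in> C" "f2 \<in> C" unfolding d(3) by (metis pairspanI)+
  then have fb: "code_basis K (2 * l) f1 f2 C" by (intro code_basis_change[OF cb] inj)
  have "(\<lambda>k. (k \<bullet> f1, k \<bullet> f2)) ` kvecs K (2 * l) = (\<lambda>(x, y). (?e * x, ?e * y)) ` (S \<times> S)"
    unfolding im[symmetric] image_image using d(1,2)
    by (intro image_cong) (auto simp: f1_def f2_def kvecs_def)
  also have "\<dots> = (*) ?e ` S \<times> (*) ?e ` S" by force
  also have "(*) ?e ` S = entry_span K r" unfolding c(2) scale_scale using c(1) by simp
  finally have "equivalent_codes K (2 * l) C (pairspan (r @\<^sub>v 0\<^sub>v l) (0\<^sub>v l @\<^sub>v r))"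
    by (intro equivalent_codes_of_same_image[OF K fb code_basis_double_row[OF K l dimr]])
      (simp add: image_double_row[OF l(1)])
  then show ?thesis using double_row_mat_code[OF l(1)] by blast
qed

theorem theorem5p3:
  fixes K :: "'a::{field, finite} set"
    and q m ell :: nat
    and C :: "'a vec set"
  assumes "primepow q"
    and "subfield K (class_ring :: 'a ring)"
    and "card K = q"
    and "CARD('a) = q ^ m"
    and "0 < ell" and "0 < m"
    and "2 \<le> 2 * ell" and "2 * ell \<le> m"
    and "nondegenerate_code K (2 * ell) 2 C"
    and "\<exists>c1 \<in> C. \<exists>c2 \<in> C. \<exists>c3 \<in> C.
           rank_weight K c1 = ell \<and> rank_weight K c2 = ell \<and> rank_weight K c3 = ell \<and>
           \<not> proportional c1 c2 \<and> \<not> proportional c1 c3 \<and> \<not> proportional c2 c3"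
  shows "L_rk_optimal K (2 * ell) 2 C \<longleftrightarrow>
    (\<exists>C' G. equivalent_codes K (2 * ell) C C' \<and> generator_matrix (2 * ell) 2 G C' \<and>
      ((\<exists>x. x \<notin> K \<and>
          (if adjoin K x \<noteq> UNIV
           then real ell \<le> (real (ext_degree K (adjoin K x)) + 1) / 2
           else real ell \<le> real m / 2) \<and>
          G = double_row_mat (power_row ell x))
       \<or>
       (\<exists>l L \<xi> x. even m \<and> ell = 2 * l + 1 \<and>
          subfield L (class_ring :: 'a ring) \<and> card L = q\<^sup>2 \<and>
          L = span_over K (field_module TYPE('a)) {1, \<xi>} \<and>
          x \<notin> L \<and>
          real l < real (ext_degree L (adjoin L x)) / 2 \<and>
          G = double_row_mat (quad_power_row l \<xi> x))))"
proof -
  have K: "subfld K" by fact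
  have dimF: "vdim K (UNIV :: 'a set) = m" using assms(3,4) by (intro vdim_eqI[OF K]) simp
  have lm: "2 * ell \<le> vdim K (UNIV :: 'a set)" using assms(8) dimF by simp
  have deg: "ext_degree E (adjoin E x) = vdim E (adjoin E x)" if "subfld E" for E and x :: 'a
    unfolding ext_degree_def
    using dim_over_field_module[OF that subsp_subfld[OF subfld_adjoin adjoin_incl(1)]] .
  have xi: "span_over K (field_module TYPE('a)) {1, \<xi>} = pspan K \<xi> 2" for \<xi> :: 'a
    by (rule span_over_1_xi[OF K])
  show ?thesis (is "?opt \<longleftrightarrow> ?form")
  proof
    assume opt: ?opt
    obtain c1 c2 c3 where c: "c1 \<in> C" "c2 \<in> C" "c3 \<in> C"
      "rank_weight K c1 = ell" "rank_weight K c2 = ell" "rank_weight K c3 = ell"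
      "\<not> proportional c1 c2" "\<not> proportional c1 c3" "\<not> proportional c2 c3"
      using assms(10) by blast
    obtain d1 d2 S where cb: "code_basis K (2 * ell) d1 d2 C" and S: "subsp K S" "vdim K S = ell"
      and im: "(\<lambda>k. (k \<bullet> d1, k \<bullet> d2)) ` kvecs K (2 * ell) = S \<times> S"
      by (rule three_words_imp_square[OF K assms(9,5) c])
    note cls = all_intersection_dims_classification[OF K S assms(5)
        optimal_imp_all_intersection_dims[OF K assms(5) lm opt cb S im]]
    consider (geometric) c x where "c \<noteq> 0" "x \<notin> K" "2 * ell \<le> Suc (vdim K (adjoin K x))"
        "S = (*) c ` pspan K x ell"
      | (quadratic) c E \<xi> x w where "c \<noteq> 0" "subfld E" "K \<subseteq> E" "card E = (card K)\<^sup>2" "E = pspan K \<xi> 2"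
        "x \<notin> E" "ell = 2 * w + 1" "2 * w < vdim E (adjoin E x)"
        "S = (*) c ` (pspan E x w + (*) (x ^ w) ` K)"
      using cls by blast
    then show ?form
    proof cases
      case geometric
      let ?r = "power_row ell x"
      have dim: "dim_vec ?r = ell" by (simp add: power_row_def)
      have "S = (*) c ` entry_span K ?r" using geometric(4) entry_span_power_row[OF K] by simp
      then obtain C' where C': "equivalent_codes K (2 * ell) C C'"
        "generator_matrix (2 * ell) 2 (double_row_mat ?r) C'"
        using equivalent_to_double_row[OF K dim assms(5) cb S(2) im geometric(1)] by blast
      have "if adjoin K x \<noteq> UNIV then real ell \<le> (real (ext_degree K (adjoin K x)) + 1) / 2
          else real ell \<le> real m / 2"
        using geometric(3) assms(8) unfolding deg[OF K] by auto
      then show ?form using C' geometric(2) by blast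
    next
      case quadratic
      let ?r = "quad_power_row w \<xi> x"
      have "dim_vec ?r = ell" using quadratic(7) by (simp add: quad_power_row_def)
      then obtain C' where C': "equivalent_codes K (2 * ell) C C'"
        "generator_matrix (2 * ell) 2 (double_row_mat ?r) C'"
        using equivalent_to_double_row[OF K _ assms(5) cb S(2) im quadratic(1), of ?r] quadratic(9)
          entry_span_quad_power_row[OF K quadratic(2,3,5)] by auto
      have "vdim K E = 2" using quadratic(4) by (intro vdim_eqI[OF K]) simp
      \<comment> \<open>The tower \<open>K\<close>, E, big field makes m even.\<close>
      then have "m = 2 * vdim E (UNIV :: 'a set)"
        using vdim_tower[OF K quadratic(2,3), of UNIV] dimF by (simp add: subsp_def)
      then have "even m" by simp
      moreover have "real w < real (ext_degree E (adjoin E x)) / 2"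
        using quadratic(8) unfolding deg[OF quadratic(2)] by simp
      moreover have "card E = q\<^sup>2" using quadratic(4) assms(3) by simp
      moreover have "E = span_over K (field_module TYPE('a)) {1, \<xi>}" using quadratic(5) xi by simp
      ultimately show ?form using C' quadratic(2,6,7) by blast
    qed
  next
    assume ?form
    then obtain C' G where eq: "equivalent_codes K (2 * ell) C C'"
      and G: "generator_matrix (2 * ell) 2 G C'"
      and alt: "(\<exists>x. x \<notin> K \<and>
          (if adjoin K x \<noteq> UNIV
           then real ell \<le> (real (ext_degree K (adjoin K x)) + 1) / 2
           else real ell \<le> real m / 2) \<and>
          G = double_row_mat (power_row ell x))
       \<or>
       (\<exists>l L \<xi> x. even m \<and> ell = 2 * l + 1 \<and>
          subfield L (class_ring :: 'a ring) \<and> card L = q\<^sup>2 \<and>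
          L = span_over K (field_module TYPE('a)) {1, \<xi>} \<and>
          x \<notin> L \<and>
          real l < real (ext_degree L (adjoin L x)) / 2 \<and>
          G = double_row_mat (quad_power_row l \<xi> x))" by blast
    from alt show ?opt
    proof (elim disjE exE conjE)
      fix x assume bd: "if adjoin K x \<noteq> UNIV
           then real ell \<le> (real (ext_degree K (adjoin K x)) + 1) / 2
           else real ell \<le> real m / 2" and Gx: "G = double_row_mat (power_row ell x)"
      \<comment> \<open>If x generates the big field, its degree is m and the first alternative is 2
        ell \<le> m; otherwise the fraction is cleared.\<close>
      have "2 * ell \<le> vdim K (adjoin K x) \<or>
          adjoin K x \<noteq> UNIV \<and> 2 * ell \<le> Suc (vdim K (adjoin K x))"
      proof (cases "adjoin K x = UNIV")
        case True then show ?thesis using lm by simp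
      next
        case False
        then have "real ell \<le> (real (vdim K (adjoin K x)) + 1) / 2" using bd deg[OF K] by simp
        then have "real (2 * ell) \<le> real (Suc (vdim K (adjoin K x)))" by simp
        then have "2 * ell \<le> Suc (vdim K (adjoin K x))" by (simp only: of_nat_le_iff)
        then show ?thesis using False by blast
      qed
      then show ?opt
        using geometric_full_spectrum[OF K, of ell x] G[unfolded Gx] entry_span_power_row[OF K, of ell x]
        by (intro optimal_of_equivalent_double_row[OF K _ assms(5) lm assms(9) eq])
          (auto simp: power_row_def)
    next
      fix l L \<xi> x assume h: "ell = 2 * l + 1" "subfld L" "card L = q\<^sup>2"
        "L = span_over K (field_module TYPE('a)) {1, \<xi>}" "real l < real (ext_degree L (adjoin L x)) / 2"
        "G = double_row_mat (quad_power_row l \<xi> x)"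
      have L: "L = pspan K \<xi> 2" using h(4) xi by simp
      have KL: "K \<subseteq> L"
        unfolding L using pspan_mono[OF K, of 1 2 \<xi>] by (simp add: set_plus_def)
      have "real (2 * l) < real (vdim L (adjoin L x))" using h(5) deg[OF h(2)] by simp
      then have bd: "2 * l < vdim L (adjoin L x)" by linarith
      let ?r = "quad_power_row l \<xi> x"
      have dim: "dim_vec ?r = ell" using h(1) by (simp add: quad_power_row_def)
      have cL: "card L = (card K)\<^sup>2" using h(3) assms(3) by simp
      show ?opt
      proof (rule optimal_of_equivalent_double_row[OF K dim assms(5) lm assms(9) eq G[unfolded h(6)]])
        fix w assume "ell \<le> w" "w \<le> 2 * ell"
        then show "\<exists>a b. vdim K ((*) a ` entry_span K ?r + (*) b ` entry_span K ?r) = w"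
          using quadratic_full_spectrum[OF K h(2) cL L bd entry_span_quad_power_row[OF K h(2) KL L], of w] h(1)
          by simp
      qed
    qed
  qed
qed

end
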